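(* Let $E\subset\Omega$ be a set with $C^2$ boundary. Then $$F(\chi_E)=\int_{\partial E\cap\Omega} f(\kappa_E(x))\,d\mathcal{H}^1(x),$$ where $\chi_E$ is the characteristic function of $E$ and $\kappa_E$ is the curvature of $\partial E$.
   Context: $\Omega\subset\mathbb{R}^2$ is a bounded open domain with Lipschitz boundary; $\mathbb{S}^1=\mathbb{R}/2\pi\mathbb{Z}$. For $\theta\in\mathbb{S}^1$, $\underline{\theta}=(\cos\theta,\sin\theta)$. Vectors of $\mathbb{R}^3$ are written $p=(p^x,p^\theta)$ with $p^x\in\mathbb{R}^2$, $p^\theta\in\mathbb{R}$. For $x\in\mathbb{R}^2$, $x^\perp=(x_2,-x_1)$. $f:\mathbb{R}\to[0,+\infty]$ is convex and lower semicontinuous, and there is $\gamma>0$ with $f(t)\ge\gamma\sqrt{1+t^2}$ for all $t\in\mathbb{R}$. Its recession function is $f^\infty(t)=\lim_{s\to+\infty}\frac1s f(st)$. Define for $\theta\in\mathbb{S}^1$, $p\in\mathbb{R}^3$: $h(\theta,p)=|p^x|f(p^\theta/|p^x|)$ if $p^x\neq0$ and $p^x\in\mathbb{R}_+\underline{\theta}$; $h(\theta,p)=f^\infty(p^\theta)$ if $p^x=0$; $h(\theta,p)=+\infty$ otherwise. $\mathcal{M}^1(\Omega\times\mathbb{S}^1;\mathbb{R}^3)$ is the space of bounded $\mathbb{R}^3$-valued Radon measures on $\Omega\times\mathbb{S}^1$. For such $\sigma=(\sigma^x,\sigma^\theta)$, $\int_{\Omega\times\mathbb{S}^1}h(\theta,\sigma):=\int_{\Omega\times\mathbb{S}^1}h\big(\theta,\frac{\sigma}{|\sigma|}\big)\,d|\sigma|$,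 where $\sigma/|\sigma|$ is the density of $\sigma$ with respect to its total variation $|\sigma|$. $\mathrm{div}\,\sigma=0$ means $\int\nabla\psi\cdot d\sigma=0$ for all $\psi\in C_c^1(\Omega\times\mathbb{S}^1)$. For $u\in L^1(\Omega)$, $$F(u)=\inf\Big\{\int_{\Omega\times\mathbb{S}^1}h(\theta,\sigma)\ :\ \sigma\in\mathcal{M}^1(\Omega\times\mathbb{S}^1;\mathbb{R}^3),\ \mathrm{div}\,\sigma=0,\ \int_{\mathbb{S}^1}\sigma^x\,d\theta=Du^\perp\Big\}$$ ($\inf\emptyset=+\infty$), where the last constraint means: for all $\varphi\in C_c^1(\Omega;\mathbb{R}^2)$, $\int_{\Omega\times\mathbb{S}^1}\varphi(x)^\perp\cdot d\sigma^x=-\int_\Omega u\,\mathrm{div}\,\varphi\,dx$. Curvature: $\partial E$ is oriented with $E$ on its left, and $\kappa_E=d\theta/ds$ is the derivative of the tangent angle with respect to arclength (so $\kappa_E\ge0$ where $E$ is convex). *)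

theory Defs
  imports "HOL-Analysis.Analysis"
begin

section \<open>Plane geometry and domains\<close>

definition angle_vec :: "real \<Rightarrow> real ^ 2" where
  "angle_vec \<theta> = vector [cos \<theta>, sin \<theta>]"

(* Clockwise rotation by a right angle. *)
definition perp :: "real ^ 2 \<Rightarrow> real ^ 2" where
  "perp x = vector [x $ 2, - x $ 1]"

(* Near each boundary point, in a rotated orthonormal frame (angle_vec a, angle_vec (a + pi/2)),
   the set is the part lying above the graph of a Lipschitz function. *)
definition lipschitz_boundary :: "(real ^ 2) set \<Rightarrow> bool" where
  "lipschitz_boundary \<Omega> \<longleftrightarrow>
    (\<forall>x0\<in>frontier \<Omega>. \<exists>r a g L. 0 < r \<and> L-lipschitz_on UNIV g \<and>
      (\<forall>x\<in>ball x0 r. x \<in> \<Omega> \<longleftrightarrow> g (x \<bullet> angle_vec a) < x \<bullet> angle_vec (a + pi / 2)))"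

definition lipschitz_domain :: "(real ^ 2) set \<Rightarrow> bool" where
  "lipschitz_domain \<Omega> \<longleftrightarrow> open \<Omega> \<and> connected \<Omega> \<and> bounded \<Omega> \<and> lipschitz_boundary \<Omega>"

definition C2_function :: "(real \<Rightarrow> real) \<Rightarrow> bool" where
  "C2_function g \<longleftrightarrow> (\<exists>g' g''.
      (\<forall>t. (g has_real_derivative g' t) (at t)) \<and>
      (\<forall>t. (g' has_real_derivative g'' t) (at t)) \<and>
      continuous_on UNIV g'')"

(* The boundary of E relative to \<Omega> is of class C^2: the set is locally the part above a C^2 graph.
   Whether points of the boundary itself belong to E is left free, so that open and closed sets
   are both covered; the boundary is not constrained on the complement of \<Omega>. *)
definition C2_boundary_in :: "(real ^ 2) set \<Rightarrow> (real ^ 2) set \<Rightarrow> bool" where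
  "C2_boundary_in \<Omega> E \<longleftrightarrow>
    (\<forall>x0\<in>frontier E \<inter> \<Omega>. \<exists>r a g. 0 < r \<and> C2_function g \<and>
      (\<forall>x\<in>ball x0 r.
        (g (x \<bullet> angle_vec a) < x \<bullet> angle_vec (a + pi / 2) \<longrightarrow> x \<in> E) \<and>
        (x \<bullet> angle_vec (a + pi / 2) < g (x \<bullet> angle_vec a) \<longrightarrow> x \<notin> E)))"

(* c is a local arclength parametrisation of the boundary of E with tangent angle \<phi>,
   having E on its left. *)
definition oriented_boundary_arc ::
    "(real ^ 2) set \<Rightarrow> (real \<Rightarrow> real ^ 2) \<Rightarrow> (real \<Rightarrow> real) \<Rightarrow> real \<Rightarrow> bool" where
  "oriented_boundary_arc E c \<phi> \<delta> \<longleftrightarrow> 0 < \<delta> \<and>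
    (\<forall>s\<in>{-\<delta><..<\<delta>}.
      c s \<in> frontier E \<and>
      (c has_vector_derivative angle_vec (\<phi> s)) (at s) \<and>
      (\<forall>\<^sub>F t in at_right 0. c s + t *\<^sub>R angle_vec (\<phi> s + pi / 2) \<in> E \<and>
                             c s - t *\<^sub>R angle_vec (\<phi> s + pi / 2) \<notin> E))"

definition curvature :: "(real ^ 2) set \<Rightarrow> real ^ 2 \<Rightarrow> real" where
  "curvature E x = (THE k. \<exists>c \<phi> \<delta>. oriented_boundary_arc E c \<phi> \<delta> \<and> c 0 = x \<and>
                                  (\<phi> has_real_derivative k) (at 0))"


section \<open>One-dimensional Hausdorff measure\<close>

(* Boundedness of the covering sets is required because diameter is unspecified on unbounded sets. *)
definition hausdorff1_pre :: "real \<Rightarrow> 'a::metric_space set \<Rightarrow> ennreal" where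
  "hausdorff1_pre \<delta> A =
    (INF C \<in> {C :: nat \<Rightarrow> 'a set. A \<subseteq> (\<Union>i. C i) \<and> (\<forall>i. bounded (C i) \<and> diameter (C i) \<le> \<delta>)}.
      \<Sum>i. ennreal (diameter (C i)))"

definition hausdorff1 :: "'a::metric_space measure" where
  "hausdorff1 = measure_of UNIV (sets borel) (\<lambda>A. SUP \<delta>\<in>{0<..}. hausdorff1_pre \<delta> A)"


section \<open>Bounded vector-valued measures\<close>

(* The measure M only supplies the \<sigma>-algebra. *)
definition total_variation :: "'a measure \<Rightarrow> ('a set \<Rightarrow> 'b::real_normed_vector) \<Rightarrow> 'a measure" where
  "total_variation M \<sigma> = measure_of (space M) (sets M)
    (\<lambda>A. SUP P \<in> {P. finite P \<and> partition_on A P \<and> P \<subseteq> sets M}. \<Sum>B\<in>P. ennreal (norm (\<sigma> B)))"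

definition bounded_vector_measure ::
    "'a measure \<Rightarrow> ('a set \<Rightarrow> 'b::real_normed_vector) \<Rightarrow> bool" where
  "bounded_vector_measure M \<sigma> \<longleftrightarrow>
    (\<forall>A :: nat \<Rightarrow> 'a set. range A \<subseteq> sets M \<longrightarrow> disjoint_family A \<longrightarrow>
        (\<lambda>i. \<sigma> (A i)) sums \<sigma> (\<Union>i. A i)) \<and>
    emeasure (total_variation M \<sigma>) (space M) < \<infinity>"

definition polar_density ::
    "'a measure \<Rightarrow> ('a set \<Rightarrow> 'b::euclidean_space) \<Rightarrow> 'a \<Rightarrow> 'b" where
  "polar_density M \<sigma> = (SOME g. integrable (total_variation M \<sigma>) g \<and>
      (\<forall>A\<in>sets M. \<sigma> A = (LINT z:A|total_variation M \<sigma>. g z)))"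

definition vector_integral ::
    "'a measure \<Rightarrow> ('a \<Rightarrow> 'b) \<Rightarrow> ('a set \<Rightarrow> 'b::euclidean_space) \<Rightarrow> real" where
  "vector_integral M \<Phi> \<sigma> = (LINT z|total_variation M \<sigma>. \<Phi> z \<bullet> polar_density M \<sigma> z)"


section \<open>The functional\<close>

definition convex_fun :: "(real \<Rightarrow> ennreal) \<Rightarrow> bool" where
  "convex_fun f \<longleftrightarrow> (\<forall>s t. \<forall>u\<in>{0<..<1}.
      f ((1 - u) * s + u * t) \<le> ennreal (1 - u) * f s + ennreal u * f t)"

definition lsc_fun :: "(real \<Rightarrow> ennreal) \<Rightarrow> bool" where
  "lsc_fun f \<longleftrightarrow> (\<forall>t. f t \<le> Liminf (at t) f)"

definition recession :: "(real \<Rightarrow> ennreal) \<Rightarrow> real \<Rightarrow> ennreal" where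
  "recession f t = Lim at_top (\<lambda>s. f (s * t) / ennreal s)"

definition lifted_density :: "(real \<Rightarrow> ennreal) \<Rightarrow> real \<Rightarrow> (real ^ 2) \<times> real \<Rightarrow> ennreal" where
  "lifted_density f \<theta> p =
    (if fst p = 0 then recession f (snd p)
     else if \<exists>r\<ge>0. fst p = r *\<^sub>R angle_vec \<theta>
          then ennreal (norm (fst p)) * f (snd p / norm (fst p))
     else \<infinity>)"

(* The circle \<real>/2\<pi>\<int> is represented by the fundamental domain [0, 2\<pi>), which has the same Borel sets;
   its topology enters only through the test functions, which are 2\<pi>-periodic in the angle. *)
definition phase_space :: "(real ^ 2) set \<Rightarrow> ((real ^ 2) \<times> real) measure" where
  "phase_space \<Omega> = restrict_space borel (\<Omega> \<times> {0..<2 * pi})"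

(* \<psi> belongs to C_c^1(\<Omega> \<times> \<real>/2\<pi>\<int>), extended by zero outside \<Omega>, and G is its gradient. *)
definition phase_test_fun ::
    "(real ^ 2) set \<Rightarrow> ((real ^ 2) \<times> real \<Rightarrow> real) \<Rightarrow> ((real ^ 2) \<times> real \<Rightarrow> (real ^ 2) \<times> real) \<Rightarrow> bool"
  where
  "phase_test_fun \<Omega> \<psi> G \<longleftrightarrow>
    (\<forall>z. GDERIV \<psi> z :> G z) \<and> continuous_on UNIV G \<and>
    (\<forall>x \<theta>. \<psi> (x, \<theta> + 2 * pi) = \<psi> (x, \<theta>)) \<and>
    (\<exists>K. compact K \<and> K \<subseteq> \<Omega> \<and> (\<forall>x \<theta>. x \<notin> K \<longrightarrow> \<psi> (x, \<theta>) = 0))"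

definition divergence_free ::
    "(real ^ 2) set \<Rightarrow> (((real ^ 2) \<times> real) set \<Rightarrow> (real ^ 2) \<times> real) \<Rightarrow> bool" where
  "divergence_free \<Omega> \<sigma> \<longleftrightarrow>
    (\<forall>\<psi> G. phase_test_fun \<Omega> \<psi> G \<longrightarrow> vector_integral (phase_space \<Omega>) G \<sigma> = 0)"

(* \<phi> belongs to C_c^1(\<Omega>; \<real>\<^sup>2), extended by zero outside \<Omega>, and J is its Jacobian matrix,
   so that trace (J x) is the divergence. *)
definition plane_test_field ::
    "(real ^ 2) set \<Rightarrow> (real ^ 2 \<Rightarrow> real ^ 2) \<Rightarrow> (real ^ 2 \<Rightarrow> real ^ 2 ^ 2) \<Rightarrow> bool" where
  "plane_test_field \<Omega> \<phi> J \<longleftrightarrow>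
    (\<forall>x. (\<phi> has_derivative (\<lambda>v. J x *v v)) (at x)) \<and> continuous_on UNIV J \<and>
    (\<exists>K. compact K \<and> K \<subseteq> \<Omega> \<and> (\<forall>x. x \<notin> K \<longrightarrow> \<phi> x = 0))"

definition marginal_is_rotated_gradient ::
    "(real ^ 2) set \<Rightarrow> (real ^ 2 \<Rightarrow> real) \<Rightarrow> (((real ^ 2) \<times> real) set \<Rightarrow> (real ^ 2) \<times> real) \<Rightarrow> bool"
  where
  "marginal_is_rotated_gradient \<Omega> u \<sigma> \<longleftrightarrow>
    (\<forall>\<phi> J. plane_test_field \<Omega> \<phi> J \<longrightarrow>
      vector_integral (phase_space \<Omega>) (\<lambda>z. (perp (\<phi> (fst z)), 0)) \<sigma>
        = - (LINT x:\<Omega>|lebesgue. u x * trace (J x)))"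

definition lifted_energy ::
    "(real \<Rightarrow> ennreal) \<Rightarrow> (real ^ 2) set \<Rightarrow> (((real ^ 2) \<times> real) set \<Rightarrow> (real ^ 2) \<times> real) \<Rightarrow> ennreal"
  where
  "lifted_energy f \<Omega> \<sigma> =
    (\<integral>\<^sup>+ z. lifted_density f (snd z) (polar_density (phase_space \<Omega>) \<sigma> z)
      \<partial>total_variation (phase_space \<Omega>) \<sigma>)"

(* Meant for u integrable over \<Omega>. *)
definition roto_translation_energy ::
    "(real \<Rightarrow> ennreal) \<Rightarrow> (real ^ 2) set \<Rightarrow> (real ^ 2 \<Rightarrow> real) \<Rightarrow> ennreal" where
  "roto_translation_energy f \<Omega> u =
    Inf {lifted_energy f \<Omega> \<sigma> | \<sigma>.
      bounded_vector_measure (phase_space \<Omega>) \<sigma> \<and> divergence_free \<Omega> \<sigma> \<and>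
      marginal_is_rotated_gradient \<Omega> u \<sigma>}"

end

theory Submission
  imports Defs
begin

text \<open>
  The identity is proved by two inequalities. Both rest on charts, in which \<open>E\<close> is the region above the
  graph of a \<open>C\<^sup>2\<close> function. In a chart, the curvature of the boundary is the derivative of the tangent
  angle of the graph with respect to arclength (\<open>curvature_eq\<close>), its length measure is the speed of the
  graph times Lebesgue measure (\<open>hausdorff1_graph\<close>), and the divergence theorem holds
  (\<open>divergence_above_graph\<close>).

  Upper bound (\<open>energy_le\<close>). The boundary lifts to a curve in phase space, by adding its tangent angle.
  The measure carried by this curve, with its velocity as density, is admissible: the integral of a
  gradient along it vanishes, and its spatial marginal is the rotated gradient of the indicator of \<open>E\<close>
  by the divergence theorem. As the velocity at unit speed is the unit tangent together with the
  curvature, the energy of this measure is the integral of \<open>f (curvature)\<close>.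

  Lower bound (\<open>energy_ge\<close>). An admissible measure \<open>\<sigma>\<close> may have mass outside of the boundary, and over
  the boundary it may contain pieces that cancel in the marginal. However, its part on the lifted
  boundary alone already has enough energy. Inserting into the constraints test functions that
  concentrate on lower dimensional sets shows three things. Finite energy forces the spatial part of
  \<open>\<sigma>\<close> to point in the direction given by the angle. Over the boundary, \<open>\<sigma>\<close> cannot move across it, since
  a normal component would produce divergence; thus the angle is the tangent angle or the opposite
  one (\<open>polar_tangential\<close>). On the lifted boundary, the same argument transversally to the lift shows
  that the angle turns at the rate prescribed by the curvature (\<open>lift_curvature\<close>). Finally, the
  marginal constraint says that the spatial parts at the two angles add up to the unit tangent times
  length, so the part with the correct orientation has at least density one with respect to length
  (\<open>lift_length_le\<close>). Hence the energy on the lifted boundary is at least the integral of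
  \<open>f (curvature)\<close>, and everything else contributes a nonnegative amount.

  These concentration arguments take the place of a calibration or of a decomposition of \<open>\<sigma>\<close> into
  curves. They presuppose that \<open>\<sigma>\<close> has a density with respect to its total variation
  (\<open>polar_density\<close>) and that length is a measure on Borel sets
  (\<open>measure_space_hausdorff1_outer\<close>).
\<close>

section \<open>One-dimensional Hausdorff measure\<close>

text \<open>The set function behind \<open>hausdorff1\<close>, on arbitrary sets, where Caratheodory's theory applies.
  Its countable additivity on Borel sets is what makes \<open>hausdorff1\<close> differ from the zero measure.\<close>

definition hausdorff1_outer :: "'a::metric_space set \<Rightarrow> ennreal" where
  "hausdorff1_outer A = (SUP \<delta>\<in>{0<..}. hausdorff1_pre \<delta> A)"

lemma hausdorff1_pre_le:
  assumes "A \<subseteq> (\<Union>i. C i)" "\<And>i::nat. bounded (C i)" "\<And>i. diameter (C i) \<le> \<delta>"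
  shows "hausdorff1_pre \<delta> A \<le> (\<Sum>i. ennreal (diameter (C i)))"
  unfolding hausdorff1_pre_def using assms by (intro INF_lower) auto

lemma hausdorff1_pre_antimono:
  assumes "\<delta> \<le> \<delta>'" shows "hausdorff1_pre \<delta>' A \<le> hausdorff1_pre \<delta> A"
  unfolding hausdorff1_pre_def using assms
  by (intro INF_superset_mono) (auto intro: order_trans)

lemma hausdorff1_pre_countably_subadditive:
  fixes A :: "nat \<Rightarrow> 'a::metric_space set"
  shows "hausdorff1_pre \<delta> (\<Union>i. A i) \<le> (\<Sum>i. hausdorff1_pre \<delta> (A i))"
proof (rule ennreal_le_epsilon)
  fix e :: real assume e: "0 < e" and fin: "(\<Sum>i. hausdorff1_pre \<delta> (A i)) < top"
  have finA: "hausdorff1_pre \<delta> (A i) < top" for i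
    using fin by (rule ennreal_suminf_lessD)
  have "\<exists>C. A i \<subseteq> (\<Union>j. C j) \<and> (\<forall>j::nat. bounded (C j) \<and> diameter (C j) \<le> \<delta>) \<and>
      (\<Sum>j. ennreal (diameter (C j))) \<le> hausdorff1_pre \<delta> (A i) + ennreal (e * (1/2)^Suc i)" for i
  proof -
    have "hausdorff1_pre \<delta> (A i) < hausdorff1_pre \<delta> (A i) + ennreal (e * (1/2)^Suc i)"
      using finA[of i] e by (auto simp: ennreal_add_left_cancel_less[of _ 0, simplified] ennreal_less_zero_iff)
    then obtain C where "A i \<subseteq> (\<Union>j. C j)" "\<forall>j::nat. bounded (C j) \<and> diameter (C j) \<le> \<delta>"
      "(\<Sum>j. ennreal (diameter (C j))) < hausdorff1_pre \<delta> (A i) + ennreal (e * (1/2)^Suc i)"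
      by (subst (asm) (1) hausdorff1_pre_def) (auto simp: INF_less_iff)
    then show ?thesis by (blast intro: less_imp_le)
  qed
  then obtain C where C: "\<And>i. A i \<subseteq> (\<Union>j. C i j)" "\<And>i j::nat. bounded (C i j)"
      "\<And>i j. diameter (C i j) \<le> \<delta>"
      "\<And>i. (\<Sum>j. ennreal (diameter (C i j))) \<le> hausdorff1_pre \<delta> (A i) + ennreal (e * (1/2)^Suc i)"
    by metis
  have "hausdorff1_pre \<delta> (\<Union>i. A i) \<le> (\<Sum>n. ennreal (diameter (case prod_decode n of (i, j) \<Rightarrow> C i j)))"
  proof (rule hausdorff1_pre_le)
    show "(\<Union>i. A i) \<subseteq> (\<Union>n. case prod_decode n of (i, j) \<Rightarrow> C i j)"
    proof
      fix x assume "x \<in> (\<Union>i. A i)"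
      then obtain i j where "x \<in> C i j" using C(1) by blast
      then show "x \<in> (\<Union>n. case prod_decode n of (i, j) \<Rightarrow> C i j)"
        by (intro UN_I[of "prod_encode (i, j)"]) auto
    qed
  qed (auto split: prod.split simp: C)
  also have "\<dots> = (\<Sum>i. \<Sum>j. ennreal (diameter (C i j)))"
    using suminf_ennreal_2dimen[of "\<lambda>i. \<Sum>j. ennreal (diameter (C i j))" "\<lambda>(i,j). ennreal (diameter (C i j))"]
    by (simp add: o_def split_def)
  also have "\<dots> \<le> (\<Sum>i. hausdorff1_pre \<delta> (A i) + ennreal (e * (1/2)^Suc i))"
    by (intro suminf_le C summableI)
  also have "\<dots> = (\<Sum>i. hausdorff1_pre \<delta> (A i)) + (\<Sum>i. ennreal (e * (1/2)^Suc i))"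
    by (intro suminf_add[symmetric] summableI)
  also have "(\<Sum>i. ennreal (e * (1/2)^Suc i)) = ennreal e"
    using sums_mult[OF power_half_series, of e] e by (subst suminf_ennreal_eq) auto
  finally show "hausdorff1_pre \<delta> (\<Union>i. A i) \<le> (\<Sum>i. hausdorff1_pre \<delta> (A i)) + ennreal e" .
qed

lemma hausdorff1_outer_mono: "A \<subseteq> B \<Longrightarrow> hausdorff1_outer A \<le> hausdorff1_outer B"
  unfolding hausdorff1_outer_def hausdorff1_pre_def
  by (intro SUP_mono' INF_superset_mono) auto

lemma hausdorff1_outer_empty [simp]: "hausdorff1_outer {} = 0"
proof -
  have "hausdorff1_pre \<delta> {} \<le> 0" if "0 < \<delta>" for \<delta>
    using hausdorff1_pre_le[of "{}" "\<lambda>_. {}" \<delta>] that by simp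
  then show ?thesis unfolding hausdorff1_outer_def
    by (intro antisym SUP_least) auto
qed

lemma hausdorff1_outer_countably_subadditive:
  "hausdorff1_outer (\<Union>i::nat. A i) \<le> (\<Sum>i. hausdorff1_outer (A i))"
  unfolding hausdorff1_outer_def[of "\<Union>i. A i"]
proof (rule SUP_least)
  fix \<delta> :: real assume "\<delta> \<in> {0<..}"
  then have "hausdorff1_pre \<delta> (A i) \<le> hausdorff1_outer (A i)" for i
    unfolding hausdorff1_outer_def by (intro SUP_upper)
  then show "hausdorff1_pre \<delta> (\<Union>i. A i) \<le> (\<Sum>i. hausdorff1_outer (A i))"
    by (intro order_trans[OF hausdorff1_pre_countably_subadditive] suminf_le summableI)
qed

lemma hausdorff1_outer_measure: "outer_measure_space UNIV (hausdorff1_outer :: 'a::metric_space set \<Rightarrow> _)"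
  unfolding outer_measure_space_def positive_def increasing_def countably_subadditive_def
  by (auto intro: hausdorff1_outer_mono hausdorff1_outer_countably_subadditive)

lemma hausdorff1_outer_subadditive:
  "hausdorff1_outer (A \<union> B) \<le> hausdorff1_outer A + hausdorff1_outer B"
proof -
  have "hausdorff1_outer (\<Union>i. binaryset A B i) \<le> (\<Sum>i. hausdorff1_outer (binaryset A B i))"
    by (rule hausdorff1_outer_countably_subadditive)
  then show ?thesis
    by (simp add: UN_binaryset_eq suminf_binaryset_eq)
qed

text \<open>A set of diameter at most \<open>\<delta>\<close> meets at most one of two sets at distance more than \<open>\<delta>\<close>. So a
  cover of the union splits into a cover of each of them.\<close>

lemma hausdorff1_pre_separated:
  assumes sep: "\<And>x y. x \<in> A \<Longrightarrow> y \<in> B \<Longrightarrow> \<delta> < dist x y"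
  shows "hausdorff1_pre \<delta> A + hausdorff1_pre \<delta> B \<le> hausdorff1_pre \<delta> (A \<union> B)"
  unfolding hausdorff1_pre_def[of _ "A \<union> B"]
proof (rule INF_greatest)
  fix C assume "C \<in> {C :: nat \<Rightarrow> 'a set. A \<union> B \<subseteq> (\<Union>i. C i) \<and> (\<forall>i. bounded (C i) \<and> diameter (C i) \<le> \<delta>)}"
  then have C: "A \<union> B \<subseteq> (\<Union>i. C i)" "\<And>i. bounded (C i)" "\<And>i. diameter (C i) \<le> \<delta>" by auto
  define CA where "CA i = (if C i \<inter> A = {} then {} else C i)" for i
  define CB where "CB i = (if C i \<inter> B = {} then {} else C i)" for i
  have \<delta>: "0 \<le> \<delta>" using C(3)[of 0] diameter_ge_0[OF C(2)[of 0]] by linarith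
  have "hausdorff1_pre \<delta> A \<le> (\<Sum>i. ennreal (diameter (CA i)))"
    using C \<delta> by (intro hausdorff1_pre_le) (auto simp: CA_def, blast+)
  moreover have "hausdorff1_pre \<delta> B \<le> (\<Sum>i. ennreal (diameter (CB i)))"
    using C \<delta> by (intro hausdorff1_pre_le) (auto simp: CB_def, blast+)
  moreover have "ennreal (diameter (CA i)) + ennreal (diameter (CB i)) \<le> ennreal (diameter (C i))" for i
  proof (cases "C i \<inter> A = {} \<or> C i \<inter> B = {}")
    case False
    then obtain x y where "x \<in> C i" "x \<in> A" "y \<in> C i" "y \<in> B" by blast
    then have "dist x y \<le> \<delta>" "\<delta> < dist x y"
      using diameter_bounded_bound[OF C(2), of x i y] C(3)[of i] sep by (auto intro: order_trans)
    then show ?thesis by simp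
  qed (auto simp: CA_def CB_def)
  ultimately show "hausdorff1_pre \<delta> A + hausdorff1_pre \<delta> B \<le> (\<Sum>i. ennreal (diameter (C i)))"
    by (intro order_trans[OF add_mono order_trans[OF eq_refl[OF suminf_add] suminf_le]] summableI)
qed

lemma hausdorff1_outer_separated:
  assumes d: "0 < d" and sep: "\<And>x y. x \<in> A \<Longrightarrow> y \<in> B \<Longrightarrow> d \<le> dist x y"
  shows "hausdorff1_outer A + hausdorff1_outer B \<le> hausdorff1_outer (A \<union> B)"
proof -
  have "hausdorff1_pre \<delta>1 A + hausdorff1_pre \<delta>2 B \<le> hausdorff1_outer (A \<union> B)"
    if \<delta>: "\<delta>1 \<in> {0<..}" "\<delta>2 \<in> {0<..}" for \<delta>1 \<delta>2 :: real
  proof -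
  define \<delta> where "\<delta> = min (min \<delta>1 \<delta>2) (d/2)"
  have "hausdorff1_pre \<delta>1 A + hausdorff1_pre \<delta>2 B \<le> hausdorff1_pre \<delta> A + hausdorff1_pre \<delta> B"
    by (intro add_mono hausdorff1_pre_antimono) (auto simp: \<delta>_def)
  also have "\<dots> \<le> hausdorff1_pre \<delta> (A \<union> B)"
  proof (rule hausdorff1_pre_separated)
    fix x y assume "x \<in> A" "y \<in> B"
    then show "\<delta> < dist x y" using sep[of x y] d by (auto simp: \<delta>_def)
  qed
  also have "\<dots> \<le> hausdorff1_outer (A \<union> B)"
    unfolding hausdorff1_outer_def using \<delta> d by (intro SUP_upper) (auto simp: \<delta>_def)
  finally show ?thesis .
  qed
  then show ?thesis
    unfolding hausdorff1_outer_def[of A] hausdorff1_outer_def[of B]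
    by (simp add: ennreal_SUP_add_left[symmetric] ennreal_SUP_add_right SUP_le_iff)
qed

lemma ennreal_suminf_even_odd_le:
  fixes h :: "nat \<Rightarrow> ennreal"
  shows "(\<Sum>k. h k) \<le> (\<Sum>k. h (2 * k)) + (\<Sum>k. h (2 * k + 1))"
proof -
  have split: "(\<Sum>k<2*n. h k) = (\<Sum>k<n. h (2 * k)) + (\<Sum>k<n. h (2 * k + 1))" for n
    by (induction n) (auto simp: algebra_simps)
  have "(\<Sum>k<n. h k) \<le> (\<Sum>k. h (2 * k)) + (\<Sum>k. h (2 * k + 1))" for n
  proof -
    have "(\<Sum>k<n. h k) \<le> (\<Sum>k<2*n. h k)" by (intro sum_mono2) auto
    also have "\<dots> \<le> (\<Sum>k. h (2 * k)) + (\<Sum>k. h (2 * k + 1))"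
      unfolding split by (intro add_mono sum_le_suminf) auto
    finally show ?thesis .
  qed
  then show ?thesis by (intro suminf_le_const summableI)
qed

lemma ennreal_suminf_tail_small:
  fixes h :: "nat \<Rightarrow> ennreal"
  assumes "(\<Sum>k. h k) < top" "0 < (e::real)"
  obtains n where "(\<Sum>k. h (k + n)) \<le> ennreal e"
proof -
  have fin: "h k < top" for k using assms(1) by (rule ennreal_suminf_lessD)
  define r where "r k = enn2real (h k)" for k
  have h: "h k = ennreal (r k)" for k using fin[of k] by (simp add: r_def)
  have r: "summable r" "\<And>k. 0 \<le> r k"
    using assms(1) unfolding h by (auto intro!: summable_suminf_not_top simp: r_def)
  obtain n where "norm (\<Sum>k. r (k + n)) < e" using suminf_exist_split[OF assms(2) r(1)] by blast
  moreover have "(\<Sum>k. h (k + n)) = ennreal (\<Sum>k. r (k + n))"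
    unfolding h using r by (intro suminf_ennreal2) (auto simp: summable_iff_shift)
  ultimately show ?thesis using that[of n] by (auto intro!: ennreal_leI)
qed

text \<open>Caratheodory's criterion. Cutting \<open>X - S\<close> into shells according to the distance from \<open>S\<close>,
  shells of the same parity are at positive distance from each other; so their measures are summable
  and the part of \<open>X - S\<close> close to \<open>S\<close> is negligible.\<close>

lemma hausdorff1_outer_closed_split:
  fixes S X :: "'a::metric_space set"
  assumes S: "closed S"
  shows "hausdorff1_outer (X \<inter> S) + hausdorff1_outer (X - S) \<le> hausdorff1_outer X"
proof (cases "S = {} \<or> hausdorff1_outer X = top")
  case False
  then have ne: "S \<noteq> {}" and fin: "hausdorff1_outer X < top" by (auto simp: less_top)
  define d where "d x = infdist x S" for x
  have lip: "\<bar>d x - d y\<bar> \<le> dist x y" for x y unfolding d_def by (rule infdist_triangle_abs)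
  define a :: "nat \<Rightarrow> real" where "a n = 1 / (real n + 1)" for n
  have a: "0 < a n" "a (Suc n) < a n" "n \<le> m \<Longrightarrow> a m \<le> a n" for n m
    by (auto simp: a_def field_simps)
  \<comment> \<open>The shells, and the part of \<open>X\<close> at distance at least \<open>a n\<close> from \<open>S\<close>.\<close>
  define R where "R n = {x \<in> X. a (Suc n) \<le> d x \<and> d x < a n}" for n
  define T where "T n = {x \<in> X. a n \<le> d x}" for n
  have same_parity: "(\<Sum>k<n. hausdorff1_outer (R (2 * k + b))) \<le> hausdorff1_outer (\<Union>k<n. R (2 * k + b))" for n b
  proof (induction n)
    case (Suc n)
    have "(\<Sum>k<Suc n. hausdorff1_outer (R (2 * k + b)))
        \<le> hausdorff1_outer (\<Union>k<n. R (2 * k + b)) + hausdorff1_outer (R (2 * n + b))"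
      using Suc by (simp add: add_right_mono)
    also have "\<dots> \<le> hausdorff1_outer ((\<Union>k<n. R (2 * k + b)) \<union> R (2 * n + b))"
    proof (rule hausdorff1_outer_separated)
      show "0 < (if n = 0 then 1 else a (2 * n + b - 1) - a (2 * n + b))"
        using a(2)[of "2 * n + b - 1"] by (cases "2 * n + b") auto
      \<comment> \<open>For \<open>n = 0\<close> the union is empty, and any positive distance will do.\<close>
      fix x y assume "x \<in> (\<Union>k<n. R (2 * k + b))" "y \<in> R (2 * n + b)"
      then obtain k where k: "k < n" "a (Suc (2 * k + b)) \<le> d x" "d y < a (2 * n + b)"
        by (auto simp: R_def)
      have "a (2 * n + b - 1) \<le> a (Suc (2 * k + b))" using k(1) by (intro a(3)) simp
      then show "(if n = 0 then 1 else a (2 * n + b - 1) - a (2 * n + b)) \<le> dist x y"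
        using k lip[of x y] by auto
    qed
    also have "(\<Union>k<n. R (2 * k + b)) \<union> R (2 * n + b) = (\<Union>k<Suc n. R (2 * k + b))"
      by (auto simp: lessThan_Suc)
    finally show ?case .
  qed simp
  have "(\<Sum>k. hausdorff1_outer (R (2 * k + b))) \<le> hausdorff1_outer X" for b
    by (intro suminf_le_const summableI order_trans[OF same_parity] hausdorff1_outer_mono)
       (auto simp: R_def)
  from add_mono[OF this[of 0] this[of 1]]
  have "(\<Sum>k. hausdorff1_outer (R k)) \<le> hausdorff1_outer X + hausdorff1_outer X"
    using ennreal_suminf_even_odd_le[of "\<lambda>k. hausdorff1_outer (R k)"] by simp
  then have sum_fin: "(\<Sum>k. hausdorff1_outer (R k)) < top"
    using fin by (auto simp: less_top[symmetric] top_unique)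
  show ?thesis
  proof (rule ennreal_le_epsilon)
    fix e :: real assume "0 < e"
    then obtain n where n: "(\<Sum>k. hausdorff1_outer (R (k + n))) \<le> ennreal e"
      using ennreal_suminf_tail_small[OF sum_fin] by blast
    have "X - S \<subseteq> T n \<union> (\<Union>k. R (k + n))"
    proof
      fix x assume x: "x \<in> X - S"
      then have "0 < d x" using S ne by (simp add: d_def infdist_pos_not_in_closed)
      then have "\<exists>k. a k \<le> d x"
        using reals_Archimedean[of "d x"]
        by (auto simp: a_def inverse_eq_divide add.commute intro: less_imp_le)
      define m where "m = (LEAST k. a k \<le> d x)"
      have m: "a m \<le> d x" unfolding m_def using \<open>\<exists>k. a k \<le> d x\<close> by (rule LeastI_ex)
      show "x \<in> T n \<union> (\<Union>k. R (k + n))"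
      proof (cases "m \<le> n")
        case True
        then show ?thesis using a(3)[OF True] m x by (auto simp: T_def)
      next
        case False
        then obtain k where k: "m = Suc (k + n)" by (metis add.commute less_iff_Suc_add not_le add_Suc_right)
        have "\<not> a (k + n) \<le> d x" using not_less_Least[of "k + n" "\<lambda>k. a k \<le> d x"] k by (simp add: m_def)
        then show ?thesis using m k x by (auto simp: R_def)
      qed
    qed
    then have "hausdorff1_outer (X - S) \<le> hausdorff1_outer (T n) + hausdorff1_outer (\<Union>k. R (k + n))"
      by (rule order_trans[OF hausdorff1_outer_mono hausdorff1_outer_subadditive])
    also have "\<dots> \<le> hausdorff1_outer (T n) + ennreal e"
      using n hausdorff1_outer_countably_subadditive[of "\<lambda>k. R (k + n)"] by (intro add_left_mono) simp
    finally have "hausdorff1_outer (X \<inter> S) + hausdorff1_outer (X - S)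
        \<le> (hausdorff1_outer (X \<inter> S) + hausdorff1_outer (T n)) + ennreal e"
      by (simp add: add.assoc add_left_mono)
    also have "hausdorff1_outer (X \<inter> S) + hausdorff1_outer (T n) \<le> hausdorff1_outer ((X \<inter> S) \<union> T n)"
    proof (rule hausdorff1_outer_separated[OF a(1)[of n]])
      fix x y assume "x \<in> X \<inter> S" "y \<in> T n"
      then show "a n \<le> dist x y" using lip[of x y] by (auto simp: T_def d_def)
    qed
    also have "\<dots> \<le> hausdorff1_outer X" by (intro hausdorff1_outer_mono) (auto simp: T_def)
    finally show "hausdorff1_outer (X \<inter> S) + hausdorff1_outer (X - S) \<le> hausdorff1_outer X + ennreal e"
      by (simp add: add_right_mono)
  qed
qed auto

lemma measure_space_hausdorff1_outer:
  "measure_space UNIV (sets borel) (hausdorff1_outer :: 'a::metric_space set \<Rightarrow> _)"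
proof (rule measure_down[OF sigma_algebra.caratheodory_lemma[OF sigma_algebra_Pow]])
  show "outer_measure_space (Pow UNIV) (hausdorff1_outer :: 'a set \<Rightarrow> _)"
    using hausdorff1_outer_measure by simp
  interpret L: sigma_algebra UNIV "lambda_system UNIV (Pow UNIV) (hausdorff1_outer :: 'a set \<Rightarrow> _)"
    using sigma_algebra.caratheodory_lemma[OF sigma_algebra_Pow, of UNIV "hausdorff1_outer :: 'a set \<Rightarrow> _"] hausdorff1_outer_measure[where 'a='a]
    by (simp add: measure_space_def)
  have "S \<in> lambda_system UNIV UNIV hausdorff1_outer" if "closed S" for S :: "'a set"
  proof -
    have "hausdorff1_outer (S \<inter> X) + hausdorff1_outer (- S \<inter> X) = hausdorff1_outer X" for X
    proof (rule antisym)
      show "hausdorff1_outer (S \<inter> X) + hausdorff1_outer (- S \<inter> X) \<le> hausdorff1_outer X"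
        using hausdorff1_outer_closed_split[OF that, of X] by (simp add: Int_commute Diff_eq)
      have "X = (S \<inter> X) \<union> (- S \<inter> X)" by blast
      then show "hausdorff1_outer X \<le> hausdorff1_outer (S \<inter> X) + hausdorff1_outer (- S \<inter> X)"
        by (metis hausdorff1_outer_subadditive)
    qed
    then show ?thesis unfolding lambda_system_def by (simp add: Compl_eq_Diff_UNIV)
  qed
  then show "sets (borel :: 'a measure) \<subseteq> lambda_system UNIV (Pow UNIV) hausdorff1_outer"
    unfolding borel_eq_closed using L.sigma_sets_subset[of "Collect closed"] by auto
  show "sigma_algebra UNIV (sets (borel :: 'a measure))" by (metis sets.sigma_algebra_axioms space_borel)
qed

lemma sets_hausdorff1 [simp, measurable_cong]: "sets hausdorff1 = sets borel"
  unfolding hausdorff1_def by (simp add: sigma_algebra.sigma_sets_eq[OF sets.sigma_algebra_axioms, of borel, unfolded space_borel])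

lemma space_hausdorff1 [simp]: "space hausdorff1 = UNIV"
  unfolding hausdorff1_def by simp

lemma emeasure_hausdorff1: "A \<in> sets borel \<Longrightarrow> emeasure hausdorff1 A = hausdorff1_outer A"
  using measure_space_hausdorff1_outer
  by (intro emeasure_measure_of[OF hausdorff1_def[folded hausdorff1_outer_def]])
     (auto simp: measure_space_def hausdorff1_outer_def[symmetric])

text \<open>A contraction to the line sends a covering set into an interval that is no longer than its
  diameter, and these intervals cover \<open>{\<alpha>..\<beta>}\<close>.\<close>

lemma hausdorff1_outer_ge_projection:
  fixes P :: "'a::metric_space \<Rightarrow> real"
  assumes lip: "\<And>x y. \<bar>P x - P y\<bar> \<le> dist x y" and im: "{\<alpha>..\<beta>} \<subseteq> P ` A"
  shows "ennreal (\<beta> - \<alpha>) \<le> hausdorff1_outer A"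
proof -
  have "ennreal (\<beta> - \<alpha>) \<le> hausdorff1_pre 1 A"
    unfolding hausdorff1_pre_def
  proof (rule INF_greatest)
    fix C assume "C \<in> {C :: nat \<Rightarrow> 'a set. A \<subseteq> (\<Union>i. C i) \<and> (\<forall>i. bounded (C i) \<and> diameter (C i) \<le> 1)}"
    then have C: "A \<subseteq> (\<Union>i. C i)" "\<And>i. bounded (C i)" by auto
    have "\<exists>I. P ` C i \<subseteq> I \<and> I \<in> sets lborel \<and> emeasure lborel I \<le> ennreal (diameter (C i))" for i
    proof (cases "C i = {}")
      case False
      have PC: "\<bar>P x - P y\<bar> \<le> diameter (C i)" if "x \<in> C i" "y \<in> C i" for x y
        using lip[of x y] diameter_bounded_bound[OF C(2) that] by linarith
      obtain x0 where x0: "x0 \<in> C i" using False by blast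
      have bdd: "bdd_below (P ` C i)" "bdd_above (P ` C i)"
        using PC[OF _ x0]
        by (auto intro!: bdd_belowI[of _ "P x0 - diameter (C i)"] bdd_aboveI[of _ "P x0 + diameter (C i)"])
           (smt (verit))+
      define l u where "l = Inf (P ` C i)" and "u = Sup (P ` C i)"
      have "P ` C i \<subseteq> {l..u}"
        using bdd by (auto simp: l_def u_def intro!: cINF_lower cSUP_upper)
      moreover have "u \<le> l + diameter (C i)"
        unfolding u_def
      proof (rule cSup_least)
        fix y assume "y \<in> P ` C i"
        then have "y - diameter (C i) \<le> l"
          unfolding l_def using False PC by (intro cInf_greatest) (auto, smt (verit))
        then show "y \<le> l + diameter (C i)" by simp
      qed (use False in auto)
      ultimately show ?thesis by (intro exI[of _ "{l..u}"]) (auto intro!: ennreal_leI simp: emeasure_lborel_Icc_eq)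
    qed (auto intro!: exI[of _ "{}"])
    then obtain I where I: "\<And>i. P ` C i \<subseteq> I i" "\<And>i. I i \<in> sets lborel"
      "\<And>i. emeasure lborel (I i) \<le> ennreal (diameter (C i))" by metis
    have "ennreal (\<beta> - \<alpha>) \<le> emeasure lborel {\<alpha>..\<beta>}"
      by (cases "\<alpha> \<le> \<beta>") (simp_all add: ennreal_neg)
    also have "\<dots> \<le> emeasure lborel (\<Union>i. I i)"
    proof (rule emeasure_mono)
      have "P ` A \<subseteq> (\<Union>i. P ` C i)" using C(1) by blast
      also have "\<dots> \<subseteq> (\<Union>i. I i)" using I(1) by (intro UN_mono) auto
      finally show "{\<alpha>..\<beta>} \<subseteq> (\<Union>i. I i)" using im by (rule subset_trans[rotated])
      show "(\<Union>i. I i) \<in> sets lborel" using I(2) by blast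
    qed
    also have "\<dots> \<le> (\<Sum>i. emeasure lborel (I i))"
      by (rule emeasure_subadditive_countably) (simp only: image_subset_iff I(2) ball_UNIV simp_thms)
    also have "\<dots> \<le> (\<Sum>i. ennreal (diameter (C i)))" by (intro suminf_le I summableI)
    finally show "ennreal (\<beta> - \<alpha>) \<le> (\<Sum>i. ennreal (diameter (C i)))" .
  qed
  also have "\<dots> \<le> hausdorff1_outer A" unfolding hausdorff1_outer_def by (intro SUP_upper) simp
  finally show ?thesis .
qed

text \<open>The images of the parts of a fine equidistant subdivision form the cover.\<close>

lemma hausdorff1_outer_lipschitz_image:
  fixes c :: "real \<Rightarrow> 'a::real_normed_vector"
  assumes lip: "L-lipschitz_on {u..v} c" and uv: "u \<le> v"
  shows "hausdorff1_outer (c ` {u..v}) \<le> ennreal (L * (v - u))"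
  unfolding hausdorff1_outer_def
proof (rule SUP_least)
  fix \<delta> :: real assume "\<delta> \<in> {0<..}" then have \<delta>: "0 < \<delta>" by simp
  have L: "0 \<le> L" using lip by (rule lipschitz_on_nonneg)
  obtain n where n: "L * (v - u) / \<delta> < real n" using reals_Archimedean2 by blast
  have n0: "0 < n" using n L uv \<delta> by (cases n) (auto simp: divide_less_0_iff mult_less_0_iff)
  define h where "h = (v - u) / n"
  have h: "0 \<le> h" "real n * h = v - u" "L * h \<le> \<delta>"
    using uv n0 n \<delta> by (auto simp: h_def field_simps)
  define C where "C i = (if i < n then c ` {u + i * h .. u + (real i + 1) * h} else {})" for i :: nat
  have diam: "bounded (C i)" "diameter (C i) \<le> (if i < n then L * h else 0)" for i
  proof -
    have *: "dist (c s) (c t) \<le> L * h" if "i < n" "s \<in> {u + i * h .. u + (real i + 1) * h}" "t \<in> {u + i * h .. u + (real i + 1) * h}" for s t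
    proof -
      have "0 \<le> real i * h" using h by simp
      moreover have "(real i + 1) * h \<le> real n * h" using h that(1) by (intro mult_right_mono) auto
      ultimately have "s \<in> {u..v}" "t \<in> {u..v}" using that h(2) unfolding atLeastAtMost_iff
  by (simp_all only: of_nat_add of_nat_1 distrib_right) linarith+
      then have "dist (c s) (c t) \<le> L * dist s t" by (rule lipschitz_onD[OF lip])
      also have "\<dots> \<le> L * h" using that L by (intro mult_left_mono) (auto simp: dist_real_def algebra_simps)
      finally show ?thesis .
    qed
    show "diameter (C i) \<le> (if i < n then L * h else 0)"
      using * L h by (auto simp: C_def dist_norm[symmetric] intro!: diameter_le)
    show "bounded (C i)"
    proof (cases "i < n")
      case True
      then show ?thesis
        using * h by (auto simp: C_def bounded_def intro!: exI[of _ "c (u + i * h)"] exI[of _ "L * h"])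
    qed (simp add: C_def)
  qed
  have "hausdorff1_pre \<delta> (c ` {u..v}) \<le> (\<Sum>i. ennreal (diameter (C i)))"
  proof (rule hausdorff1_pre_le)
    show "c ` {u..v} \<subseteq> (\<Union>i. C i)"
    proof
      fix x assume "x \<in> c ` {u..v}"
      then obtain t where t: "x = c t" "u \<le> t" "t \<le> v" by auto
      have "\<exists>i<n. t \<in> {u + i * h .. u + (real i + 1) * h}"
      proof (cases "t = v \<or> h = 0")
        case True
        \<comment> \<open>The right end point lies in the last part; for \<open>h = 0\<close> all parts coincide.\<close>
        then have "t \<in> {u + real (n-1) * h .. u + (real (n - 1) + 1) * h}"
          using n0 h t by (auto simp: of_nat_diff algebra_simps)
        then show ?thesis using n0 by (intro exI[of _ "n - 1"]) auto
      next
        case False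
        then have h0: "0 < h" using h by auto
        define i where "i = nat \<lfloor>(t - u) / h\<rfloor>"
        have i: "real i \<le> (t - u) / h" "(t - u) / h < real i + 1"
          using t h0 by (auto simp: i_def)
        have "(t - u) / h < real n" using t False h0 h(2) by (auto simp: field_simps)
        then have "i < n" using i by linarith
        then show ?thesis using i h0 by (intro exI[of _ i]) (auto simp: field_simps)
      qed
      then obtain i where "i < n" "t \<in> {u + i * h .. u + (real i + 1) * h}" by blast
      then have "x \<in> C i" unfolding C_def t(1) by (simp only: if_True imageI)
      then show "x \<in> (\<Union>i. C i)" by blast
    qed
    show "diameter (C i) \<le> \<delta>" for i using diam(2)[of i] h(3) \<delta> by (auto split: if_splits)
  qed (rule diam)
  also have "\<dots> = (\<Sum>i<n. ennreal (diameter (C i)))"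
    by (intro suminf_finite) (auto simp: C_def)
  also have "\<dots> \<le> (\<Sum>i<n. ennreal (L * h))" using diam(2) by (intro sum_mono ennreal_leI) (metis lessThan_iff)
  also have "\<dots> = ennreal (L * (v - u))" using L h by (simp add: ennreal_of_nat_eq_real_of_nat ennreal_mult[symmetric] mult.left_commute)
  finally show "hausdorff1_pre \<delta> (c ` {u..v}) \<le> ennreal (L * (v - u))" .
qed

section \<open>Total variation and polar density of vector measures\<close>

text \<open>The set function that defines \<open>total_variation\<close>; the lemmas below show that it is a measure.\<close>

definition variation :: "'a measure \<Rightarrow> ('a set \<Rightarrow> 'b::real_normed_vector) \<Rightarrow> 'a set \<Rightarrow> ennreal" where
  "variation M \<sigma> A =
    (SUP P \<in> {P. finite P \<and> partition_on A P \<and> P \<subseteq> sets M}. \<Sum>B\<in>P. ennreal (norm (\<sigma> B)))"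

definition countably_additive_on :: "'a measure \<Rightarrow> ('a set \<Rightarrow> 'b::real_normed_vector) \<Rightarrow> bool" where
  "countably_additive_on M \<sigma> \<longleftrightarrow>
    (\<forall>A :: nat \<Rightarrow> 'a set. range A \<subseteq> sets M \<longrightarrow> disjoint_family A \<longrightarrow> (\<lambda>i. \<sigma> (A i)) sums \<sigma> (\<Union>i. A i))"

lemma countably_additive_onD:
  assumes "countably_additive_on M \<sigma>" "\<And>i. A i \<in> sets M" "disjoint_family A"
  shows "(\<lambda>i. \<sigma> (A i)) sums \<sigma> (\<Union>i. A i)"
  using assms unfolding countably_additive_on_def by blast

lemma countably_additive_on_empty:
  assumes "countably_additive_on M \<sigma>" shows "\<sigma> {} = 0"
proof -
  have "(\<lambda>i::nat. \<sigma> {}) sums \<sigma> {}"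
    using countably_additive_onD[OF assms, of "\<lambda>_. {}"] by (simp add: disjoint_family_on_def)
  then show ?thesis using sums_summable summable_const_iff by blast
qed

lemma sum_le_variation:
  assumes \<sigma>: "countably_additive_on M \<sigma>"
    and P: "finite P" "disjoint P" "P \<subseteq> sets M" "\<Union>P \<subseteq> A" and A: "A \<in> sets M"
  shows "(\<Sum>B\<in>P. ennreal (norm (\<sigma> B))) \<le> variation M \<sigma> A"
proof -
  \<comment> \<open>Complete \<open>P\<close> to a partition of \<open>A\<close>, whose members must be nonempty.\<close>
  define Q where "Q = insert (A - \<Union>P) P - {{}}"
  have Q: "finite Q" "Q \<subseteq> sets M" "\<Union>Q = A" "{} \<notin> Q"
  proof -
    have "\<Union>P \<in> sets M" using P by (intro sets.finite_Union)
    then have "A - \<Union>P \<in> sets M" using A by (rule sets.Diff[rotated])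
    then show "Q \<subseteq> sets M" unfolding Q_def using P(3) by blast
    have "\<Union>Q = (A - \<Union>P) \<union> \<Union>P" unfolding Q_def by blast
    then show "\<Union>Q = A" using P(4) by blast
  qed (use P in \<open>simp_all add: Q_def\<close>)
  have "disjoint Q"
  proof (rule disjointI)
    fix X Y assume "X \<in> Q" "Y \<in> Q" "X \<noteq> Y"
    then show "X \<inter> Y = {}" using disjointD[OF P(2), of X Y] unfolding Q_def by blast
  qed
  then have "partition_on A Q" using Q by (intro partition_onI) (auto simp: disjnt_def disjoint_def)
  have "(\<Sum>B\<in>P. ennreal (norm (\<sigma> B))) = (\<Sum>B\<in>P - {{}}. ennreal (norm (\<sigma> B)))"
    using P countably_additive_on_empty[OF \<sigma>] by (intro sum.mono_neutral_right) auto
  also have "\<dots> \<le> (\<Sum>B\<in>Q. ennreal (norm (\<sigma> B)))"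
    using Q by (intro sum_mono2) (auto simp: Q_def)
  also have "\<dots> \<le> variation M \<sigma> A"
    unfolding variation_def using Q \<open>partition_on A Q\<close> by (intro SUP_upper) auto
  finally show ?thesis .
qed

lemma norm_le_variation:
  assumes "countably_additive_on M \<sigma>" "A \<in> sets M"
  shows "ennreal (norm (\<sigma> A)) \<le> variation M \<sigma> A"
  using sum_le_variation[OF assms(1), of "{A}" A] assms(2) by (simp add: disjoint_def)

text \<open>A partition of \<open>A\<close> and one of \<open>B\<close> together form a partition of \<open>A \<union> B\<close>.\<close>

lemma variation_superadditive:
  assumes \<sigma>: "countably_additive_on M \<sigma>" and A: "A \<in> sets M" "B \<in> sets M" "A \<inter> B = {}"
  shows "variation M \<sigma> A + variation M \<sigma> B \<le> variation M \<sigma> (A \<union> B)"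
proof -
  have "(\<Sum>B\<in>P. ennreal (norm (\<sigma> B))) + (\<Sum>B\<in>Q. ennreal (norm (\<sigma> B))) \<le> variation M \<sigma> (A \<union> B)"
    if P: "finite P" "partition_on A P" "P \<subseteq> sets M" and Q: "finite Q" "partition_on B Q" "Q \<subseteq> sets M" for P Q
  proof -
    have PQ: "\<Union>P = A" "\<Union>Q = B" "{} \<notin> P" "{} \<notin> Q" "disjoint P" "disjoint Q"
      using P Q unfolding partition_on_def by auto
    have dis: "P \<inter> Q = {}" using PQ A(3) by (metis Int_iff Union_upper bot.extremum_uniqueI ex_in_conv le_inf_iff)
    have "disjoint (P \<union> Q)"
      using PQ A(3) by (intro disjoint_union) auto
    then have "(\<Sum>B\<in>P \<union> Q. ennreal (norm (\<sigma> B))) \<le> variation M \<sigma> (A \<union> B)"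
      using P Q PQ A by (intro sum_le_variation[OF \<sigma>]) auto
    then show ?thesis using P(1) Q(1) dis by (simp add: sum.union_disjoint del: sum_ennreal)
  qed
  moreover have "{P. finite P \<and> partition_on A P \<and> P \<subseteq> sets M} \<noteq> {}" if "A \<in> sets M" for A
  proof -
    have "{A} - {{}} \<in> {P. finite P \<and> partition_on A P \<and> P \<subseteq> sets M}"
      using that by (auto simp: partition_on_def disjoint_def)
    then show ?thesis by blast
  qed
  ultimately show ?thesis
    unfolding variation_def[of _ _ A] variation_def[of _ _ B] using A(1,2)
    by (simp add: ennreal_SUP_add_left[symmetric] ennreal_SUP_add_right SUP_le_iff)
qed

lemma variation_mono:
  assumes \<sigma>: "countably_additive_on M \<sigma>" and "A \<subseteq> B" "B \<in> sets M"
  shows "variation M \<sigma> A \<le> variation M \<sigma> B"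
  unfolding variation_def[of _ _ A]
  using assms(2,3) by (auto simp: partition_on_def simp del: sum_ennreal intro!: SUP_least sum_le_variation[OF \<sigma>])

lemma variation_empty:
  assumes "countably_additive_on M \<sigma>" shows "variation M \<sigma> {} = 0"
proof -
  have "P = {}" if "partition_on {} P" for P :: "'a set set"
    using that by (auto simp: partition_on_def)
  then have "{P. finite P \<and> partition_on {} P \<and> P \<subseteq> sets M} \<subseteq> {{}}" by blast
  then show ?thesis unfolding variation_def by (auto intro!: antisym SUP_least simp del: sum_ennreal)
qed

text \<open>Cutting the parts of a partition of the union by the sets \<open>A i\<close> yields partitions of these sets,
  and countable additivity of \<open>\<sigma>\<close> bounds each part by the sum over its pieces.\<close>

lemma variation_countably_subadditive:
  fixes A :: "nat \<Rightarrow> 'a set"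
  assumes \<sigma>: "countably_additive_on M \<sigma>" and A: "\<And>i. A i \<in> sets M" "disjoint_family A"
  shows "variation M \<sigma> (\<Union>i. A i) \<le> (\<Sum>i. variation M \<sigma> (A i))"
  unfolding variation_def[of _ _ "\<Union>i. A i"]
proof (rule SUP_least)
  fix P assume "P \<in> {P. finite P \<and> partition_on (\<Union>i. A i) P \<and> P \<subseteq> sets M}"
  then have P: "finite P" "\<Union>P = (\<Union>i. A i)" "disjoint P" "P \<subseteq> sets M"
    by (auto simp: partition_on_def)
  have "(\<Sum>B\<in>P. ennreal (norm (\<sigma> B))) \<le> (\<Sum>B\<in>P. \<Sum>i. ennreal (norm (\<sigma> (B \<inter> A i))))"
  proof (rule sum_mono)
    fix B assume B: "B \<in> P"
    have sums: "(\<lambda>i. \<sigma> (B \<inter> A i)) sums \<sigma> (\<Union>i. B \<inter> A i)"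
      using B P A by (intro countably_additive_onD[OF \<sigma>] disjoint_family_on_bisimulation[OF A(2)]) auto
    have UB: "(\<Union>i. B \<inter> A i) = B" using B P(2) by blast
    show "ennreal (norm (\<sigma> B)) \<le> (\<Sum>i. ennreal (norm (\<sigma> (B \<inter> A i))))"
    proof (cases "(\<Sum>i. ennreal (norm (\<sigma> (B \<inter> A i)))) = top")
      case False
      then have s: "summable (\<lambda>i. norm (\<sigma> (B \<inter> A i)))" by (intro summable_suminf_not_top) auto
      have "norm (\<sigma> B) \<le> (\<Sum>i. norm (\<sigma> (B \<inter> A i)))"
      proof (rule LIMSEQ_le_const2)
        show "(\<lambda>n. norm (\<Sum>i<n. \<sigma> (B \<inter> A i))) \<longlonglongrightarrow> norm (\<sigma> B)"
          using sums UB by (intro tendsto_norm) (simp add: sums_def)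
        have "norm (\<Sum>i<n. \<sigma> (B \<inter> A i)) \<le> (\<Sum>i. norm (\<sigma> (B \<inter> A i)))" for n
          by (rule order_trans[OF norm_sum sum_le_suminf[OF s]]) auto
        then show "\<exists>N. \<forall>n\<ge>N. norm (\<Sum>i<n. \<sigma> (B \<inter> A i)) \<le> (\<Sum>i. norm (\<sigma> (B \<inter> A i)))" by blast
      qed
      also have "ennreal \<dots> = (\<Sum>i. ennreal (norm (\<sigma> (B \<inter> A i))))" using s by (intro suminf_ennreal2[symmetric]) auto
      finally show ?thesis using ennreal_leI by blast
    qed simp
  qed
  also have "\<dots> = (\<Sum>i. \<Sum>B\<in>P. ennreal (norm (\<sigma> (B \<inter> A i))))" by (intro suminf_sum[symmetric] summableI)
  also have "\<dots> \<le> (\<Sum>i. variation M \<sigma> (A i))"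
  proof (intro suminf_le summableI)
    fix i
    let ?Q = "(\<lambda>B. B \<inter> A i) ` P"
    have inj: "x = y" if "x \<in> P" "y \<in> P" "x \<inter> A i = y \<inter> A i" "x \<inter> A i \<noteq> {}" for x y
      using P(3) that unfolding disjoint_def by blast
    have "(\<Sum>B\<in>P. ennreal (norm (\<sigma> (B \<inter> A i)))) = (\<Sum>B\<in>{B\<in>P. B \<inter> A i \<noteq> {}}. ennreal (norm (\<sigma> (B \<inter> A i))))"
      using P(1) countably_additive_on_empty[OF \<sigma>] by (intro sum.mono_neutral_right) auto
    also have "\<dots> = (\<Sum>B\<in>(\<lambda>B. B \<inter> A i) ` {B\<in>P. B \<inter> A i \<noteq> {}}. ennreal (norm (\<sigma> B)))"
      using inj by (subst sum.reindex) (auto simp: inj_on_def)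
    also have "\<dots> \<le> variation M \<sigma> (A i)"
    proof (rule sum_le_variation[OF \<sigma>])
      show "disjoint ((\<lambda>B. B \<inter> A i) ` {B\<in>P. B \<inter> A i \<noteq> {}})"
        using P(3) unfolding disjoint_def by blast
    qed (use P A in auto)
    finally show "(\<Sum>B\<in>P. ennreal (norm (\<sigma> (B \<inter> A i)))) \<le> variation M \<sigma> (A i)" .
  qed
  finally show "(\<Sum>B\<in>P. ennreal (norm (\<sigma> B))) \<le> (\<Sum>i. variation M \<sigma> (A i))" .
qed

lemma measure_space_variation:
  assumes \<sigma>: "countably_additive_on M \<sigma>"
  shows "measure_space (space M) (sets M) (variation M \<sigma>)"
proof -
  have fin: "(\<Sum>i<n. variation M \<sigma> (A i)) \<le> variation M \<sigma> (\<Union>i<n. A i)"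
    if A: "\<And>i. A i \<in> sets M" "disjoint_family A" for A :: "nat \<Rightarrow> 'a set" and n
  proof (induction n)
    case (Suc n)
    have "(\<Union>i<n. A i) \<inter> A n = {}"
      using disjoint_family_onD[OF A(2), of _ n] by fastforce
    have "(\<Sum>i<Suc n. variation M \<sigma> (A i)) \<le> variation M \<sigma> (\<Union>i<n. A i) + variation M \<sigma> (A n)"
      using Suc by (simp add: add_right_mono)
    also have "\<dots> \<le> variation M \<sigma> ((\<Union>i<n. A i) \<union> A n)"
      using A(1) \<open>_ = {}\<close> by (intro variation_superadditive[OF \<sigma>]) auto
    finally show ?case by (simp add: lessThan_Suc Un_commute)
  qed simp
  have "(\<Sum>i. variation M \<sigma> (A i)) = variation M \<sigma> (\<Union>i. A i)"
    if A: "\<And>i. A i \<in> sets M" "disjoint_family A" for A :: "nat \<Rightarrow> 'a set"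
  proof (rule antisym)
    show "(\<Sum>i. variation M \<sigma> (A i)) \<le> variation M \<sigma> (\<Union>i. A i)"
      using A by (intro suminf_le_const summableI order_trans[OF fin[OF A] variation_mono[OF \<sigma>]]) auto
  qed (rule variation_countably_subadditive[OF \<sigma> A])
  then show ?thesis
    using sets.sigma_algebra_axioms[of M] variation_empty[OF \<sigma>]
    by (auto simp: measure_space_def positive_def countably_additive_def)
qed

lemma total_variation_eq_variation: "total_variation M \<sigma> = measure_of (space M) (sets M) (variation M \<sigma>)"
  unfolding total_variation_def variation_def ..

lemma sets_total_variation [simp, measurable_cong]: "sets (total_variation M \<sigma>) = sets M"
  by (simp add: total_variation_def)

lemma space_total_variation [simp]: "space (total_variation M \<sigma>) = space M"
  by (simp add: total_variation_def)

lemma emeasure_total_variation: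
  assumes "countably_additive_on M \<sigma>" "A \<in> sets M"
  shows "emeasure (total_variation M \<sigma>) A = variation M \<sigma> A"
  using measure_space_variation[OF assms(1)] assms(2)
  by (intro emeasure_measure_of[OF total_variation_eq_variation])
     (auto simp: measure_space_def sets.space_closed)

lemma bounded_vector_measure_iff:
  "bounded_vector_measure M \<sigma> \<longleftrightarrow>
    countably_additive_on M \<sigma> \<and> emeasure (total_variation M \<sigma>) (space M) < \<infinity>"
  unfolding bounded_vector_measure_def countably_additive_on_def ..

lemma finite_measure_total_variation:
  "bounded_vector_measure M \<sigma> \<Longrightarrow> finite_measure (total_variation M \<sigma>)"
  by (auto simp: bounded_vector_measure_iff intro!: finite_measureI)

text \<open>Each component plus the total variation is a positive measure dominated by twice the total
  variation, so the Radon--Nikodym theorem for positive measures provides its density.\<close>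

lemma polar_decomposition_exists:
  fixes \<sigma> :: "'a set \<Rightarrow> 'b::euclidean_space"
  assumes bvm: "bounded_vector_measure M \<sigma>"
  shows "\<exists>g. integrable (total_variation M \<sigma>) g \<and>
    (\<forall>A\<in>sets M. \<sigma> A = (LINT z:A|total_variation M \<sigma>. g z))"
proof -
  let ?T = "total_variation M \<sigma>"
  interpret T: finite_measure ?T using bvm by (rule finite_measure_total_variation)
  have \<sigma>: "countably_additive_on M \<sigma>" using bvm by (simp add: bounded_vector_measure_iff)
  have le: "norm (\<sigma> A) \<le> measure ?T A" if "A \<in> sets M" for A
    using norm_le_variation[OF \<sigma> that] emeasure_total_variation[OF \<sigma> that]
    by (metis T.emeasure_eq_measure ennreal_le_iff measure_nonneg)
  have "\<exists>g. integrable ?T g \<and> (\<forall>A\<in>sets M. \<sigma> A \<bullet> b = (LINT z:A|?T. g z))" if b: "b \<in> Basis" for b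
  proof -
    \<comment> \<open>The density of \<open>\<mu>\<close> exceeds the wanted one by 1.\<close>
    define \<mu> where "\<mu> A = ennreal (measure ?T A + \<sigma> A \<bullet> b)" for A
    have nn: "0 \<le> measure ?T A + \<sigma> A \<bullet> b" "measure ?T A + \<sigma> A \<bullet> b \<le> 2 * measure ?T A" if "A \<in> sets M" for A
      using le[OF that] Basis_le_norm[OF b, of "\<sigma> A"] by linarith+
    have cadd: "countably_additive (sets M) \<mu>"
      unfolding countably_additive_def
    proof safe
      fix A :: "nat \<Rightarrow> 'a set" assume A: "range A \<subseteq> sets M" "disjoint_family A"
      have "(\<lambda>i. measure ?T (A i)) sums measure ?T (\<Union>i. A i)"
        using A by (intro T.finite_measure_UNION) auto
      moreover have "(\<lambda>i. \<sigma> (A i) \<bullet> b) sums (\<sigma> (\<Union>i. A i) \<bullet> b)"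
        using A by (intro bounded_linear.sums[OF bounded_linear_inner_left] countably_additive_onD[OF \<sigma>]) auto
      ultimately have "(\<lambda>i. measure ?T (A i) + \<sigma> (A i) \<bullet> b) sums (measure ?T (\<Union>i. A i) + \<sigma> (\<Union>i. A i) \<bullet> b)"
        by (rule sums_add)
      then show "(\<Sum>i. \<mu> (A i)) = \<mu> (\<Union>i. A i)"
        unfolding \<mu>_def using A nn by (intro suminf_ennreal_eq) auto
    qed
    define N where "N = measure_of (space M) (sets M) \<mu>"
    have sets_N: "sets N = sets M" by (simp add: N_def)
    have N: "emeasure N A = \<mu> A" if "A \<in> sets M" for A
      using that cadd countably_additive_on_empty[OF \<sigma>]
      by (intro emeasure_measure_of[OF N_def]) (auto simp: sets.space_closed positive_def \<mu>_def[of "{}"] sets_N)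
    have "absolutely_continuous ?T N"
      unfolding absolutely_continuous_def
    proof
      fix A assume "A \<in> null_sets ?T"
      then have A: "A \<in> sets M" "measure ?T A = 0" by (auto simp: measure_def)
      then show "A \<in> null_sets N" using nn[OF A(1)] N[OF A(1)] sets_N by (auto simp: \<mu>_def)
    qed
    then have dens: "density ?T (RN_deriv ?T N) = N"
      by (rule T.density_RN_deriv) (simp add: sets_N)
    let ?r = "\<lambda>z. enn2real (RN_deriv ?T N z)"
    have "(\<integral>\<^sup>+z. RN_deriv ?T N z \<partial>?T) = (\<integral>\<^sup>+z\<in>space M. RN_deriv ?T N z \<partial>?T)"
      by (intro nn_integral_cong) simp
    also have "\<dots> = emeasure N (space M)"
      using emeasure_density[of "RN_deriv ?T N" ?T "space M"] by (simp add: dens)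
    finally have space_fin: "(\<integral>\<^sup>+z. RN_deriv ?T N z \<partial>?T) < top"
      using N[of "space M"] by (simp add: \<mu>_def)
    then have fin: "AE z in ?T. RN_deriv ?T N z = ennreal (?r z)"
      using nn_integral_PInf_AE[of "RN_deriv ?T N" ?T] by (auto elim!: AE_mp simp: less_top)
    have int: "integrable ?T ?r"
      using space_fin fin by (intro integrableI_nonneg) (auto cong: nn_integral_cong_AE)
    have "\<sigma> A \<bullet> b = (LINT z:A|?T. (?r z - 1))" if A: "A \<in> sets M" for A
    proof -
      have "ennreal (measure ?T A + \<sigma> A \<bullet> b) = (\<integral>\<^sup>+z. RN_deriv ?T N z * indicator A z \<partial>?T)"
        using N[OF A] A by (subst (asm) dens[symmetric], subst (asm) emeasure_density) (auto simp: \<mu>_def)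
      also have "\<dots> = (\<integral>\<^sup>+z. ennreal (indicator A z * ?r z) \<partial>?T)"
        using fin by (intro nn_integral_cong_AE) (auto elim!: AE_mp split: split_indicator)
      also have "\<dots> = ennreal (LINT z:A|?T. ?r z)"
        unfolding set_lebesgue_integral_def
        using integrable_mult_indicator[OF _ int, of A] A
        by (subst nn_integral_eq_integral) auto
      finally have "measure ?T A + \<sigma> A \<bullet> b = (LINT z:A|?T. ?r z)"
        using nn[OF A] by (subst (asm) ennreal_inj) (auto simp: set_lebesgue_integral_def intro!: integral_nonneg_AE)
      moreover have "(LINT z:A|?T. (?r z - 1)) = (LINT z:A|?T. ?r z) - (LINT z:A|?T. 1)"
        using integrable_mult_indicator[OF _ int, of A] integrable_mult_indicator[of A ?T "\<lambda>_. 1 :: real"] A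
        by (intro set_integral_diff(2)) (simp_all add: set_integrable_def)
      moreover have "(LINT z:A|?T. 1) = measure ?T A"
        using A sets.sets_into_space[OF A] by (simp add: set_lebesgue_integral_def Int_absorb2)
      ultimately show ?thesis by simp
    qed
    then show ?thesis using int by (intro exI[of _ "\<lambda>z. ?r z - 1"]) auto
  qed
  then obtain g where g: "\<And>b. b \<in> Basis \<Longrightarrow> integrable ?T (g b)"
    "\<And>b A. b \<in> Basis \<Longrightarrow> A \<in> sets M \<Longrightarrow> \<sigma> A \<bullet> b = (LINT z:A|?T. g b z)" by metis
  let ?G = "\<lambda>z. \<Sum>b\<in>Basis. g b z *\<^sub>R b"
  have "\<sigma> A = (LINT z:A|?T. ?G z)" if A: "A \<in> sets M" for A
  proof -
    have i: "integrable ?T (\<lambda>z. indicat_real A z *\<^sub>R g b z)" if "b \<in> Basis" for b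
      using g(1)[OF that] A by (intro integrable_mult_indicator) auto
    have "(LINT z:A|?T. ?G z) = (LINT z|?T. (\<Sum>b\<in>Basis. (indicat_real A z *\<^sub>R g b z) *\<^sub>R b))"
      unfolding set_lebesgue_integral_def by (simp add: scaleR_sum_right)
    also have "\<dots> = (\<Sum>b\<in>Basis. (integral\<^sup>L ?T (\<lambda>z. indicat_real A z *\<^sub>R g b z)) *\<^sub>R b)"
      using i by (subst Bochner_Integration.integral_sum) auto
    also have "\<dots> = (\<Sum>b\<in>Basis. (\<sigma> A \<bullet> b) *\<^sub>R b)"
      using g(2)[OF _ A] by (intro sum.cong) (auto simp: set_lebesgue_integral_def)
    finally show ?thesis by (simp add: euclidean_representation)
  qed
  then show ?thesis using g(1) by (intro exI[of _ ?G]) auto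
qed

lemma polar_density:
  fixes \<sigma> :: "'a set \<Rightarrow> 'b::euclidean_space"
  assumes "bounded_vector_measure M \<sigma>"
  shows integrable_polar_density: "integrable (total_variation M \<sigma>) (polar_density M \<sigma>)"
    and polar_density_eq: "A \<in> sets M \<Longrightarrow> \<sigma> A = (LINT z:A|total_variation M \<sigma>. polar_density M \<sigma> z)"
  using someI_ex[OF polar_decomposition_exists[OF assms]] unfolding polar_density_def by auto

text \<open>If \<open>\<sigma>\<close> has density \<open>G\<close> with respect to \<open>\<nu>\<close>, its polar density need not be \<open>G\<close>. But the two
  differ only by a nonnegative factor, because the total variation is dominated by \<open>norm G\<close> times
  \<open>\<nu>\<close> and thus has a density as well.\<close>

lemma polar_density_of_density:
  fixes G :: "'a \<Rightarrow> 'b::euclidean_space"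
  assumes \<nu>: "finite_measure \<nu>" and sets_\<nu>: "sets \<nu> = sets M"
    and G: "integrable \<nu> G"
    and \<sigma>: "\<And>A. A \<in> sets M \<Longrightarrow> \<sigma> A = (LINT z:A|\<nu>. G z)"
  shows "bounded_vector_measure M \<sigma>"
    and "\<exists>\<rho>\<in>borel_measurable \<nu>. (\<forall>z. 0 \<le> \<rho> z) \<and>
      total_variation M \<sigma> = density \<nu> (\<lambda>z. ennreal (\<rho> z)) \<and>
      (AE z in \<nu>. \<rho> z *\<^sub>R polar_density M \<sigma> z = G z)"
proof -
  interpret \<nu>: finite_measure \<nu> by fact
  let ?T = "total_variation M \<sigma>"
  have sp: "space \<nu> = space M" using sets_\<nu> by (rule sets_eq_imp_space_eq)
  have iG: "integrable \<nu> (\<lambda>z. indicat_real A z *\<^sub>R G z)" if "A \<in> sets M" for A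
    using G that sets_\<nu> by (intro integrable_mult_indicator) auto
  have ca: "countably_additive_on M \<sigma>"
    unfolding countably_additive_on_def
  proof safe
    fix A :: "nat \<Rightarrow> 'a set" assume A: "range A \<subseteq> sets M" "disjoint_family A"
    then have A': "A i \<in> sets M" "(\<Union>i. A i) \<in> sets M" for i by auto
    have "(\<lambda>n. \<Sum>i<n. \<sigma> (A i)) \<longlonglongrightarrow> \<sigma> (\<Union>i. A i)"
    proof -
      have "(\<lambda>n. LINT z|\<nu>. indicat_real (\<Union>i<n. A i) z *\<^sub>R G z) \<longlonglongrightarrow> (LINT z|\<nu>. indicat_real (\<Union>i. A i) z *\<^sub>R G z)"
      proof (rule integral_dominated_convergence[where w="\<lambda>z. norm (G z)"])
        show "AE z in \<nu>. (\<lambda>n. indicat_real (\<Union>i<n. A i) z *\<^sub>R G z) \<longlonglongrightarrow> indicat_real (\<Union>i. A i) z *\<^sub>R G z"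
        proof (intro AE_I2 tendsto_scaleR tendsto_const)
          fix z
          show "(\<lambda>n. indicat_real (\<Union>i<n. A i) z) \<longlonglongrightarrow> indicat_real (\<Union>i. A i) z"
            by (rule LIMSEQ_indicator_UN)
        qed
      qed (use G A' iG sets_\<nu> in \<open>auto intro!: borel_measurable_integrable iG split: split_indicator\<close>)
      moreover have "(LINT z|\<nu>. indicat_real (\<Union>i<n. A i) z *\<^sub>R G z) = (\<Sum>i<n. \<sigma> (A i))" for n
      proof (induction n)
        case (Suc n)
        have "(\<Union>i<n. A i) \<inter> A n = {}"
          using disjoint_family_onD[OF A(2), of _ n] by fastforce
        then have "indicat_real (\<Union>i<Suc n. A i) z = indicat_real (\<Union>i<n. A i) z + indicat_real (A n) z" for z
          by (auto simp: lessThan_Suc split: split_indicator)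
        then show ?case using Suc iG[OF A'(1)[of n]] iG[of "\<Union>i<n. A i"] A'
          by (simp add: scaleR_add_left \<sigma> set_lebesgue_integral_def sets.countable_UN'')
      qed simp
      ultimately show ?thesis using A' by (simp add: \<sigma> set_lebesgue_integral_def)
    qed
    then show "(\<lambda>i. \<sigma> (A i)) sums \<sigma> (\<Union>i. A i)" by (simp add: sums_def)
  qed
  have ndom: "variation M \<sigma> A \<le> (\<integral>\<^sup>+z\<in>A. ennreal (norm (G z)) \<partial>\<nu>)" if A: "A \<in> sets M" for A
    unfolding variation_def
  proof (rule SUP_least)
    fix P assume "P \<in> {P. finite P \<and> partition_on A P \<and> P \<subseteq> sets M}"
    then have P: "finite P" "\<Union>P = A" "disjoint P" "P \<subseteq> sets M" by (auto simp: partition_on_def)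
    have "(\<Sum>B\<in>P. ennreal (norm (\<sigma> B))) \<le> (\<Sum>B\<in>P. \<integral>\<^sup>+z\<in>B. ennreal (norm (G z)) \<partial>\<nu>)"
    proof (rule sum_mono)
      fix B assume "B \<in> P" then have B: "B \<in> sets M" using P by auto
      have "ennreal (norm (\<sigma> B)) \<le> (\<integral>\<^sup>+z. ennreal (norm (indicat_real B z *\<^sub>R G z)) \<partial>\<nu>)"
        unfolding \<sigma>[OF B] set_lebesgue_integral_def using iG[OF B] by (rule integral_norm_bound_ennreal)
      also have "\<dots> = (\<integral>\<^sup>+z\<in>B. ennreal (norm (G z)) \<partial>\<nu>)"
        by (intro nn_integral_cong) (auto split: split_indicator)
      finally show "ennreal (norm (\<sigma> B)) \<le> (\<integral>\<^sup>+z\<in>B. ennreal (norm (G z)) \<partial>\<nu>)" .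
    qed
    also have "\<dots> = (\<Sum>B\<in>P. emeasure (density \<nu> (\<lambda>z. ennreal (norm (G z)))) B)"
      using P sets_\<nu> G by (intro sum.cong refl emeasure_density[symmetric]) auto
    also have "\<dots> = emeasure (density \<nu> (\<lambda>z. ennreal (norm (G z)))) (\<Union>B\<in>P. B)"
      using P sets_\<nu> by (intro sum_emeasure) (auto simp: disjoint_family_on_def disjoint_def)
    also have "\<dots> = (\<integral>\<^sup>+z\<in>A. ennreal (norm (G z)) \<partial>\<nu>)"
      using P(2) A sets_\<nu> G by (subst emeasure_density) auto
    finally show "(\<Sum>B\<in>P. ennreal (norm (\<sigma> B))) \<le> (\<integral>\<^sup>+z\<in>A. ennreal (norm (G z)) \<partial>\<nu>)" .
  qed
  have "emeasure ?T (space M) \<le> (\<integral>\<^sup>+z\<in>space M. ennreal (norm (G z)) \<partial>\<nu>)"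
    using ndom emeasure_total_variation[OF ca] by simp
  also have "\<dots> = (\<integral>\<^sup>+z. ennreal (norm (G z)) \<partial>\<nu>)" by (intro nn_integral_cong) (simp add: sp)
  also have "\<dots> < \<infinity>" using G by (simp add: integrable_iff_bounded)
  finally show bvm: "bounded_vector_measure M \<sigma>" by (simp add: bounded_vector_measure_iff ca)
  interpret T: finite_measure ?T using bvm by (rule finite_measure_total_variation)
  have "absolutely_continuous \<nu> ?T"
    unfolding absolutely_continuous_def
  proof
    fix A assume A: "A \<in> null_sets \<nu>"
    then have AM: "A \<in> sets M" using sets_\<nu> by auto
    have "(\<integral>\<^sup>+z\<in>A. ennreal (norm (G z)) \<partial>\<nu>) = 0"
      using A by (rule nn_integral_null_set)
    then show "A \<in> null_sets ?T"
      using ndom[OF AM] AM emeasure_total_variation[OF ca AM] by auto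
  qed
  then have dens: "density \<nu> (RN_deriv \<nu> ?T) = ?T"
    by (rule \<nu>.density_RN_deriv) (simp add: sets_\<nu>)
  define \<rho> where "\<rho> z = enn2real (RN_deriv \<nu> ?T z)" for z
  have [measurable]: "\<rho> \<in> borel_measurable \<nu>" unfolding \<rho>_def by measurable
  have "AE z in \<nu>. RN_deriv \<nu> ?T z \<noteq> \<infinity>"
    by (rule \<nu>.RN_deriv_finite) (use \<open>absolutely_continuous \<nu> ?T\<close> T.sigma_finite_measure_axioms sets_\<nu> in auto)
  then have "AE z in \<nu>. RN_deriv \<nu> ?T z = ennreal (\<rho> z)"
    by eventually_elim (auto simp: \<rho>_def less_top)
  then have T_eq: "?T = density \<nu> (\<lambda>z. ennreal (\<rho> z))"
    by (subst dens[symmetric], intro density_cong) (auto simp: \<rho>_def)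
  have \<rho>0: "0 \<le> \<rho> z" for z by (simp add: \<rho>_def)
  let ?p = "polar_density M \<sigma>"
  have ip: "integrable ?T ?p" by (rule integrable_polar_density[OF bvm])
  have [measurable]: "?p \<in> borel_measurable \<nu>"
    using ip[THEN borel_measurable_integrable] by (simp add: sets_\<nu> cong: measurable_cong_sets)
  have "integrable \<nu> (\<lambda>z. \<rho> z *\<^sub>R ?p z)"
    using ip unfolding T_eq by (subst (asm) integrable_density) (auto simp: \<rho>0)
  moreover have "(LINT z:A|\<nu>. \<rho> z *\<^sub>R ?p z) = (LINT z:A|\<nu>. G z)" if A: "A \<in> sets \<nu>" for A
  proof -
    have AM: "A \<in> sets M" using A sets_\<nu> by simp
    have "(LINT z:A|\<nu>. G z) = (LINT z:A|?T. ?p z)"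
      using \<sigma>[OF AM] polar_density_eq[OF bvm AM] by simp
    also have "\<dots> = (LINT z:A|\<nu>. \<rho> z *\<^sub>R ?p z)"
      unfolding T_eq set_lebesgue_integral_def using A
      by (subst integral_density) (auto simp: \<rho>0 mult.commute)
    finally show ?thesis by simp
  qed
  ultimately have "AE z in \<nu>. \<rho> z *\<^sub>R ?p z = G z"
    using G by (intro \<nu>.density_unique_banach)
  then show "\<exists>\<rho>\<in>borel_measurable \<nu>. (\<forall>z. 0 \<le> \<rho> z) \<and>
      total_variation M \<sigma> = density \<nu> (\<lambda>z. ennreal (\<rho> z)) \<and>
      (AE z in \<nu>. \<rho> z *\<^sub>R polar_density M \<sigma> z = G z)"
    using T_eq \<rho>0 by (intro bexI[of _ \<rho>]) auto
qed

text \<open>The factor relating \<open>G\<close> to the polar density is the density of the total variation, so it cancels.\<close>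

lemma vector_integral_of_density:
  fixes G \<Phi> :: "'a \<Rightarrow> 'b::euclidean_space"
  assumes \<nu>: "finite_measure \<nu>" and sets_\<nu>: "sets \<nu> = sets M"
    and G: "integrable \<nu> G"
    and \<sigma>: "\<And>A. A \<in> sets M \<Longrightarrow> \<sigma> A = (LINT z:A|\<nu>. G z)"
    and \<Phi>: "\<Phi> \<in> borel_measurable M"
  shows "vector_integral M \<Phi> \<sigma> = (LINT z|\<nu>. \<Phi> z \<bullet> G z)"
proof -
  note bvm = polar_density_of_density(1)[OF \<nu> sets_\<nu> G \<sigma>]
  obtain \<rho> where \<rho>: "\<rho> \<in> borel_measurable \<nu>" "\<And>z. 0 \<le> \<rho> z"
    "total_variation M \<sigma> = density \<nu> (\<lambda>z. ennreal (\<rho> z))"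
    "AE z in \<nu>. \<rho> z *\<^sub>R polar_density M \<sigma> z = G z"
    using polar_density_of_density(2)[OF \<nu> sets_\<nu> G \<sigma>] by blast
  have [measurable]: "polar_density M \<sigma> \<in> borel_measurable \<nu>" "\<Phi> \<in> borel_measurable \<nu>" "G \<in> borel_measurable \<nu>"
    using integrable_polar_density[OF bvm, THEN borel_measurable_integrable] \<Phi> borel_measurable_integrable[OF G]
    by (simp_all add: sets_\<nu> cong: measurable_cong_sets)
  have "vector_integral M \<Phi> \<sigma> = (LINT z|\<nu>. \<rho> z *\<^sub>R (\<Phi> z \<bullet> polar_density M \<sigma> z))"
    unfolding vector_integral_def \<rho>(3) using \<rho>(1,2) by (intro integral_density) auto
  also have "\<dots> = (LINT z|\<nu>. \<Phi> z \<bullet> G z)"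
  proof (intro integral_cong_AE)
    show "AE z in \<nu>. \<rho> z *\<^sub>R (\<Phi> z \<bullet> polar_density M \<sigma> z) = \<Phi> z \<bullet> G z"
      using \<rho>(4) by eventually_elim (metis inner_scaleR_right real_scaleR_def)
  qed (use \<rho>(1) in measurable)
  finally show ?thesis .
qed

section \<open>Continuously differentiable functions and cutoffs\<close>

text \<open>The gradient is an explicit argument, because the limits of concentrating test functions are
  computed from its formula.\<close>

definition C1_gradient :: "('a::euclidean_space \<Rightarrow> real) \<Rightarrow> ('a \<Rightarrow> 'a) \<Rightarrow> bool" where
  "C1_gradient \<psi> G \<longleftrightarrow> (\<forall>z. GDERIV \<psi> z :> G z) \<and> continuous_on UNIV G"

lemma C1_gradientI:
  "(\<And>z. GDERIV \<psi> z :> G z) \<Longrightarrow> continuous_on UNIV G \<Longrightarrow> C1_gradient \<psi> G"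
  by (simp add: C1_gradient_def)

lemma C1_gradient_real: "C1_gradient h h' \<longleftrightarrow> (\<forall>t. (h has_real_derivative h' t) (at t)) \<and> continuous_on UNIV h'"
  for h :: "real \<Rightarrow> real"
  by (simp add: C1_gradient_def)

lemma C1_gradient_has_derivative: "C1_gradient \<psi> G \<Longrightarrow> (\<psi> has_derivative (\<lambda>h. h \<bullet> G z)) (at z)"
  by (simp add: C1_gradient_def gderiv_def)

lemma C1_gradient_continuous: "C1_gradient \<psi> G \<Longrightarrow> continuous_on UNIV \<psi>"
  by (meson C1_gradient_has_derivative UNIV_I continuous_at_imp_continuous_on has_derivative_continuous)

lemma C1_gradient_continuous_gradient: "C1_gradient \<psi> G \<Longrightarrow> continuous_on UNIV G"
  by (simp add: C1_gradient_def)

lemma C1_gradient_unique: "C1_gradient \<psi> G \<Longrightarrow> C1_gradient \<psi> H \<Longrightarrow> G z = H z"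
  using has_derivative_unique[OF C1_gradient_has_derivative[of \<psi> G z] C1_gradient_has_derivative[of \<psi> H z]]
  by (metis (no_types, lifting) vector_eq_ldot)

lemma C1_gradient_chain:
  assumes "C1_gradient f F" "(c has_vector_derivative v) (at s)"
  shows "((\<lambda>s. f (c s)) has_real_derivative v \<bullet> F (c s)) (at s)"
proof -
  have "((\<lambda>s. f (c s)) has_derivative (\<lambda>h. (h *\<^sub>R v) \<bullet> F (c s))) (at s)"
    by (rule has_derivative_compose[OF assms(2)[unfolded has_vector_derivative_def] C1_gradient_has_derivative[OF assms(1)]])
  moreover have "(\<lambda>h. (h *\<^sub>R v) \<bullet> F (c s)) = (*) (v \<bullet> F (c s))"
    by (auto simp: fun_eq_iff)
  ultimately show ?thesis by (simp add: has_field_derivative_def)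
qed

lemma C1_gradient_const: "C1_gradient (\<lambda>z. k) (\<lambda>z. 0)"
  by (simp add: C1_gradient_def GDERIV_const)

lemma C1_gradient_add:
  "C1_gradient f F \<Longrightarrow> C1_gradient g G \<Longrightarrow> C1_gradient (\<lambda>z. f z + g z) (\<lambda>z. F z + G z)"
  by (simp add: C1_gradient_def GDERIV_add continuous_on_add)

lemma C1_gradient_diff:
  "C1_gradient f F \<Longrightarrow> C1_gradient g G \<Longrightarrow> C1_gradient (\<lambda>z. f z - g z) (\<lambda>z. F z - G z)"
  by (simp add: C1_gradient_def GDERIV_diff continuous_on_diff)

lemma C1_gradient_mult:
  assumes "C1_gradient f F" "C1_gradient g G"
  shows "C1_gradient (\<lambda>z. f z * g z) (\<lambda>z. f z *\<^sub>R G z + g z *\<^sub>R F z)"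
  using assms C1_gradient_continuous[OF assms(1)] C1_gradient_continuous[OF assms(2)]
  by (simp add: C1_gradient_def GDERIV_mult continuous_on_add continuous_on_scaleR)

lemma C1_gradient_compose:
  assumes "C1_gradient f F" "C1_gradient h h'"
  shows "C1_gradient (\<lambda>z. h (f z)) (\<lambda>z. h' (f z) *\<^sub>R F z)"
proof (rule C1_gradientI)
  show "GDERIV (\<lambda>z. h (f z)) z :> h' (f z) *\<^sub>R F z" for z
    using assms by (intro GDERIV_DERIV_compose) (auto simp: C1_gradient_def)
  have "continuous_on UNIV (\<lambda>z. h' (f z))"
    using continuous_on_compose2[OF C1_gradient_continuous_gradient[OF assms(2)] C1_gradient_continuous[OF assms(1)]] by auto
  then show "continuous_on UNIV (\<lambda>z. h' (f z) *\<^sub>R F z)"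
    using C1_gradient_continuous_gradient[OF assms(1)] by (intro continuous_on_scaleR)
qed

lemma C1_gradient_inner: "C1_gradient (\<lambda>z. z \<bullet> a) (\<lambda>z. a)"
  by (intro C1_gradientI) (auto simp: gderiv_def intro!: derivative_eq_intros)

lemma C1_gradient_norm_sq: "C1_gradient (\<lambda>z. (norm (z - a))\<^sup>2) (\<lambda>z. 2 *\<^sub>R (z - a))"
  unfolding power2_norm_eq_inner
  by (intro C1_gradientI continuous_intros)
     (auto simp: gderiv_def inner_diff_left inner_diff_right algebra_simps inner_commute intro!: derivative_eq_intros)

lemma C1_gradient_fst:
  assumes "C1_gradient f F" shows "C1_gradient (\<lambda>z. f (fst z)) (\<lambda>z. (F (fst z), 0))"
proof (rule C1_gradientI)
  fix z :: "'a \<times> 'b"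
  have "((\<lambda>z. f (fst z)) has_derivative (\<lambda>h. fst h \<bullet> F (fst z))) (at z)"
    by (rule has_derivative_compose[OF has_derivative_fst[OF has_derivative_ident] C1_gradient_has_derivative[OF assms]])
  then show "GDERIV (\<lambda>z. f (fst z)) z :> (F (fst z), 0)"
    by (simp add: gderiv_def inner_prod_def)
  show "continuous_on UNIV (\<lambda>z :: 'a \<times> 'b. (F (fst z), 0 :: 'b))"
    by (intro continuous_on_Pair continuous_on_const continuous_on_compose2[OF C1_gradient_continuous_gradient[OF assms]] continuous_on_fst continuous_on_id) auto
qed

lemma C1_gradient_snd:
  assumes "C1_gradient f F" shows "C1_gradient (\<lambda>z. f (snd z)) (\<lambda>z. (0, F (snd z)))"
proof (rule C1_gradientI)
  fix z :: "'b \<times> 'a"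
  have "((\<lambda>z. f (snd z)) has_derivative (\<lambda>h. snd h \<bullet> F (snd z))) (at z)"
    by (rule has_derivative_compose[OF has_derivative_snd[OF has_derivative_ident] C1_gradient_has_derivative[OF assms]])
  then show "GDERIV (\<lambda>z. f (snd z)) z :> (0, F (snd z))"
    by (simp add: gderiv_def inner_prod_def)
  show "continuous_on UNIV (\<lambda>z :: 'b \<times> 'a. (0 :: 'b, F (snd z)))"
    by (intro continuous_on_Pair continuous_on_const continuous_on_compose2[OF C1_gradient_continuous_gradient[OF assms]] continuous_on_snd continuous_on_id) auto
qed

text \<open>The squared positive part is the building block of all cutoffs: it is of class \<open>C\<^sup>1\<close>, and
  its algebraic combinations yield plateaus.\<close>

definition sqpos :: "real \<Rightarrow> real" where
  "sqpos t = (max 0 t)\<^sup>2"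

lemma sqpos_pos [simp]: "0 \<le> t \<Longrightarrow> sqpos t = t\<^sup>2" and sqpos_neg [simp]: "t \<le> 0 \<Longrightarrow> sqpos t = 0"
  and sqpos_nonneg [simp]: "0 \<le> sqpos t"
  by (auto simp: sqpos_def max_def)

lemma sqpos_le_1: "t \<le> 1 \<Longrightarrow> sqpos t \<le> 1"
  by (auto simp: sqpos_def max_def power_le_one)

lemma sqpos_eq_0_iff [simp]: "sqpos t = 0 \<longleftrightarrow> t \<le> 0"
  by (auto simp: sqpos_def max_def)

lemma C1_gradient_sqpos: "C1_gradient sqpos (\<lambda>t. 2 * max 0 t)"
  unfolding C1_gradient_real
proof safe
  fix t :: real
  show "(sqpos has_real_derivative 2 * max 0 t) (at t)"
  proof (cases "t = 0")
    case True
    have "(sqpos has_real_derivative 0) (at 0)"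
      unfolding DERIV_def
    proof (rule tendsto_sandwich)
      show "\<forall>\<^sub>F h in at 0. - \<bar>h\<bar> \<le> (sqpos (0 + h) - sqpos 0) / h"
        by (intro always_eventually allI)
           (auto simp: sqpos_def max_def power2_eq_square divide_simps)
      show "\<forall>\<^sub>F h in at 0. (sqpos (0 + h) - sqpos 0) / h \<le> \<bar>h\<bar>"
        by (intro always_eventually allI)
           (auto simp: sqpos_def max_def power2_eq_square divide_simps)
    qed (auto intro!: tendsto_eq_intros)
    then show ?thesis using True by simp
  next
    case False
    show ?thesis
    proof (cases "0 < t")
      case True
      have "((\<lambda>t. t\<^sup>2) has_real_derivative 2 * t) (at t)" by (auto intro!: derivative_eq_intros)
      then show ?thesis
        using True has_field_derivative_transform_within_open[of "\<lambda>t. t\<^sup>2" "2 * t" t "{0<..}" sqpos] by auto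
    next
      case False
      then have t: "t < 0" using \<open>t \<noteq> 0\<close> by simp
      show ?thesis
        using t has_field_derivative_transform_within_open[of "\<lambda>t. 0" 0 t "{..<0}" sqpos] by auto
    qed
  qed
qed (intro continuous_intros)

text \<open>A cutoff with plateau 1 on the ball of radius \<open>r / 2\<close>: there, the inner \<open>sqpos\<close> is at least
  \<open>(3/4)\<^sup>2 > 1/2\<close>, so that the outer one vanishes.\<close>

definition bump :: "'a::euclidean_space \<Rightarrow> real \<Rightarrow> 'a \<Rightarrow> real" where
  "bump c r x = 1 - sqpos (1 - 2 * sqpos (1 - (norm (x - c))\<^sup>2 / r\<^sup>2))"

lemma C1_bump: "\<exists>B. C1_gradient (bump c r) B"
proof -
  have "\<exists>B. C1_gradient (\<lambda>x. 1 - sqpos (1 - 2 * sqpos (1 - (norm (x - c))\<^sup>2 * inverse (r\<^sup>2)))) B"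
    by (intro exI, (rule C1_gradient_diff C1_gradient_mult C1_gradient_const C1_gradient_norm_sq
        C1_gradient_compose[OF _ C1_gradient_sqpos])+)
  then show ?thesis unfolding bump_def by (simp add: divide_inverse)
qed

lemma bump_center:
  assumes "0 < r" "dist c x \<le> r / 2" shows "bump c r x = 1"
proof -
  have "(norm (x - c))\<^sup>2 \<le> (r / 2)\<^sup>2"
    using assms by (intro power_mono) (auto simp: dist_norm norm_minus_commute)
  then have *: "3 / 4 \<le> 1 - (norm (x - c))\<^sup>2 / r\<^sup>2" using assms by (simp add: field_simps power_divide)
  then have "(3/4)\<^sup>2 \<le> (1 - (norm (x - c))\<^sup>2 / r\<^sup>2)\<^sup>2" by (intro power_mono) auto
  moreover have "sqpos (1 - (norm (x - c))\<^sup>2 / r\<^sup>2) = (1 - (norm (x - c))\<^sup>2 / r\<^sup>2)\<^sup>2"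
    using * by (intro sqpos_pos) linarith
  ultimately have "1 \<le> 2 * sqpos (1 - (norm (x - c))\<^sup>2 / r\<^sup>2)"
    by (simp add: power2_eq_square[of "3/4"])
  then show ?thesis by (simp add: bump_def)
qed

lemma bump_outside:
  assumes "0 < r" "r \<le> dist c x" shows "bump c r x = 0"
proof -
  have "r\<^sup>2 \<le> (norm (x - c))\<^sup>2" using assms by (intro power_mono) (auto simp: dist_norm norm_minus_commute)
  then have "1 - (norm (x - c))\<^sup>2 / r\<^sup>2 \<le> 0" using assms by simp
  then show ?thesis by (simp add: bump_def)
qed

text \<open>Products of the functions \<open>1 - bump\<close> serve as a partition of unity: splitting off one bump
  after the other, nothing is left on a compact set that is covered by the plateaus.\<close>

lemma finite_bumps_exhaust:
  fixes K :: "'a::euclidean_space set"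
  assumes "compact K" "\<And>c. c \<in> K \<Longrightarrow> 0 < r c"
  shows "\<exists>S. finite S \<and> S \<subseteq> K \<and> (\<forall>x\<in>K. (\<Prod>c\<in>S. 1 - bump c (r c) x) = 0)"
proof -
  have "K \<subseteq> (\<Union>c\<in>K. ball c (r c / 2))" using assms(2) by force
  then obtain S where S: "S \<subseteq> K" "finite S" "K \<subseteq> (\<Union>c\<in>S. ball c (r c / 2))"
    using compactE_image[OF assms(1), of K "\<lambda>c. ball c (r c / 2)"] by auto
  have "(\<Prod>c\<in>S. 1 - bump c (r c) x) = 0" if x: "x \<in> K" for x
  proof -
    obtain c where "c \<in> S" "x \<in> ball c (r c / 2)" using S(3) x by blast
    then have "bump c (r c) x = 1" using S(1) assms(2) by (intro bump_center) (auto simp: less_imp_le)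
    then show ?thesis using \<open>c \<in> S\<close> S(2) by (intro prod_zero) auto
  qed
  then show ?thesis using S by blast
qed

text \<open>\<open>C\<^sup>1\<close> approximations from below of the indicator function of an interval.\<close>

definition itv_bump :: "real \<Rightarrow> real \<Rightarrow> nat \<Rightarrow> real \<Rightarrow> real" where
  "itv_bump u v n t = 1 - sqpos (1 - real n * (sqpos (t - u) * sqpos (v - t)))"

lemma C1_itv_bump: "\<exists>B. C1_gradient (itv_bump u v n) B"
proof -
  have id: "C1_gradient (\<lambda>t::real. t) (\<lambda>t. 1)" using C1_gradient_inner[of "1::real"] by simp
  show ?thesis unfolding itv_bump_def[abs_def]
    by (intro exI, (rule C1_gradient_diff C1_gradient_mult C1_gradient_const id
        C1_gradient_compose[OF _ C1_gradient_sqpos])+)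
qed

lemma itv_bump_bounds: "0 \<le> itv_bump u v n t" "itv_bump u v n t \<le> 1"
  unfolding itv_bump_def using sqpos_le_1[of "1 - real n * (sqpos (t - u) * sqpos (v - t))"] by auto

lemma itv_bump_outside: "t \<notin> {u<..<v} \<Longrightarrow> itv_bump u v n t = 0"
  by (auto simp: itv_bump_def not_less)

lemma itv_bump_pos: "t \<in> {u<..<v} \<Longrightarrow> 0 < n \<Longrightarrow> 0 < itv_bump u v n t"
  unfolding itv_bump_def using power_less_one_iff
  by (cases "1 - real n * (sqpos (t - u) * sqpos (v - t)) \<le> 0")
     (auto simp: abs_square_less_1 power2_eq_1_iff)

lemma itv_bump_tendsto: "(\<lambda>n. itv_bump u v n t) \<longlonglongrightarrow> indicator {u<..<v} t"
proof (cases "t \<in> {u<..<v}")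
  case True
  then have p: "0 < sqpos (t - u) * sqpos (v - t)" by auto
  obtain N where N: "1 / (sqpos (t - u) * sqpos (v - t)) < real N" using reals_Archimedean2 by blast
  have "itv_bump u v n t = 1" if "n \<ge> N" for n
  proof -
    have "1 / (sqpos (t - u) * sqpos (v - t)) < real n" using N that by linarith
    then have "1 \<le> real n * (sqpos (t - u) * sqpos (v - t))" using p by (simp add: field_simps)
    then show ?thesis by (simp add: itv_bump_def)
  qed
  then show ?thesis using True by (intro tendsto_eventually) (auto simp: eventually_sequentially)
qed (simp add: itv_bump_outside)

lemma jacobian_zero_outside:
  fixes \<phi> :: "real ^ 'n \<Rightarrow> real ^ 'm"
  assumes "(\<phi> has_derivative (\<lambda>v. A *v v)) (at x)" "compact K" "\<And>x. x \<notin> K \<Longrightarrow> \<phi> x = 0" "x \<notin> K"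
  shows "A = 0"
proof -
  have "open (- K)" using assms(2) by (simp add: compact_imp_closed open_Compl)
  have "(\<phi> has_derivative (\<lambda>v. 0)) (at x)"
    by (rule has_derivative_transform_within_open[of "\<lambda>_. 0" _ x UNIV "- K"])
       (use assms \<open>open (- K)\<close> in auto)
  then have "(\<lambda>v. A *v v) = (\<lambda>v. 0)" using assms(1) has_derivative_unique by blast
  then show ?thesis by (metis matrix_eq matrix_vector_mult_0)
qed

lemma plane_fieldI:
  fixes u v :: "real ^ 2" and \<alpha> \<beta> :: "real ^ 2 \<Rightarrow> real"
  assumes "C1_gradient \<alpha> A" "C1_gradient \<beta> B"
  obtains J where "\<And>x. ((\<lambda>x. \<alpha> x *\<^sub>R u + \<beta> x *\<^sub>R v) has_derivative (\<lambda>h. J x *v h)) (at x)"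
    "continuous_on UNIV J"
proof -
  define J :: "real ^ 2 \<Rightarrow> real ^ 2 ^ 2" where "J x = (\<chi> i j. A x $ j * u $ i + B x $ j * v $ i)" for x
  have J: "J x *v h = (h \<bullet> A x) *\<^sub>R u + (h \<bullet> B x) *\<^sub>R v" for x h
    by (simp add: J_def vec_eq_iff matrix_vector_mult_def inner_vec_def sum_2 algebra_simps)
  show ?thesis
  proof
    fix x
    have "((\<lambda>x. \<alpha> x *\<^sub>R u + \<beta> x *\<^sub>R v) has_derivative (\<lambda>h. (h \<bullet> A x) *\<^sub>R u + (h \<bullet> B x) *\<^sub>R v)) (at x)"
      using C1_gradient_has_derivative[OF assms(1)] C1_gradient_has_derivative[OF assms(2)]
      by (auto intro!: derivative_intros)
    then show "((\<lambda>x. \<alpha> x *\<^sub>R u + \<beta> x *\<^sub>R v) has_derivative (\<lambda>h. J x *v h)) (at x)" by (simp add: J)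
    show "continuous_on UNIV J" unfolding J_def
      using C1_gradient_continuous_gradient[OF assms(1)] C1_gradient_continuous_gradient[OF assms(2)]
      by (intro continuous_intros)
  qed
qed

lemma plane_test_field_component:
  assumes "plane_test_field \<Omega> \<phi> J"
  shows "C1_gradient (\<lambda>x. \<phi> x \<bullet> e) (\<lambda>x. e v* J x)"
proof (rule C1_gradientI)
  fix x
  have "(\<phi> has_derivative (\<lambda>h. J x *v h)) (at x)" using assms by (auto simp: plane_test_field_def)
  then have "((\<lambda>x. \<phi> x \<bullet> e) has_derivative (\<lambda>h. (J x *v h) \<bullet> e)) (at x)"
    by (auto intro!: derivative_intros)
  moreover have "(J x *v h) \<bullet> e = h \<bullet> (e v* J x)" for h
    by (metis dot_lmul_matrix inner_commute)
  ultimately show "GDERIV (\<lambda>x. \<phi> x \<bullet> e) x :> e v* J x" by (simp add: gderiv_def)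
  show "continuous_on UNIV (\<lambda>x. e v* J x)"
    using assms unfolding vector_matrix_mult_def plane_test_field_def by (intro continuous_intros) auto
qed

lemma phase_test_fun_iff:
  "phase_test_fun \<Omega> \<psi> G \<longleftrightarrow> C1_gradient \<psi> G \<and>
    (\<forall>x \<theta>. \<psi> (x, \<theta> + 2 * pi) = \<psi> (x, \<theta>)) \<and>
    (\<exists>K. compact K \<and> K \<subseteq> \<Omega> \<and> (\<forall>x \<theta>. x \<notin> K \<longrightarrow> \<psi> (x, \<theta>) = 0))"
  unfolding phase_test_fun_def C1_gradient_def by blast

section \<open>Graphs, boundary charts, curvature and tangent angle\<close>

lemma angle_vec_component [simp]: "angle_vec \<theta> $ 1 = cos \<theta>" "angle_vec \<theta> $ 2 = sin \<theta>"
  by (simp_all add: angle_vec_def)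

lemma vec2_eq_iff: "x = y \<longleftrightarrow> x $ 1 = y $ 1 \<and> x $ 2 = y $ 2" for x y :: "'a ^ 2"
  by (simp add: vec_eq_iff forall_2)

lemma inner_vec2: "x \<bullet> y = x $ 1 * y $ 1 + x $ 2 * y $ 2" for x y :: "real ^ 2"
  by (simp add: inner_vec_def sum_2)

lemma inner_angle_vec: "angle_vec \<alpha> \<bullet> angle_vec \<beta> = cos (\<alpha> - \<beta>)"
  by (simp add: inner_vec2 cos_diff)

lemma norm_angle_vec [simp]: "norm (angle_vec \<theta>) = 1"
  by (simp add: norm_eq_sqrt_inner inner_angle_vec)

lemma angle_vec_add:
  "angle_vec (\<alpha> + \<beta>) = cos \<beta> *\<^sub>R angle_vec \<alpha> + sin \<beta> *\<^sub>R angle_vec (\<alpha> + pi / 2)"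
  by (simp add: vec2_eq_iff cos_add sin_add)

lemma angle_vec_periodic [simp]: "angle_vec (\<theta> + 2 * pi) = angle_vec \<theta>"
  by (simp add: vec2_eq_iff)

lemma angle_vec_has_vector_derivative:
  "(angle_vec has_vector_derivative angle_vec (\<theta> + pi / 2)) (at \<theta>)"
proof -
  have *: "angle_vec = (\<lambda>\<theta>. cos \<theta> *\<^sub>R angle_vec 0 + sin \<theta> *\<^sub>R angle_vec (pi / 2))"
    by (simp add: fun_eq_iff vec2_eq_iff)
  show ?thesis
    by (subst (1) *) (auto intro!: derivative_eq_intros simp: vec2_eq_iff cos_add sin_add)
qed

lemma continuous_angle_vec: "continuous_on S angle_vec"
  by (meson angle_vec_has_vector_derivative continuous_at_imp_continuous_on has_vector_derivative_continuous)

lemma perp_inner_angle_vec: "perp x \<bullet> angle_vec \<alpha> = x \<bullet> angle_vec (\<alpha> + pi / 2)"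
  by (simp add: inner_vec2 perp_def cos_add sin_add)

text \<open>The graph of \<open>g\<close> over the line spanned by \<open>e1\<close>, in the frame \<open>e1\<close>, \<open>e2\<close>. The vertical distance
  \<open>height\<close> to the graph is a \<open>C\<^sup>2\<close> function with gradient \<open>conormal\<close>. The tangent has angle
  \<open>angle\<close> and length \<open>speed\<close>, so \<open>kappa\<close> is the derivative of the angle with respect to arclength.\<close>

locale C2_graph =
  fixes a :: real and g g' g'' :: "real \<Rightarrow> real"
  assumes deriv_g: "\<And>t. (g has_real_derivative g' t) (at t)"
    and deriv_g': "\<And>t. (g' has_real_derivative g'' t) (at t)"
    and continuous_g'': "continuous_on UNIV g''"
begin

definition "e1 = angle_vec a"
definition "e2 = angle_vec (a + pi / 2)"
definition "pt t = t *\<^sub>R e1 + g t *\<^sub>R e2"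
definition "tangent t = e1 + g' t *\<^sub>R e2"
definition "conormal t = e2 - g' t *\<^sub>R e1"
definition "height x = x \<bullet> e2 - g (x \<bullet> e1)"
definition "speed t = sqrt (1 + (g' t)\<^sup>2)"
definition "angle t = a + arctan (g' t)"
definition "angle' t = g'' t / (1 + (g' t)\<^sup>2)"
definition "kappa t = angle' t / speed t"

lemma frame [simp]: "e1 \<bullet> e1 = 1" "e2 \<bullet> e2 = 1" "e1 \<bullet> e2 = 0" "e2 \<bullet> e1 = 0"
  by (simp_all add: e1_def e2_def inner_angle_vec)

lemma frame_expansion: "x = (x \<bullet> e1) *\<^sub>R e1 + (x \<bullet> e2) *\<^sub>R e2"
proof -
  have c: "cos a * (cos a * r) + sin a * (sin a * r) = r" for r
    using sin_cos_squared_add3[of a] by (metis distrib_right mult.assoc mult_1)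
  show ?thesis
    by (simp add: vec2_eq_iff inner_vec2 e1_def e2_def cos_add sin_add algebra_simps c)
qed

lemma frame_eqI: "x \<bullet> e1 = y \<bullet> e1 \<Longrightarrow> x \<bullet> e2 = y \<bullet> e2 \<Longrightarrow> x = y"
  by (metis frame_expansion)

lemma pt_inner [simp]: "pt t \<bullet> e1 = t" "pt t \<bullet> e2 = g t"
  by (simp_all add: pt_def inner_add_left)

lemma height_pt [simp]: "height (pt t) = 0"
  by (simp add: height_def)

lemma height_eq_0_iff: "height x = 0 \<longleftrightarrow> x = pt (x \<bullet> e1)"
proof
  assume "x = pt (x \<bullet> e1)"
  then have "x \<bullet> e2 = pt (x \<bullet> e1) \<bullet> e2" by simp
  then show "height x = 0" by (simp add: height_def)
qed (auto simp: height_def intro: frame_eqI)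

lemma inj_pt: "inj pt"
  by (metis injI pt_inner(1))

lemma speed_ge_1: "1 \<le> speed t" and speed_pos [simp]: "0 < speed t"
  and speed_nz [simp]: "speed t \<noteq> 0" and speed_sq: "(speed t)\<^sup>2 = 1 + (g' t)\<^sup>2"
  by (auto simp: speed_def add_pos_nonneg sum_power2_eq_zero_iff add_nonneg_eq_0_iff)

lemma tangent_eq: "tangent t = speed t *\<^sub>R angle_vec (angle t)"
proof -
  have "speed t * cos (arctan (g' t)) = 1" "speed t * sin (arctan (g' t)) = g' t"
    by (simp_all add: cos_arctan sin_arctan flip: speed_def)
  moreover have "angle_vec (angle t) = cos (arctan (g' t)) *\<^sub>R e1 + sin (arctan (g' t)) *\<^sub>R e2"
    unfolding angle_def e1_def e2_def by (rule angle_vec_add)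
  ultimately show ?thesis
    by (simp add: tangent_def scaleR_add_right)
qed

lemma conormal_eq: "conormal t = speed t *\<^sub>R angle_vec (angle t + pi / 2)"
proof -
  have "speed t * cos (arctan (g' t)) = 1" "speed t * sin (arctan (g' t)) = g' t"
    by (simp_all add: cos_arctan sin_arctan flip: speed_def)
  moreover have "angle_vec (angle t + pi / 2) =
      cos (arctan (g' t)) *\<^sub>R angle_vec (a + pi / 2) - sin (arctan (g' t)) *\<^sub>R angle_vec a"
    by (simp add: angle_def vec2_eq_iff cos_add sin_add algebra_simps)
  ultimately show ?thesis
    by (simp add: conormal_def e1_def e2_def scaleR_diff_right)
qed

lemma norm_tangent: "norm (tangent t) = speed t"
  by (simp add: tangent_eq less_imp_le)

lemma tangent_inner [simp]: "tangent t \<bullet> e1 = 1" "tangent t \<bullet> e2 = g' t"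
  by (simp_all add: tangent_def inner_add_left)

lemma pt_has_vector_derivative: "(pt has_vector_derivative tangent t) (at t)"
  unfolding pt_def[abs_def] tangent_def
  using deriv_g[of t]
  by (auto intro!: derivative_eq_intros simp: has_real_derivative_iff_has_vector_derivative)

lemma continuous_g: "continuous_on S g" and continuous_g': "continuous_on S g'"
  by (meson deriv_g deriv_g' DERIV_isCont continuous_at_imp_continuous_on)+

lemma continuous_pt: "continuous_on S pt"
  unfolding pt_def by (intro continuous_intros continuous_g)

lemma continuous_tangent: "continuous_on S tangent"
  unfolding tangent_def by (intro continuous_intros continuous_g')

lemma continuous_speed: "continuous_on S speed"
  unfolding speed_def by (intro continuous_intros continuous_g')

lemma continuous_angle: "continuous_on S angle"
  unfolding angle_def by (intro continuous_intros continuous_g')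

lemma continuous_angle': "continuous_on S angle'"
  unfolding angle'_def
  by (intro continuous_intros continuous_g' continuous_on_subset[OF continuous_g''])
     (auto simp: add_nonneg_eq_0_iff)

lemma continuous_kappa: "continuous_on S kappa"
  unfolding kappa_def by (intro continuous_intros continuous_angle' continuous_speed) auto

lemma angle_has_derivative: "(angle has_real_derivative angle' t) (at t)"
  unfolding angle_def[abs_def] angle'_def
  by (auto intro!: derivative_eq_intros deriv_g' simp: divide_inverse)

lemma C1_height: "C1_gradient height (\<lambda>x. conormal (x \<bullet> e1))"
proof -
  have "C1_gradient g g'" by (simp add: C1_gradient_real deriv_g continuous_g')
  from C1_gradient_diff[OF C1_gradient_inner[of e2] C1_gradient_compose[OF C1_gradient_inner[of e1] this]]
  show ?thesis unfolding height_def conormal_def .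
qed

lemma C1_angle: "C1_gradient angle angle'"
  by (simp add: C1_gradient_real angle_has_derivative continuous_angle')

lemma C1_g': "C1_gradient g' g''"
  by (simp add: C1_gradient_real deriv_g' continuous_g'')

lemma borel_e1 [measurable]: "(\<lambda>x. x \<bullet> e1) \<in> borel_measurable borel"
  and borel_pt [measurable]: "pt \<in> borel_measurable borel"
  and borel_height [measurable]: "height \<in> borel_measurable borel"
  and borel_speed [measurable]: "speed \<in> borel_measurable borel"
  and borel_angle [measurable]: "angle \<in> borel_measurable borel"
  and borel_angle' [measurable]: "angle' \<in> borel_measurable borel"
  and borel_kappa [measurable]: "kappa \<in> borel_measurable borel"
  and borel_tangent [measurable]: "tangent \<in> borel_measurable borel"
  using continuous_pt C1_gradient_continuous[OF C1_height] continuous_speed continuous_angle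
    continuous_angle' continuous_kappa continuous_tangent
  by (auto intro!: borel_measurable_continuous_onI continuous_intros)

end

locale boundary_chart = C2_graph +
  fixes E U :: "(real ^ 2) set"
  assumes open_U: "open U"
    and above: "\<And>x. x \<in> U \<Longrightarrow> 0 < height x \<Longrightarrow> x \<in> E"
    and below: "\<And>x. x \<in> U \<Longrightarrow> height x < 0 \<Longrightarrow> x \<notin> E"

lemma boundary_chart_exists:
  assumes "C2_boundary_in \<Omega> E" "open \<Omega>" "x0 \<in> frontier E \<inter> \<Omega>"
  obtains a g g' g'' U where "boundary_chart a g g' g'' E U" "x0 \<in> U" "U \<subseteq> \<Omega>"
proof -
  obtain r a g where r: "0 < r" "C2_function g"
    "\<forall>x\<in>ball x0 r. (g (x \<bullet> angle_vec a) < x \<bullet> angle_vec (a + pi / 2) \<longrightarrow> x \<in> E) \<and>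
        (x \<bullet> angle_vec (a + pi / 2) < g (x \<bullet> angle_vec a) \<longrightarrow> x \<notin> E)"
    using assms unfolding C2_boundary_in_def by blast
  obtain g' g'' where "C2_graph g g' g''"
    using r(2) unfolding C2_function_def C2_graph_def by blast
  then interpret C2_graph a g g' g'' .
  have "boundary_chart a g g' g'' E (ball x0 r \<inter> \<Omega>)"
    by unfold_locales (use assms r in \<open>auto simp: height_def e1_def e2_def\<close>)
  then show ?thesis using that assms r by force
qed

context boundary_chart
begin

text \<open>Along a direction \<open>n\<close> with \<open>n \<bullet> conormal > 0\<close>, the height has positive derivative.\<close>

lemma eventually_normal:
  assumes x: "x \<in> U" "height x = 0" and n: "0 < n \<bullet> conormal (x \<bullet> e1)"
  shows "\<forall>\<^sub>F t in at_right 0. x + t *\<^sub>R n \<in> E \<and> x - t *\<^sub>R n \<notin> E"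
proof -
  have d: "((\<lambda>t. height (x + t *\<^sub>R m)) has_real_derivative (m \<bullet> conormal (x \<bullet> e1))) (at 0)" for m
  proof -
    have "((\<lambda>t. x + t *\<^sub>R m) has_vector_derivative m) (at 0)"
      by (auto intro!: derivative_eq_intros)
    from C1_gradient_chain[OF C1_height this] show ?thesis by simp
  qed
  obtain d1 where d1: "0 < d1" "\<And>t. 0 < t \<Longrightarrow> t < d1 \<Longrightarrow> 0 < height (x + t *\<^sub>R n)"
    using DERIV_pos_inc_right[OF d[of n] n] x by auto
  obtain d2 where d2: "0 < d2" "\<And>t. 0 < t \<Longrightarrow> t < d2 \<Longrightarrow> height (x + t *\<^sub>R (- n)) < 0"
    using DERIV_neg_dec_right[OF d[of "- n"]] n x by auto
  have "((\<lambda>t. x + t *\<^sub>R n) \<longlongrightarrow> x + 0 *\<^sub>R n) (at_right 0)" "((\<lambda>t. x - t *\<^sub>R n) \<longlongrightarrow> x - 0 *\<^sub>R n) (at_right 0)"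
    by (intro tendsto_intros)+
  then have "\<forall>\<^sub>F t in at_right 0. x + t *\<^sub>R n \<in> U" "\<forall>\<^sub>F t in at_right 0. x - t *\<^sub>R n \<in> U"
    using open_U x(1) by (auto dest!: topological_tendstoD)
  moreover have "\<forall>\<^sub>F t in at_right (0::real). 0 < t \<and> t < d1 \<and> t < d2"
    using d1(1) d2(1) eventually_at_right_real[of 0 "min d1 d2"] by (auto elim!: eventually_mono)
  ultimately show ?thesis
    by eventually_elim (use above below d1 d2 in auto)
qed

lemma frontier_iff:
  assumes x: "x \<in> U" shows "x \<in> frontier E \<longleftrightarrow> height x = 0"
proof
  assume fr: "x \<in> frontier E"
  have open_pos: "open {y \<in> U. 0 < height y}" "open {y \<in> U. height y < 0}"
  proof -
    have "open {y. 0 < height y}" "open {y. height y < 0}"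
      using C1_gradient_continuous[OF C1_height] by (auto intro!: open_Collect_less)
    from open_Int[OF open_U this(1)] open_Int[OF open_U this(2)]
    show "open {y \<in> U. 0 < height y}" "open {y \<in> U. height y < 0}" by (simp_all add: Int_def)
  qed
  show "height x = 0"
  proof (rule ccontr)
    assume "height x \<noteq> 0"
    then consider "0 < height x" | "height x < 0" by linarith
    then show False
    proof cases
      case 1
      then have "x \<in> interior E" using above x open_pos(1) by (intro interiorI[of "{y \<in> U. 0 < height y}"]) auto
      then show ?thesis using fr by (simp add: frontier_def)
    next
      case 2
      then have "x \<in> interior (- E)" using below x open_pos(2) by (intro interiorI[of "{y \<in> U. height y < 0}"]) auto
      then show ?thesis using fr by (simp add: frontier_def interior_complement)
    qed
  qed
next
  assume h: "height x = 0"
  have "0 < angle_vec (angle (x \<bullet> e1) + pi / 2) \<bullet> conormal (x \<bullet> e1)"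
    by (simp add: conormal_eq inner_angle_vec)
  from eventually_normal[OF x h this]
  have ev: "\<forall>\<^sub>F t in at_right 0. x + t *\<^sub>R angle_vec (angle (x \<bullet> e1) + pi / 2) \<in> E"
    "\<forall>\<^sub>F t in at_right 0. x - t *\<^sub>R angle_vec (angle (x \<bullet> e1) + pi / 2) \<in> - E"
    by (auto elim: eventually_mono)
  have "((\<lambda>t. x + t *\<^sub>R angle_vec (angle (x \<bullet> e1) + pi / 2)) \<longlongrightarrow> x) (at_right 0)"
    "((\<lambda>t. x - t *\<^sub>R angle_vec (angle (x \<bullet> e1) + pi / 2)) \<longlongrightarrow> x) (at_right 0)"
    by (auto intro!: tendsto_eq_intros)
  note lim = this
  have "x \<in> closure E"
    using ev(1) closure_subset[of E]
    by (intro Lim_in_closed_set[OF closed_closure _ _ lim(1)]) (auto elim!: eventually_mono)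
  moreover have "x \<in> closure (- E)"
    using ev(2) closure_subset[of "- E"]
    by (intro Lim_in_closed_set[OF closed_closure _ _ lim(2)]) (auto elim!: eventually_mono)
  ultimately show "x \<in> frontier E" by (simp add: frontier_closures)
qed

text \<open>An arc of the boundary moves along the graph, and having \<open>E\<close> on its left excludes the reversed
  direction. So close to the parameter 0 its tangent is the one of the graph, not only up to sign.\<close>

lemma oriented_arc_eventually:
  assumes arc: "oriented_boundary_arc E c \<phi> \<delta>" and c0: "c 0 \<in> U"
  shows "\<forall>\<^sub>F s in nhds 0. angle_vec (\<phi> s) = angle_vec (angle (c s \<bullet> e1))"
proof -
  note arc' = arc[unfolded oriented_boundary_arc_def]
  have "open {s. s \<in> {-\<delta><..<\<delta>} \<and> c s \<in> U}"
  proof -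
    have "continuous_on {-\<delta><..<\<delta>} c"
      using arc' by (meson continuous_at_imp_continuous_on has_vector_derivative_continuous)
    then have "open ({-\<delta><..<\<delta>} \<inter> c -` U)" by (intro continuous_open_preimage open_U) auto
    then show ?thesis by (simp add: Int_def vimage_def)
  qed
  moreover have "0 \<in> {s. s \<in> {-\<delta><..<\<delta>} \<and> c s \<in> U}" using arc' c0 by auto
  ultimately have "\<forall>\<^sub>F s in nhds 0. s \<in> {s. s \<in> {-\<delta><..<\<delta>} \<and> c s \<in> U}" (is "eventually (\<lambda>s. s \<in> ?S) _")
    by (rule eventually_nhds_in_open)
  then show ?thesis
  proof eventually_elim
    case (elim s)
    then have s: "s \<in> {-\<delta><..<\<delta>}" "c s \<in> U" by auto
    let ?y = "angle_vec (\<phi> s) \<bullet> e1"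
    have cd: "(c has_vector_derivative angle_vec (\<phi> s)) (at s)" using arc' s by auto
    have h: "height (c r) = 0" if "r \<in> ?S" for r using arc' that frontier_iff[of "c r"] by blast
    have d: "((\<lambda>r. height (c r)) has_real_derivative angle_vec (\<phi> s) \<bullet> conormal (c s \<bullet> e1)) (at s)"
      by (rule C1_gradient_chain[OF C1_height cd])
    have "((\<lambda>r. height (c r)) has_real_derivative 0) (at s)"
      by (rule has_field_derivative_transform_within_open[of "\<lambda>_. 0" 0 s ?S])
         (use \<open>open ?S\<close> elim h in auto)
    then have 0: "angle_vec (\<phi> s) \<bullet> conormal (c s \<bullet> e1) = 0" using d DERIV_unique by blast
    let ?\<alpha> = "\<phi> s - angle (c s \<bullet> e1)"
    have "cos (\<phi> s - (angle (c s \<bullet> e1) + pi / 2)) = 0"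
      using 0 by (simp add: conormal_eq inner_angle_vec)
    then have sin: "sin ?\<alpha> = 0" by (simp add: cos_diff cos_add sin_add sin_diff)
    have cos: "\<not> cos ?\<alpha> < 0"
    proof
      assume neg: "cos ?\<alpha> < 0"
      have "angle_vec (\<phi> s + pi / 2) \<bullet> angle_vec (angle (c s \<bullet> e1) + pi / 2) = cos ?\<alpha>"
        by (simp add: inner_angle_vec)
      then have "0 < (- angle_vec (\<phi> s + pi / 2)) \<bullet> conormal (c s \<bullet> e1)"
        using neg by (simp add: conormal_eq mult_pos_neg)
      from eventually_normal[OF s(2) h[OF elim] this]
      have "\<forall>\<^sub>F t in at_right 0. c s - t *\<^sub>R angle_vec (\<phi> s + pi / 2) \<in> E" by (auto elim: eventually_mono)
      moreover have "\<forall>\<^sub>F t in at_right 0. c s - t *\<^sub>R angle_vec (\<phi> s + pi / 2) \<notin> E"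
        using arc' s by (auto elim: eventually_mono)
      ultimately have "\<forall>\<^sub>F t in at_right (0::real). False" by eventually_elim auto
      then show False by simp
    qed
    have "cos ?\<alpha> = 1"
      using sin cos sin_cos_squared_add[of ?\<alpha>] by (simp add: power2_eq_1_iff)
    then have "angle_vec (angle (c s \<bullet> e1) + ?\<alpha>) = angle_vec (angle (c s \<bullet> e1))"
      using sin by (subst angle_vec_add) simp
    then show ?case by simp
  qed
qed

text \<open>Near 0 the vectors \<open>angle_vec (\<phi> s)\<close> and \<open>angle_vec (angle (c s \<bullet> e1))\<close> agree. Comparing their
  derivatives, instead of those of the angles, makes the choice of a branch of the angle irrelevant.\<close>

lemma oriented_arc_curvature:
  assumes arc: "oriented_boundary_arc E c \<phi> \<delta>" and c0: "c 0 \<in> U"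
    and k: "(\<phi> has_real_derivative k) (at 0)"
  shows "k = kappa (c 0 \<bullet> e1)"
proof -
  let ?t = "c 0 \<bullet> e1"
  note ev = oriented_arc_eventually[OF arc c0]
  have dir: "angle_vec (\<phi> 0) = angle_vec (angle ?t)" using eventually_nhds_x_imp_x[OF ev] .
  have cd: "(c has_vector_derivative angle_vec (\<phi> 0)) (at 0)"
    using arc by (auto simp: oriented_boundary_arc_def)
  have "((\<lambda>s. c s \<bullet> e1) has_vector_derivative angle_vec (\<phi> 0) \<bullet> e1) (at 0)"
    by (rule bounded_linear.has_vector_derivative[OF bounded_linear_inner_left cd])
  moreover have "angle_vec (\<phi> 0) \<bullet> e1 = 1 / speed ?t"
    using tangent_inner(1)[of ?t] unfolding dir tangent_eq by (simp add: field_simps)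
  ultimately have "((\<lambda>s. c s \<bullet> e1) has_real_derivative 1 / speed ?t) (at 0)"
    by (simp add: has_real_derivative_iff_has_vector_derivative)
  from DERIV_chain2[OF angle_has_derivative this]
  have ad: "((\<lambda>s. angle (c s \<bullet> e1)) has_real_derivative kappa ?t) (at 0)" by (simp add: kappa_def)
  have chain: "((\<lambda>s. angle_vec (p s)) has_vector_derivative d *\<^sub>R angle_vec (p 0 + pi / 2)) (at 0)"
    if "(p has_real_derivative d) (at 0)" for p d
    using vector_diff_chain_at[OF _ angle_vec_has_vector_derivative, of p d 0] that
    by (simp add: has_real_derivative_iff_has_vector_derivative o_def)
  have "((\<lambda>s. angle_vec (\<phi> s)) has_vector_derivative kappa ?t *\<^sub>R angle_vec (angle ?t + pi / 2)) (at 0)"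
    using chain[OF ad] ev eventually_nhds_x_imp_x[OF ev]
    by (subst has_vector_derivative_cong_ev[where g="\<lambda>s. angle_vec (angle (c s \<bullet> e1))"]) auto
  with chain[OF k] have "k *\<^sub>R angle_vec (\<phi> 0 + pi / 2) = kappa ?t *\<^sub>R angle_vec (angle ?t + pi / 2)"
    by (rule vector_derivative_unique_at)
  moreover have "angle_vec (\<phi> 0 + pi / 2) = angle_vec (angle ?t + pi / 2)"
    using dir by (simp add: vec2_eq_iff cos_add sin_add)
  ultimately have "(k - kappa ?t) *\<^sub>R angle_vec (angle ?t + pi / 2) = 0" by (simp add: scaleR_diff_left)
  moreover have "angle_vec (angle ?t + pi / 2) \<noteq> 0" using norm_angle_vec by (metis norm_zero zero_neq_one)
  ultimately show ?thesis by simp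
qed

text \<open>The arc is the graph reparametrised by arclength: \<open>q\<close> inverts an antiderivative \<open>S\<close> of the speed.\<close>

lemma oriented_arc_exists:
  assumes t0: "pt t0 \<in> U"
  obtains c \<phi> \<delta> where "oriented_boundary_arc E c \<phi> \<delta>" "c 0 = pt t0" "\<phi> 0 = angle t0"
    "(\<phi> has_real_derivative kappa t0) (at 0)"
proof -
  obtain S where S: "\<And>t. t \<in> {t0 - 1..t0 + 1} \<Longrightarrow> (S has_vector_derivative speed t) (at t within {t0 - 1..t0 + 1})"
    using antiderivative_continuous[OF continuous_speed] by blast
  have SD: "(S has_real_derivative speed t) (at t)" if "t \<in> {t0 - 1<..<t0 + 1}" for t
  proof -
    have "(S has_vector_derivative speed t) (at t within {t0 - 1..t0 + 1})" using S that by simp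
    then show ?thesis using that by (simp add: has_real_derivative_iff_has_vector_derivative at_within_Icc_at)
  qed
  have Scont: "continuous_on {t0 - 1..t0 + 1} S"
    using S by (meson continuous_on_eq_continuous_within has_vector_derivative_continuous)
  have Smono: "S s < S t" if "t0 - 1 \<le> s" "s < t" "t \<le> t0 + 1" for s t
  proof (rule DERIV_pos_imp_increasing_open[OF that(2)])
    fix x assume "s < x" "x < t"
    then show "\<exists>y. (S has_real_derivative y) (at x) \<and> 0 < y"
      using SD[of x] that by (intro exI[of _ "speed x"]) auto
  qed (use that in \<open>auto intro!: continuous_on_subset[OF Scont]\<close>)
  then have Sinj: "inj_on S {t0 - 1..t0 + 1}"
    by (intro linorder_inj_onI) (auto, metis less_irrefl)
  define q where "q s = inv_into {t0 - 1..t0 + 1} S (S t0 + s)" for s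
  have qS: "q (S t - S t0) = t" if "t \<in> {t0 - 1..t0 + 1}" for t
    using inv_into_f_f[OF Sinj that] by (simp add: q_def)
  have img: "{S (t0 - 1)..S (t0 + 1)} \<subseteq> S ` {t0 - 1..t0 + 1}"
  proof
    fix y assume "y \<in> {S (t0 - 1)..S (t0 + 1)}"
    then obtain t where "t0 - 1 \<le> t" "t \<le> t0 + 1" "S t = y"
      using IVT'[of S "t0 - 1" y "t0 + 1"] Scont by auto
    then show "y \<in> S ` {t0 - 1..t0 + 1}" by auto
  qed
  define \<delta>0 where "\<delta>0 = min (S t0 - S (t0 - 1)) (S (t0 + 1) - S t0)"
  have \<delta>0: "0 < \<delta>0" using Smono[of "t0 - 1" t0] Smono[of t0 "t0 + 1"] by (simp add: \<delta>0_def)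
  have Sq: "S (q s) = S t0 + s" "q s \<in> {t0 - 1<..<t0 + 1}" if "s \<in> {-\<delta>0<..<\<delta>0}" for s
  proof -
    have "S t0 + s \<in> S ` {t0 - 1..t0 + 1}" using that img by (force simp: \<delta>0_def)
    then show 1: "S (q s) = S t0 + s" unfolding q_def by (rule f_inv_into_f)
    have 2: "q s \<in> {t0 - 1..t0 + 1}" unfolding q_def using \<open>S t0 + s \<in> _\<close> by (rule inv_into_into)
    have "q s \<noteq> t0 - 1" "q s \<noteq> t0 + 1" using 1 that by (auto simp: \<delta>0_def)
    with 2 show "q s \<in> {t0 - 1<..<t0 + 1}" by auto
  qed
  have qcont: "continuous_on {-\<delta>0<..<\<delta>0} q"
  proof -
    have "continuous_on (S ` {t0 - 1..t0 + 1}) (inv_into {t0 - 1..t0 + 1} S)"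
      using inv_into_f_f[OF Sinj] by (intro continuous_on_inv[OF Scont compact_Icc]) blast
    moreover have "continuous_on {-\<delta>0<..<\<delta>0} (\<lambda>s. S t0 + s)" by (intro continuous_intros)
    moreover have "(\<lambda>s. S t0 + s) ` {-\<delta>0<..<\<delta>0} \<subseteq> S ` {t0 - 1..t0 + 1}"
      using img by (force simp: \<delta>0_def)
    ultimately show ?thesis unfolding q_def by (rule continuous_on_compose2)
  qed
  have qD: "(q has_real_derivative inverse (speed (q s))) (at s)" if "s \<in> {-\<delta>0<..<\<delta>0}" for s
  proof (rule DERIV_inverse_function[of "\<lambda>t. S t - S t0" _ _ _ "- \<delta>0" \<delta>0])
    show "((\<lambda>t. S t - S t0) has_real_derivative speed (q s)) (at (q s))"
      using SD[OF Sq(2)[OF that]] by (auto intro!: derivative_eq_intros)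
    show "isCont q s" using qcont that by (simp add: continuous_on_eq_continuous_at)
  qed (use that Sq(1) in auto)
  have q0: "q 0 = t0" using qS[of t0] by simp
  define c where "c = (\<lambda>s. pt (q s))"
  define \<phi> where "\<phi> = (\<lambda>s. angle (q s))"
  have cd: "(c has_vector_derivative angle_vec (\<phi> s)) (at s)" if "s \<in> {-\<delta>0<..<\<delta>0}" for s
    using vector_diff_chain_at[OF _ pt_has_vector_derivative, of q "inverse (speed (q s))" s] qD[OF that]
    by (simp add: has_real_derivative_iff_has_vector_derivative o_def c_def \<phi>_def tangent_eq)
  have "continuous_on {-\<delta>0<..<\<delta>0} c"
    using cd by (meson continuous_at_imp_continuous_on has_vector_derivative_continuous)
  then have "open ({-\<delta>0<..<\<delta>0} \<inter> c -` U)" by (intro continuous_open_preimage open_U) auto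
  moreover have "0 \<in> {-\<delta>0<..<\<delta>0} \<inter> c -` U" using \<delta>0 t0 q0 by (simp add: c_def)
  ultimately obtain \<delta> where \<delta>: "0 < \<delta>" "ball 0 \<delta> \<subseteq> {-\<delta>0<..<\<delta>0} \<inter> c -` U"
    unfolding open_contains_ball by blast
  have in\<delta>: "s \<in> {-\<delta>0<..<\<delta>0}" "c s \<in> U" if "s \<in> {-\<delta><..<\<delta>}" for s
    using subsetD[OF \<delta>(2), of s] that by (auto simp: dist_real_def)
  have "oriented_boundary_arc E c \<phi> \<delta>"
    unfolding oriented_boundary_arc_def
  proof (intro conjI ballI \<delta>(1))
    fix s assume s: "s \<in> {-\<delta><..<\<delta>}"
    have h: "height (c s) = 0" by (simp add: c_def)
    show "c s \<in> frontier E" using frontier_iff[OF in\<delta>(2)[OF s]] h by simp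
    show "(c has_vector_derivative angle_vec (\<phi> s)) (at s)" using cd in\<delta>[OF s] by blast
    have "0 < angle_vec (\<phi> s + pi / 2) \<bullet> conormal (c s \<bullet> e1)"
      by (simp add: conormal_eq inner_angle_vec \<phi>_def c_def)
    from eventually_normal[OF in\<delta>(2)[OF s] h this]
    show "\<forall>\<^sub>F t in at_right 0. c s + t *\<^sub>R angle_vec (\<phi> s + pi / 2) \<in> E \<and>
        c s - t *\<^sub>R angle_vec (\<phi> s + pi / 2) \<notin> E" .
  qed
  moreover have "(\<phi> has_real_derivative kappa t0) (at 0)"
    unfolding \<phi>_def using DERIV_chain2[OF angle_has_derivative qD[of 0]] \<delta>0
    by (simp add: q0 kappa_def divide_inverse)
  ultimately show ?thesis using that[of c \<phi> \<delta>] q0 by (simp add: c_def \<phi>_def)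
qed

lemma curvature_eq:
  assumes "pt t \<in> U" shows "curvature E (pt t) = kappa t"
proof -
  obtain c \<phi> \<delta> where c: "oriented_boundary_arc E c \<phi> \<delta>" "c 0 = pt t" "(\<phi> has_real_derivative kappa t) (at 0)"
    using oriented_arc_exists[OF assms] by metis
  show ?thesis unfolding curvature_def
  proof (rule the_equality)
    show "\<exists>c \<phi> \<delta>. oriented_boundary_arc E c \<phi> \<delta> \<and> c 0 = pt t \<and> (\<phi> has_real_derivative kappa t) (at 0)"
      using c by blast
  next
    fix k assume "\<exists>c \<phi> \<delta>. oriented_boundary_arc E c \<phi> \<delta> \<and> c 0 = pt t \<and> (\<phi> has_real_derivative k) (at 0)"
    then show "k = kappa t" using oriented_arc_curvature assms by (metis pt_inner(1))
  qed
qed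

end

text \<open>The representative in \<open>[0, 2\<pi>)\<close> of an angle.\<close>

definition circ :: "real \<Rightarrow> real" where
  "circ \<theta> = \<theta> - 2 * pi * of_int \<lfloor>\<theta> / (2 * pi)\<rfloor>"

lemma circ_range: "circ \<theta> \<in> {0..<2 * pi}"
proof -
  have "of_int \<lfloor>\<theta> / (2 * pi)\<rfloor> \<le> \<theta> / (2 * pi)" "\<theta> / (2 * pi) < of_int \<lfloor>\<theta> / (2 * pi)\<rfloor> + 1" by linarith+
  then have "of_int \<lfloor>\<theta> / (2 * pi)\<rfloor> * (2 * pi) \<le> \<theta>" "\<theta> < (of_int \<lfloor>\<theta> / (2 * pi)\<rfloor> + 1) * (2 * pi)"
    by (simp_all only: pos_le_divide_eq pos_divide_less_eq pi_gt_zero zero_less_mult_iff zero_less_numeral simp_thms)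
  then show ?thesis by (simp add: circ_def algebra_simps)
qed

lemma borel_circ [measurable]: "circ \<in> borel_measurable borel"
  unfolding circ_def[abs_def] by measurable

lemma periodic_circ:
  assumes "\<And>\<theta>. p (\<theta> + 2 * pi) = p \<theta>" shows "p (circ \<theta>) = p \<theta>"
proof -
  have nat: "p (\<theta> + 2 * pi * real n) = p \<theta>" for \<theta> n
  proof (induction n)
    case (Suc n)
    have "\<theta> + 2 * pi * real (Suc n) = (\<theta> + 2 * pi * real n) + 2 * pi" by (simp add: algebra_simps)
    then show ?case using Suc assms by metis
  qed simp
  have "p (\<theta> + 2 * pi * of_int k) = p \<theta>" for \<theta> and k :: int
  proof (cases "0 \<le> k")
    case True
    then show ?thesis using nat[of \<theta> "nat k"] by simp
  next
    case False
    then show ?thesis using nat[of "\<theta> + 2 * pi * of_int k" "nat (- k)"] by simp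
  qed
  from this[of \<theta> "- \<lfloor>\<theta> / (2 * pi)\<rfloor>"] show ?thesis by (simp add: circ_def)
qed

lemma angle_vec_circ [simp]: "angle_vec (circ \<theta>) = angle_vec \<theta>"
  by (rule periodic_circ) simp

text \<open>Only one representative of an angle lies in \<open>[0, 2\<pi>)\<close>.\<close>

lemma circ_eqI:
  assumes "cos (\<theta> - \<alpha>) = 1" "\<theta> \<in> {0..<2 * pi}" shows "circ \<alpha> = \<theta>"
proof -
  have "cos (circ \<alpha> - \<theta>) = 1"
    using assms(1) periodic_circ[of "\<lambda>\<alpha>. cos (\<alpha> - \<theta>)" \<alpha>] cos_minus[of "\<theta> - \<alpha>"]
    by (simp add: diff_add_eq[symmetric] del: diff_add_eq)
  then obtain n :: int where "circ \<alpha> - \<theta> = of_int n * 2 * pi" using cos_one_2pi_int by blast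
  moreover have "\<bar>circ \<alpha> - \<theta>\<bar> < 2 * pi" using circ_range[of \<alpha>] assms(2) by auto
  ultimately have "\<bar>of_int n :: real\<bar> < 1" by (simp add: abs_mult)
  then have "n = 0" by linarith
  then show ?thesis using \<open>circ \<alpha> - \<theta> = _\<close> by simp
qed

text \<open>Like \<open>curvature\<close>, the tangent angle is defined from \<open>E\<close> alone, so its values in overlapping charts
  agree without a comparison of the charts.\<close>

definition tangent_angle :: "(real ^ 2) set \<Rightarrow> real ^ 2 \<Rightarrow> real" where
  "tangent_angle E x = (THE \<theta>. \<theta> \<in> {0..<2 * pi} \<and>
    (\<exists>c \<phi> \<delta>. oriented_boundary_arc E c \<phi> \<delta> \<and> c 0 = x \<and> angle_vec (\<phi> 0) = angle_vec \<theta>))"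

lemma (in boundary_chart) tangent_angle_eq:
  assumes "pt t \<in> U" shows "tangent_angle E (pt t) = circ (angle t)"
proof -
  obtain c \<phi> \<delta> where c: "oriented_boundary_arc E c \<phi> \<delta>" "c 0 = pt t" "\<phi> 0 = angle t"
    using oriented_arc_exists[OF assms] by metis
  show ?thesis unfolding tangent_angle_def
  proof (rule the_equality)
    show "circ (angle t) \<in> {0..<2 * pi} \<and> (\<exists>c \<phi> \<delta>. oriented_boundary_arc E c \<phi> \<delta> \<and> c 0 = pt t \<and>
        angle_vec (\<phi> 0) = angle_vec (circ (angle t)))"
      using c circ_range by (metis angle_vec_circ)
  next
    fix \<theta> assume \<theta>: "\<theta> \<in> {0..<2 * pi} \<and> (\<exists>c \<phi> \<delta>. oriented_boundary_arc E c \<phi> \<delta> \<and> c 0 = pt t \<and>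
        angle_vec (\<phi> 0) = angle_vec \<theta>)"
    then have "angle_vec \<theta> = angle_vec (angle t)"
      using eventually_nhds_x_imp_x[OF oriented_arc_eventually] assms by (metis pt_inner(1))
    then have "cos (\<theta> - angle t) = 1" by (metis cancel_comm_monoid_add_class.diff_cancel cos_zero inner_angle_vec)
    then show "\<theta> = circ (angle t)" using circ_eqI \<theta> by metis
  qed
qed

section \<open>Divergence theorem and length measure in a chart\<close>

lemma continuous_vec2: "continuous_on S (\<lambda>z :: real \<times> real. vector [fst z, snd z] :: real ^ 2)"
proof -
  have "(\<lambda>z :: real \<times> real. vector [fst z, snd z] :: real ^ 2) =
      (\<lambda>z. fst z *\<^sub>R angle_vec 0 + snd z *\<^sub>R angle_vec (pi / 2))"
    by (simp add: fun_eq_iff vec2_eq_iff)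
  then show ?thesis by (simp only:) (intro continuous_intros)
qed

lemma borel_vec2: "(\<lambda>(t, s). vector [t, s] :: real ^ 2) \<in> borel_measurable (lborel \<Otimes>\<^sub>M lborel)"
  using borel_measurable_continuous_onI[OF continuous_vec2] by (simp add: split_beta' lborel_prod)

lemma lborel_vec2: "distr (lborel \<Otimes>\<^sub>M lborel) borel (\<lambda>(t, s). vector [t, s] :: real ^ 2) = lborel"
proof (rule lborel_eqI[symmetric])
  fix l u :: "real ^ 2" assume le: "\<And>b. b \<in> Basis \<Longrightarrow> l \<bullet> b \<le> u \<bullet> b"
  have "(\<lambda>(t, s). vector [t, s] :: real ^ 2) -` box l u \<inter> space (lborel \<Otimes>\<^sub>M lborel) = {l $ 1<..<u $ 1} \<times> {l $ 2<..<u $ 2}"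
    by (auto simp: mem_box_cart forall_2 space_pair_measure)
  moreover have le2: "l $ i \<le> u $ i" for i
    using le[of "axis i 1"] by (simp add: inner_axis)
  moreover have "(\<Prod>b\<in>Basis. (u - l) \<bullet> b) = (\<Prod>i\<in>UNIV. (u - l) $ i)"
    unfolding Basis_vec_def by (subst prod.reindex_cong[where l="\<lambda>i. axis i 1" and B=UNIV]) 
       (auto simp: inner_axis inj_on_def axis_eq_axis)
  ultimately show "emeasure (distr (lborel \<Otimes>\<^sub>M lborel) borel (\<lambda>(t, s). vector [t, s] :: real ^ 2)) (box l u) = (\<Prod>b\<in>Basis. (u - l) \<bullet> b)"
    using borel_vec2 by (simp add: emeasure_distr lborel.emeasure_pair_measure_Times UNIV_2 ennreal_mult)
qed simp

lemma FTC_compact_support: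
  fixes h h' :: "real \<Rightarrow> real"
  assumes h: "\<And>t. (h has_real_derivative h' t) (at t)" and c: "continuous_on UNIV h'"
    and supp: "\<And>t. N \<le> \<bar>t\<bar> \<Longrightarrow> h t = 0" "\<And>t. N \<le> \<bar>t\<bar> \<Longrightarrow> h' t = 0" and N: "0 \<le> N"
  shows "(LINT t|lborel. h' t) = 0" "(LINT t|lborel. indicator {0<..} t * h' t) = - h 0"
proof -
  have cc: "isCont h' t" for t using c by (simp add: continuous_on_eq_continuous_at)
  have "(LINT t|lborel. h' t) = (LINT t|lborel. h' t * indicator {-N..N} t)"
    using supp(2) by (intro Bochner_Integration.integral_cong) (auto split: split_indicator)
  also have "\<dots> = h N - h (- N)" using N h cc by (intro integral_FTC_Icc_real) auto
  finally show "(LINT t|lborel. h' t) = 0" using supp(1)[of N] supp(1)[of "- N"] by simp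
  have "(LINT t|lborel. indicator {0<..} t * h' t) = (LINT t|lborel. h' t * indicator {0..N} t)"
  proof (rule integral_cong_AE)
    have "AE t in lborel. t \<noteq> (0::real)" using AE_lborel_singleton[of "0::real"] by simp
    then show "AE t in lborel. indicator {0<..} t * h' t = h' t * indicator {0..N} t"
      by eventually_elim (use supp(2) in \<open>auto split: split_indicator\<close>)
  qed (use borel_measurable_continuous_onI[OF c] in measurable)
  also have "\<dots> = h N - h 0" using N h cc by (intro integral_FTC_Icc_real) auto
  finally show "(LINT t|lborel. indicator {0<..} t * h' t) = - h 0" using supp(1)[of N] N by simp
qed

lemma integrable_continuous_compact_support:
  fixes f :: "'a::euclidean_space \<Rightarrow> real"
  assumes "compact K" "continuous_on UNIV f" "\<And>x. x \<notin> K \<Longrightarrow> f x = 0" "A \<in> sets borel"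
  shows "integrable lborel (\<lambda>x. indicator A x * f x)"
proof -
  have "integrable lborel (\<lambda>x. indicator K x *\<^sub>R f x)"
    using borel_integrable_compact[OF assms(1)] continuous_on_subset[OF assms(2)] by blast
  then have "integrable lborel (\<lambda>x. indicator A x *\<^sub>R (indicator K x *\<^sub>R f x))"
    by (rule integrable_mult_indicator[rotated]) (simp add: assms(4))
  moreover have "(\<lambda>x. indicator A x *\<^sub>R (indicator K x *\<^sub>R f x)) = (\<lambda>x. indicator A x * f x)"
    using assms(3) by (auto simp: fun_eq_iff split: split_indicator)
  ultimately show ?thesis by (simp only:)
qed

context C2_graph
begin

text \<open>Passing from the standard frame to \<open>e1\<close>, \<open>e2\<close> is an orthogonal transformation, which preserves
  the volume of boxes.\<close>

lemma lborel_frame: "distr (lborel \<Otimes>\<^sub>M lborel) borel (\<lambda>(t, s). t *\<^sub>R e1 + s *\<^sub>R e2) = lborel"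
proof -
  define Q where "Q = (\<lambda>x :: real ^ 2. x $ 1 *\<^sub>R e1 + x $ 2 *\<^sub>R e2)"
  define R where "R = (\<lambda>x :: real ^ 2. vector [x \<bullet> e1, x \<bullet> e2] :: real ^ 2)"
  have lin: "linear R" unfolding R_def
    by (intro linearI) (simp_all add: vec2_eq_iff inner_add_left)
  have "R x \<bullet> R y = x \<bullet> y" for x y
    by (subst (2) frame_expansion, subst (3) frame_expansion)
       (simp add: R_def inner_vec2[of "vector _"] inner_add_left inner_add_right mult.commute)
  with lin have orth: "orthogonal_transformation R" by (simp add: orthogonal_transformation_def)
  have QR: "Q (R x) = x" for x using frame_expansion[of x] by (simp add: Q_def R_def)
  have RQ: "R (Q x) = x" for x by (simp add: Q_def R_def vec2_eq_iff inner_add_left)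
  have cQ: "continuous_on UNIV Q" unfolding Q_def by (intro continuous_intros)
  then have mQ: "Q \<in> borel_measurable borel" by (rule borel_measurable_continuous_onI)
  have "distr lborel borel Q = lborel"
  proof (rule lborel_eqI[symmetric])
    fix l u :: "real ^ 2" assume le: "\<And>b. b \<in> Basis \<Longrightarrow> l \<bullet> b \<le> u \<bullet> b"
    have vim: "Q -` box l u = R ` box l u"
      using QR RQ by (auto simp: image_iff) (metis RQ)
    have opn: "open (Q -` box l u)" by (rule open_vimage[OF open_box cQ])
    have "R ` box l u \<in> lmeasurable" by (intro measurable_orthogonal_image orth lmeasurable_box)
    then have "emeasure lebesgue (R ` box l u) = ennreal (measure lebesgue (R ` box l u))"
      by (rule emeasure_eq_measure2)
    moreover have "emeasure lebesgue (Q -` box l u) = emeasure lborel (Q -` box l u)"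
      using opn by simp
    ultimately have "emeasure lborel (Q -` box l u) = ennreal (measure lebesgue (R ` box l u))"
      by (simp only: vim)
    also have "measure lebesgue (R ` box l u) = measure lebesgue (box l u)"
      by (rule measure_orthogonal_image[OF orth lmeasurable_box])
    also have "\<dots> = (\<Prod>b\<in>Basis. (u - l) \<bullet> b)" using le by (simp add: measure_lborel_box_eq)
    finally show "emeasure (distr lborel borel Q) (box l u) = (\<Prod>b\<in>Basis. (u - l) \<bullet> b)"
      using mQ by (simp add: emeasure_distr)
  qed simp
  then have "lborel = distr (distr (lborel \<Otimes>\<^sub>M lborel) borel (\<lambda>(t, s). vector [t, s] :: real ^ 2)) borel Q"
    by (simp add: lborel_vec2)
  also have "\<dots> = distr (lborel \<Otimes>\<^sub>M lborel) borel (Q \<circ> (\<lambda>(t, s). vector [t, s] :: real ^ 2))"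
    by (rule distr_distr[OF mQ borel_vec2])
  also have "Q \<circ> (\<lambda>(t, s). vector [t, s] :: real ^ 2) = (\<lambda>(t, s). t *\<^sub>R e1 + s *\<^sub>R e2)"
    by (auto simp: Q_def fun_eq_iff)
  finally show ?thesis by simp
qed

text \<open>Coordinates that straighten the graph. They differ from the frame by a shear, so Fubini's theorem
  and translation invariance in \<open>s\<close> show that they preserve Lebesgue measure.\<close>

definition "Phi = (\<lambda>(t, s). pt t + s *\<^sub>R e2)"

lemma Phi_inner [simp]: "Phi (t, s) \<bullet> e1 = t" "Phi (t, s) \<bullet> e2 = g t + s"
  by (simp_all add: Phi_def inner_add_left)

lemma height_Phi [simp]: "height (Phi (t, s)) = s"
  by (simp add: height_def)

lemma Phi_inverse: "Phi (x \<bullet> e1, height x) = x"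
  by (rule frame_eqI) (simp_all add: height_def)

lemma Phi_0 [simp]: "Phi (t, 0) = pt t"
  by (simp add: Phi_def)

lemma continuous_Phi: "continuous_on S Phi"
  unfolding Phi_def split_beta'
  by (intro continuous_intros continuous_on_compose2[OF continuous_pt[of UNIV]]) auto

lemma borel_Phi [measurable]: "Phi \<in> borel_measurable borel"
  by (intro borel_measurable_continuous_onI continuous_Phi)

lemma nn_integral_Phi:
  assumes [measurable]: "F \<in> borel_measurable borel"
  shows "(\<integral>\<^sup>+x. F x \<partial>lborel) = (\<integral>\<^sup>+t. \<integral>\<^sup>+s. F (Phi (t, s)) \<partial>lborel \<partial>lborel)"
proof -
  have m: "(\<lambda>(t, s). t *\<^sub>R e1 + s *\<^sub>R e2) \<in> borel_measurable (lborel \<Otimes>\<^sub>M lborel)"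
    by (simp add: split_beta' lborel_prod) (intro borel_measurable_continuous_onI continuous_intros)
  have "(\<integral>\<^sup>+x. F x \<partial>lborel) = (\<integral>\<^sup>+x. F x \<partial>distr (lborel \<Otimes>\<^sub>M lborel) borel (\<lambda>(t, s). t *\<^sub>R e1 + s *\<^sub>R e2))"
    by (simp add: lborel_frame)
  also have "\<dots> = (\<integral>\<^sup>+z. F (case z of (t, s) \<Rightarrow> t *\<^sub>R e1 + s *\<^sub>R e2) \<partial>(lborel \<Otimes>\<^sub>M lborel))"
    using m by (rule nn_integral_distr) simp
  also have "\<dots> = (\<integral>\<^sup>+t. \<integral>\<^sup>+s. F (t *\<^sub>R e1 + s *\<^sub>R e2) \<partial>lborel \<partial>lborel)"
    using measurable_compose[OF m, of F borel] by (subst lborel.nn_integral_fst[symmetric]) auto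
  also have "\<dots> = (\<integral>\<^sup>+t. \<integral>\<^sup>+s. F (t *\<^sub>R e1 + (g t + 1 * s) *\<^sub>R e2) \<partial>lborel \<partial>lborel)"
  proof (rule nn_integral_cong)
    fix t
    have "(\<lambda>s. F (t *\<^sub>R e1 + s *\<^sub>R e2)) \<in> borel_measurable borel" by measurable
    from nn_integral_real_affine[OF this, of 1 "g t"]
    show "(\<integral>\<^sup>+s. F (t *\<^sub>R e1 + s *\<^sub>R e2) \<partial>lborel) = (\<integral>\<^sup>+s. F (t *\<^sub>R e1 + (g t + 1 * s) *\<^sub>R e2) \<partial>lborel)"
      by simp
  qed
  finally show ?thesis by (simp add: Phi_def pt_def scaleR_add_left add.assoc)
qed

lemma lborel_Phi: "distr (lborel \<Otimes>\<^sub>M lborel) borel Phi = lborel"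
proof (rule measure_eqI)
  have m: "Phi \<in> borel_measurable (lborel \<Otimes>\<^sub>M lborel)" by (simp add: lborel_prod)
  fix A assume "A \<in> sets (distr (lborel \<Otimes>\<^sub>M lborel) borel Phi)"
  then have A[measurable]: "A \<in> sets borel" by simp
  have "emeasure (distr (lborel \<Otimes>\<^sub>M lborel) borel Phi) A = (\<integral>\<^sup>+z. indicator A (Phi z) \<partial>(lborel \<Otimes>\<^sub>M lborel))"
    using m by (subst nn_integral_distr[symmetric]) auto
  also have "\<dots> = (\<integral>\<^sup>+t. \<integral>\<^sup>+s. indicator A (Phi (t, s)) \<partial>lborel \<partial>lborel)"
    using measurable_compose[OF m, of "indicator A" "borel :: ennreal measure"] A by (subst lborel.nn_integral_fst[symmetric]) auto
  also have "\<dots> = (\<integral>\<^sup>+x. indicator A x \<partial>lborel)" using A by (intro nn_integral_Phi[symmetric]) simp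
  finally show "emeasure (distr (lborel \<Otimes>\<^sub>M lborel) borel Phi) A = emeasure lborel A" by simp
qed simp

lemma graph_null: "{x. height x = 0} \<in> null_sets lborel"
proof -
  have [measurable]: "{x. height x = 0} \<in> sets borel" by measurable
  have "emeasure lborel {x. height x = 0} = (\<integral>\<^sup>+x. indicator {x. height x = 0} x \<partial>lborel)" by simp
  also have "\<dots> = (\<integral>\<^sup>+t. \<integral>\<^sup>+s. indicator {x. height x = 0} (Phi (t, s)) \<partial>lborel \<partial>lborel)"
    by (rule nn_integral_Phi) simp
  also have "\<dots> = (\<integral>\<^sup>+t. \<integral>\<^sup>+s. indicator {0::real} s \<partial>lborel \<partial>(lborel :: real measure))"
    by (intro nn_integral_cong) (auto split: split_indicator)
  also have "\<dots> = 0" by simp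
  finally show ?thesis by (intro null_setsI) auto
qed

lemma trace_frame: "trace J = (J *v e1) \<bullet> e1 + (J *v e2) \<bullet> e2" for J :: "real ^ 2 ^ 2"
proof -
  have c: "cos a * (cos a * r) + sin a * (sin a * r) = r" for r
    using sin_cos_squared_add3[of a] by (metis distrib_right mult.assoc mult_1)
  show ?thesis
    using c[of "J $ 1 $ 1"] c[of "J $ 2 $ 2"]
    by (simp add: trace_def sum_2 inner_vec2 matrix_vector_mult_def e1_def e2_def cos_add sin_add algebra_simps)
qed

text \<open>The divergence theorem above the graph. In the coordinates \<open>Phi\<close>, which have Jacobian one, the
  region is a half-plane, and only the derivative across its boundary contributes.\<close>

lemma divergence_above_graph:
  assumes \<phi>: "\<And>x. (\<phi> has_derivative (\<lambda>v. J x *v v)) (at x)" and J: "continuous_on UNIV J"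
    and K: "compact K" "\<And>x. x \<notin> K \<Longrightarrow> \<phi> x = 0"
  shows "integrable lborel (\<lambda>x. indicator {x. 0 < height x} x * trace (J x))"
    and "(LINT x|lborel. indicator {x. 0 < height x} x * trace (J x)) = - (LINT t|lborel. perp (\<phi> (pt t)) \<bullet> tangent t)"
    and "(LINT x|lborel. trace (J x)) = 0"
proof -
  have J0: "J x = 0" if "x \<notin> K" for x
    using jacobian_zero_outside[OF \<phi> K that] .
  have cJ: "continuous_on UNIV (\<lambda>z. J (Phi z) *v v)" for v
    using continuous_on_compose2[OF J continuous_Phi[of UNIV]]
    unfolding matrix_vector_mult_def by (auto intro!: continuous_intros)
  define C where "C = (\<lambda>x. (x \<bullet> e1, height x)) ` K"
  have C: "compact C" unfolding C_def
    using K(1) C1_gradient_continuous[OF C1_height]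
    by (intro compact_continuous_image continuous_intros) (auto intro: continuous_on_subset)
  have outC: "Phi z \<notin> K" if "z \<notin> C" for z
  proof
    assume "Phi z \<in> K"
    then have "(Phi z \<bullet> e1, height (Phi z)) \<in> C" unfolding C_def by blast
    then show False using that by (cases z) simp
  qed
  obtain N where N: "0 \<le> N" "\<And>z. z \<in> C \<Longrightarrow> norm z < N"
    using compact_imp_bounded[OF C] unfolding bounded_pos by (metis less_add_one add.commute le_less_trans less_imp_le linorder_not_le add_pos_pos zero_less_one)
  have out: "Phi (t, s) \<notin> K" if "N \<le> \<bar>t\<bar> \<or> N \<le> \<bar>s\<bar>" for t s
    using N(2)[of "(t, s)"] that norm_fst_le[of t s] norm_snd_le[of s t]
    by (intro outC) (auto simp: real_norm_def)
  define D where "D z = trace (J (Phi z))" for z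
  \<comment> \<open>With \<open>A = \<phi> (Phi z) \<bullet> e1\<close> and \<open>B = \<phi> (Phi z) \<bullet> e2\<close>, the divergence of \<open>\<phi>\<close> at \<open>Phi (t, s)\<close>\<close>
  \<comment> \<open>is the sum of the \<open>t\<close>-derivative of \<open>A\<close> and the \<open>s\<close>-derivative of \<open>B - g' t * A\<close>.\<close>
  define At where "At = (\<lambda>(t, s). (J (Phi (t, s)) *v tangent t) \<bullet> e1)"
  define Bs where "Bs = (\<lambda>(t, s). (J (Phi (t, s)) *v e2) \<bullet> e2 - g' t * ((J (Phi (t, s)) *v e2) \<bullet> e1))"
  have D: "D z = At z + Bs z" for z
    unfolding D_def At_def Bs_def tangent_def trace_frame
    by (cases z) (simp add: matrix_vector_right_distrib matrix_vector_mult_scaleR inner_add_left)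
  have cAt: "continuous_on UNIV At"
  proof -
    have "At = (\<lambda>z. (J (Phi z) *v e1) \<bullet> e1 + g' (fst z) * ((J (Phi z) *v e2) \<bullet> e1))"
      by (auto simp: At_def fun_eq_iff tangent_def matrix_vector_right_distrib matrix_vector_mult_scaleR inner_add_left)
    then show ?thesis
      by (simp only:) (intro continuous_intros cJ continuous_on_compose2[OF continuous_g'[of UNIV]], auto)
  qed
  have cBs: "continuous_on UNIV Bs"
    unfolding Bs_def split_beta'
    using cJ by (auto intro!: continuous_intros continuous_on_compose2[OF continuous_g'[of UNIV]])
  have zero: "At z = 0" "Bs z = 0" if "z \<notin> C" for z
    using J0[OF outC[OF that]] by (auto simp: At_def Bs_def split: prod.split)
  have half: "{z :: real \<times> real. 0 < snd z} \<in> sets borel"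
    by (intro borel_open open_Collect_less continuous_intros)
  have iA: "integrable (lborel \<Otimes>\<^sub>M lborel) (\<lambda>z. indicator H z * At z)"
    and iB: "integrable (lborel \<Otimes>\<^sub>M lborel) (\<lambda>z. indicator H z * Bs z)" if "H \<in> sets borel" for H
    using integrable_continuous_compact_support[OF C cAt zero(1) that]
      integrable_continuous_compact_support[OF C cBs zero(2) that] by (auto simp: lborel_prod)
  have Phi_vd: "((\<lambda>s. Phi (t, s)) has_vector_derivative e2) (at s)"
     "((\<lambda>t. Phi (t, s)) has_vector_derivative tangent t) (at t)" for t s
    unfolding Phi_def using pt_has_vector_derivative[of t] by (auto intro!: derivative_eq_intros)
  have comp: "C1_gradient (\<lambda>x. \<phi> x \<bullet> e) (\<lambda>x. e v* J x)" for e
    using \<phi> J K by (intro plane_test_field_component[of UNIV]) (auto simp: plane_test_field_def)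
  have vJ: "v \<bullet> (e v* M) = (M *v v) \<bullet> e" for v e :: "real ^ 2" and M :: "real ^ 2 ^ 2"
    by (metis dot_lmul_matrix inner_commute)
  have dA: "((\<lambda>t. \<phi> (Phi (t, s)) \<bullet> e1) has_real_derivative At (t, s)) (at t)" for t s
    using C1_gradient_chain[OF comp[of e1] Phi_vd(2)[of s t]] by (simp add: At_def vJ)
  have dB: "((\<lambda>s. \<phi> (Phi (t, s)) \<bullet> e2 - g' t * (\<phi> (Phi (t, s)) \<bullet> e1)) has_real_derivative Bs (t, s)) (at s)" for t s
    using C1_gradient_chain[OF comp[of e2] Phi_vd(1)[of t s]] C1_gradient_chain[OF comp[of e1] Phi_vd(1)[of t s]]
    by (auto simp: Bs_def vJ intro!: derivative_eq_intros)
  have cA1: "continuous_on UNIV (\<lambda>t. At (t, s))" and cB1: "continuous_on UNIV (\<lambda>t. Bs (s, t))" for s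
    by (auto intro!: continuous_on_compose2[OF cAt] continuous_on_compose2[OF cBs] continuous_intros)
  have zA: "\<phi> (Phi (t, s)) = 0" "At (t, s) = 0" "Bs (t, s) = 0" if "N \<le> \<bar>t\<bar> \<or> N \<le> \<bar>s\<bar>" for t s
    using out[OF that] K(2) J0 by (auto simp: At_def Bs_def)
  have intA: "(LINT t|lborel. At (t, s)) = 0" for s
    using zA by (intro FTC_compact_support(1)[OF dA cA1 _ _ N(1)]) auto
  have intB: "(LINT s|lborel. indicator {0<..} s * Bs (t, s)) = - (perp (\<phi> (pt t)) \<bullet> tangent t)" for t
  proof -
    have "(LINT s|lborel. indicator {0<..} s * Bs (t, s)) = - (\<phi> (Phi (t, 0)) \<bullet> e2 - g' t * (\<phi> (Phi (t, 0)) \<bullet> e1))"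
      using zA by (intro FTC_compact_support(2)[OF dB cB1 _ _ N(1)]) auto
    also have "perp x \<bullet> tangent t = x \<bullet> e2 - g' t * (x \<bullet> e1)" for x
    proof -
      have "perp x \<bullet> e1 = x \<bullet> e2" by (simp add: e1_def e2_def perp_inner_angle_vec)
      moreover have "perp x \<bullet> e2 = - (x \<bullet> e1)"
        by (simp add: e1_def e2_def perp_def inner_vec2 cos_add sin_add)
      ultimately show ?thesis by (simp add: tangent_def inner_add_right)
    qed
    ultimately show ?thesis by simp
  qed
  have intB0: "(LINT s|lborel. Bs (t, s)) = 0" for t
    using zA by (intro FTC_compact_support(1)[OF dB cB1 _ _ N(1)]) auto
  have Fub: "(LINT z|(lborel \<Otimes>\<^sub>M lborel). F z) = (LINT t|lborel. LINT s|lborel. F (t, s))"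
     "(LINT z|(lborel \<Otimes>\<^sub>M lborel). F z) = (LINT s|lborel. LINT t|lborel. F (t, s))"
    if "integrable (lborel \<Otimes>\<^sub>M lborel) F" for F :: "real \<times> real \<Rightarrow> real"
    using lborel_pair.integral_fst[of "\<lambda>t s. F (t, s)"] lborel_pair.integral_snd[of "\<lambda>t s. F (t, s)"] that
    by (simp_all add: split_beta')
  have mD: "(\<lambda>x. trace (J x)) \<in> borel_measurable borel"
    using J unfolding trace_def by (intro borel_measurable_continuous_onI continuous_intros) 
  have mPhi: "Phi \<in> borel_measurable (lborel \<Otimes>\<^sub>M lborel)" by (simp add: lborel_prod)
  have hs: "{x. 0 < height x} \<in> sets borel" by measurable
  have pull: "indicator {x. 0 < height x} (Phi z) = (indicator {z. 0 < snd z} z :: real)" for z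
    by (cases z) (auto split: split_indicator)
  have cT: "continuous_on UNIV (\<lambda>x. trace (J x))" using J unfolding trace_def by (intro continuous_intros)
  show "integrable lborel (\<lambda>x. indicator {x. 0 < height x} x * trace (J x))"
    by (rule integrable_continuous_compact_support[OF K(1) cT _ hs]) (simp add: J0 trace_def)
  have "(LINT x|lborel. indicator {x. 0 < height x} x * trace (J x))
      = (LINT z|(lborel \<Otimes>\<^sub>M lborel). indicator {z. 0 < snd z} z * D z)"
    using mPhi mD hs by (subst lborel_Phi[symmetric], subst integral_distr) (auto simp: pull D_def)
  also have "\<dots> = (LINT z|(lborel \<Otimes>\<^sub>M lborel). indicator {z. 0 < snd z} z * At z) +
      (LINT z|(lborel \<Otimes>\<^sub>M lborel). indicator {z. 0 < snd z} z * Bs z)"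
    unfolding D distrib_left by (intro Bochner_Integration.integral_add iA iB half)
  also have "(LINT z|(lborel \<Otimes>\<^sub>M lborel). indicator {z. 0 < snd z} z * At z) =
      (LINT s|lborel. LINT t|lborel. indicator {0<..} s * At (t, s))"
    using Fub(2)[OF iA[OF half]] by (simp add: indicator_def)
  also have "\<dots> = 0" by (simp add: intA)
  also have "(LINT z|(lborel \<Otimes>\<^sub>M lborel). indicator {z. 0 < snd z} z * Bs z) =
      (LINT t|lborel. LINT s|lborel. indicator {0<..} s * Bs (t, s))"
    using Fub(1)[OF iB[OF half]] by (simp add: indicator_def)
  also have "\<dots> = - (LINT t|lborel. perp (\<phi> (pt t)) \<bullet> tangent t)" by (simp add: intB)
  finally show "(LINT x|lborel. indicator {x. 0 < height x} x * trace (J x)) = - (LINT t|lborel. perp (\<phi> (pt t)) \<bullet> tangent t)"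
    by simp
  have "(LINT x|lborel. trace (J x)) = (LINT z|(lborel \<Otimes>\<^sub>M lborel). D z)"
    using mPhi mD by (subst lborel_Phi[symmetric], subst integral_distr) (auto simp: D_def[abs_def])
  also have "\<dots> = (LINT z|(lborel \<Otimes>\<^sub>M lborel). At z) + (LINT z|(lborel \<Otimes>\<^sub>M lborel). Bs z)"
    unfolding D using iA[of UNIV] iB[of UNIV] by (intro Bochner_Integration.integral_add) simp_all
  also have "(LINT z|(lborel \<Otimes>\<^sub>M lborel). At z) = 0"
    using Fub(2)[of At] iA[of UNIV] intA by simp
  also have "(LINT z|(lborel \<Otimes>\<^sub>M lborel). Bs z) = 0"
    using Fub(1)[of Bs] iB[of UNIV] intB0 by simp
  finally show "(LINT x|lborel. trace (J x)) = 0" by simp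
qed

lemma graph_arc_borel: "pt ` {u..v} \<in> sets borel"
  by (intro borel_compact compact_continuous_image continuous_pt) simp

text \<open>The projection onto the chord is a contraction, and by continuity its image of the arc contains the
  whole chord.\<close>

lemma hausdorff1_graph_arc_ge:
  assumes "u \<le> v" shows "ennreal (norm (pt v - pt u)) \<le> emeasure hausdorff1 (pt ` {u..v})"
proof (cases "pt v = pt u")
  case False
  define d where "d = (pt v - pt u) /\<^sub>R norm (pt v - pt u)"
  have nd: "norm d = 1" using False by (simp add: d_def)
  have d: "pt v \<bullet> d - pt u \<bullet> d = norm (pt v - pt u)"
  proof -
    have "(pt v - pt u) \<bullet> d = norm (pt v - pt u)"
      using False by (simp add: d_def dot_square_norm power2_eq_square)
    then show ?thesis by (simp add: inner_diff_left)
  qed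
  have "ennreal (pt v \<bullet> d - pt u \<bullet> d) \<le> hausdorff1_outer (pt ` {u..v})"
  proof (rule hausdorff1_outer_ge_projection[where P="\<lambda>x. x \<bullet> d"])
    show "\<bar>x \<bullet> d - y \<bullet> d\<bar> \<le> dist x y" for x y
      using Cauchy_Schwarz_ineq2[of "x - y" d] nd by (simp add: inner_diff_left dist_norm)
    show "{pt u \<bullet> d..pt v \<bullet> d} \<subseteq> (\<lambda>x. x \<bullet> d) ` pt ` {u..v}"
    proof
      fix y assume y: "y \<in> {pt u \<bullet> d..pt v \<bullet> d}"
      have "continuous_on {u..v} (\<lambda>t. pt t \<bullet> d)" by (intro continuous_intros continuous_pt)
      then obtain t where "u \<le> t" "t \<le> v" "pt t \<bullet> d = y"
        using IVT'[of "\<lambda>t. pt t \<bullet> d" u y v] y assms by auto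
      then show "y \<in> (\<lambda>x. x \<bullet> d) ` pt ` {u..v}" by auto
    qed
  qed
  then show ?thesis using d by (simp add: emeasure_hausdorff1 graph_arc_borel)
qed simp

lemma hausdorff1_graph_arc_le:
  assumes "u \<le> v" "\<And>t. t \<in> {u..v} \<Longrightarrow> speed t \<le> L" "0 \<le> L"
  shows "emeasure hausdorff1 (pt ` {u..v}) \<le> ennreal (L * (v - u))"
proof -
  have "L-lipschitz_on {u..v} pt"
  proof (rule bounded_derivative_imp_lipschitz[where f'="\<lambda>t h. h *\<^sub>R tangent t"])
    fix t assume "t \<in> {u..v}"
    show "(pt has_derivative (\<lambda>h. h *\<^sub>R tangent t)) (at t within {u..v})"
      using pt_has_vector_derivative[of t]
      by (auto simp: has_vector_derivative_def intro: has_derivative_at_withinI)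
    show "onorm (\<lambda>h. h *\<^sub>R tangent t) \<le> L"
      using assms(2)[OF \<open>t \<in> {u..v}\<close>]
      by (intro onorm_bound assms(3)) (auto simp: norm_tangent mult.commute[of L] intro!: mult_left_mono)
  qed (use assms in auto)
  then show ?thesis
    using hausdorff1_outer_lipschitz_image[of L u v pt] assms(1)
    by (simp add: emeasure_hausdorff1 graph_arc_borel)
qed

lemma hausdorff1_pt_null: "emeasure hausdorff1 {pt t} = 0"
  using hausdorff1_graph_arc_le[of t t "speed t"] by (simp add: less_imp_le)

lemma hausdorff1_graph_arc_finite: "emeasure hausdorff1 (pt ` {u..v}) < \<infinity>"
proof (cases "u \<le> v")
  case True
  have "compact (speed ` {u..v})" by (intro compact_continuous_image continuous_speed) simp
  then obtain L where L: "\<And>t. t \<in> {u..v} \<Longrightarrow> norm (speed t) \<le> L" "0 < L"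
    using compact_imp_bounded[of "speed ` {u..v}"] unfolding bounded_pos by (metis image_eqI)
  have "emeasure hausdorff1 (pt ` {u..v}) \<le> ennreal (L * (v - u))"
    using L by (intro hausdorff1_graph_arc_le True) (auto simp: less_imp_le)
  from le_less_trans[OF this ennreal_less_top] show ?thesis by simp
qed simp

lemma hausdorff1_graph_arc_add:
  assumes "u \<le> s" "s \<le> v"
  shows "measure hausdorff1 (pt ` {u..v}) = measure hausdorff1 (pt ` {u..s}) + measure hausdorff1 (pt ` {s..v})"
proof -
  have "pt ` {u..v} = pt ` {u..s} \<union> pt ` {s..v}" using assms by (simp add: image_Un[symmetric] ivl_disj_un_two_touch)
  moreover have "pt ` {u..s} \<inter> pt ` {s..v} = {pt s}"
    using assms by (auto simp: inj_eq[OF inj_pt])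
  moreover have "pt ` {x..y} \<in> fmeasurable hausdorff1" for x y
    using hausdorff1_graph_arc_finite graph_arc_borel by (intro fmeasurableI) auto
  moreover have "measure hausdorff1 {pt s} = 0" by (simp add: measure_def hausdorff1_pt_null)
  ultimately show ?thesis by (simp add: measure_Un3)
qed

text \<open>The length of an arc lies between its chord and the product of its parameter length with the
  maximal speed. So length as a function of the endpoint has derivative \<open>speed\<close>.\<close>

lemma hausdorff1_graph_arc:
  assumes uv: "u \<le> v"
  shows "emeasure hausdorff1 (pt ` {u..v}) = (\<integral>\<^sup>+t\<in>{u..v}. ennreal (speed t) \<partial>lborel)"
proof -
  define n where "n t = measure hausdorff1 (pt ` {u..t})" for t
  have em: "emeasure hausdorff1 (pt ` {s..t}) = ennreal (measure hausdorff1 (pt ` {s..t}))" for s t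
    using hausdorff1_graph_arc_finite[of s t] by (simp add: emeasure_eq_ennreal_measure)
  have "(n has_vector_derivative speed t) (at t within {u..v})" if t: "t \<in> {u..v}" for t
    unfolding has_vector_derivative_def has_derivative_within_alt
  proof (intro conjI allI impI)
    fix e :: real assume e: "0 < e"
    have "isCont speed t" using continuous_speed[of UNIV] by (simp add: continuous_on_eq_continuous_at)
    then obtain d1 where d1: "0 < d1" "\<And>r. \<bar>r - t\<bar> < d1 \<Longrightarrow> \<bar>speed r - speed t\<bar> < e"
      using e unfolding continuous_at_eps_delta by (auto simp: dist_real_def)
    have "(pt has_derivative (\<lambda>h. h *\<^sub>R tangent t)) (at t)"
      using pt_has_vector_derivative by (simp add: has_vector_derivative_def)
    then obtain d2 where d2: "0 < d2" "\<And>s. \<bar>s - t\<bar> < d2 \<Longrightarrow> norm (pt s - pt t - (s - t) *\<^sub>R tangent t) \<le> e * \<bar>s - t\<bar>"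
      using e unfolding has_derivative_at_alt by (auto simp: real_norm_def)
    have key: "\<bar>measure hausdorff1 (pt ` {p..q}) - (q - p) * speed t\<bar> \<le> e * (q - p)"
      if pq: "p \<le> q" "p = t \<or> q = t" "q - p < min d1 d2" for p q
    proof -
      have "emeasure hausdorff1 (pt ` {p..q}) \<le> ennreal ((speed t + e) * (q - p))"
      proof (rule hausdorff1_graph_arc_le)
        fix r assume "r \<in> {p..q}"
        then have "\<bar>r - t\<bar> < d1" using pq by auto
        then show "speed r \<le> speed t + e" using d1(2)[of r] by linarith
      qed (use pq e speed_ge_1[of t] in auto)
      then have up: "measure hausdorff1 (pt ` {p..q}) \<le> (speed t + e) * (q - p)"
        using pq e speed_ge_1[of t] by (subst (asm) em, subst (asm) ennreal_le_iff) auto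
      have "norm (pt q - pt p) \<le> measure hausdorff1 (pt ` {p..q})"
        using hausdorff1_graph_arc_ge[OF pq(1)] by (subst (asm) em, subst (asm) ennreal_le_iff) auto
      moreover have "(q - p) * speed t - e * (q - p) \<le> norm (pt q - pt p)"
      proof -
        define s where "s = (if p = t then q else p)"
        have s: "\<bar>s - t\<bar> = q - p" "norm (pt q - pt p) = norm (pt s - pt t)"
          using pq by (auto simp: s_def norm_minus_commute)
        have "norm ((s - t) *\<^sub>R tangent t) \<le> norm (pt s - pt t) + norm (pt s - pt t - (s - t) *\<^sub>R tangent t)"
          using norm_triangle_ineq4[of "pt s - pt t" "pt s - pt t - (s - t) *\<^sub>R tangent t"] by simp
        moreover have "norm (pt s - pt t - (s - t) *\<^sub>R tangent t) \<le> e * \<bar>s - t\<bar>"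
          using d2(2)[of s] s pq by auto
        ultimately show ?thesis unfolding s(2) using s(1) by (simp add: norm_tangent)
      qed
      ultimately show ?thesis using up by (auto simp: algebra_simps)
    qed
    show "\<exists>d>0. \<forall>s\<in>{u..v}. norm (s - t) < d \<longrightarrow> norm (n s - n t - (s - t) *\<^sub>R speed t) \<le> e * norm (s - t)"
    proof (intro exI conjI ballI impI)
      show "0 < min d1 d2" using d1 d2 by simp
      fix s assume s: "s \<in> {u..v}" "norm (s - t) < min d1 d2"
      show "norm (n s - n t - (s - t) *\<^sub>R speed t) \<le> e * norm (s - t)"
      proof (cases "t \<le> s")
        case True
        then have "n s - n t = measure hausdorff1 (pt ` {t..s})"
          using t s hausdorff1_graph_arc_add[of u t s] by (simp add: n_def)
        then show ?thesis using key[of t s] True s by (simp add: real_norm_def)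
      next
        case False
        then have "n t - n s = measure hausdorff1 (pt ` {s..t})"
          using t s hausdorff1_graph_arc_add[of u s t] by (simp add: n_def)
        then have "n s - n t - (s - t) *\<^sub>R speed t = - (measure hausdorff1 (pt ` {s..t}) - (t - s) * speed t)"
          by (simp add: algebra_simps)
        then show ?thesis using key[of s t] False s by (simp add: real_norm_def)
      qed
    qed
  qed (rule bounded_linear_scaleR_left)
  then have "(speed has_integral n v - n u) {u..v}"
    by (intro fundamental_theorem_of_calculus uv)
  moreover have "n u = 0" using hausdorff1_pt_null[of u] by (simp add: n_def measure_def)
  ultimately have "(speed has_integral n v) {u..v}" by simp
  then have "(\<integral>\<^sup>+t. ennreal (indicator {u..v} t * speed t) \<partial>lborel) = ennreal (n v)"
    by (intro nn_integral_has_integral_lebesgue) (auto simp: less_imp_le)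
  also have "(\<integral>\<^sup>+t. ennreal (indicator {u..v} t * speed t) \<partial>lborel) = (\<integral>\<^sup>+t. indicator {u..v} t * ennreal (speed t) \<partial>lborel)"
    by (intro nn_integral_cong) (auto split: split_indicator)
  finally show ?thesis using em[of u v] by (simp add: n_def mult.commute)
qed

definition "graph = {x. height x = 0}"

lemma borel_graph [measurable]: "graph \<in> sets borel"
  unfolding graph_def by measurable

text \<open>Both sides are carried by the graph, on which \<open>x \<bullet> e1\<close> inverts \<open>pt\<close>, and they agree on arcs.\<close>

lemma hausdorff1_graph:
  "density hausdorff1 (indicator graph) = distr (density lborel (\<lambda>t. ennreal (speed t))) borel pt"
proof -
  let ?D = "density hausdorff1 (indicator graph)"
  have ptE: "x \<in> graph \<Longrightarrow> pt (x \<bullet> e1) = x" for x using height_eq_0_iff[of x] by (simp add: graph_def)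
  have mD: "(\<lambda>x. x \<bullet> e1) \<in> measurable ?D borel" by simp
  have eq: "distr ?D borel (\<lambda>x. x \<bullet> e1) = density lborel (\<lambda>t. ennreal (speed t))" (is "?L = ?R")
  proof (rule measure_eqI_generator_eq[where E="range (\<lambda>(u, v). {u..v::real})" and \<Omega>=UNIV and A="\<lambda>i. {- real i..real i}"])
    have em: "emeasure ?L B = emeasure hausdorff1 (pt ` B)" if B: "B \<in> sets borel" for B
    proof -
      have "emeasure ?L B = emeasure ?D ((\<lambda>x. x \<bullet> e1) -` B)"
        using B by (subst emeasure_distr[OF mD]) auto
      also have "\<dots> = emeasure hausdorff1 (graph \<inter> (\<lambda>x. x \<bullet> e1) -` B)"
        using B measurable_sets_borel[OF borel_e1 B]
        by (subst emeasure_density) (auto simp: indicator_inter_arith[symmetric] simp flip: nn_integral_indicator)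
      also have "graph \<inter> (\<lambda>x. x \<bullet> e1) -` B = pt ` B"
        using ptE by (force simp: graph_def)
      finally show ?thesis .
    qed
    show "emeasure ?L X = emeasure ?R X" if X': "X \<in> range (\<lambda>(u, v). {u..v::real})" for X
    proof -
      obtain u v where X: "X = {u..v}" using X' by auto
      show ?thesis
      proof (cases "u \<le> v")
        case True
        then show ?thesis unfolding X by (simp add: em emeasure_density hausdorff1_graph_arc)
      qed (simp add: X)
    qed
    show "sets ?L = sigma_sets UNIV (range (\<lambda>(u, v). {u..v::real}))" "sets ?R = sigma_sets UNIV (range (\<lambda>(u, v). {u..v::real}))"
      by (simp_all add: borel_eq_atLeastAtMost split_beta' image_def flip: full_SetCompr_eq) 
    show "Int_stable (range (\<lambda>(u, v). {u..v::real}))"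
      by (auto simp: Int_stable_def Int_atLeastAtMost intro!: image_eqI)
    show "(\<Union>i. {- real i..real i}) = UNIV"
    proof -
      have "x \<in> (\<Union>i. {- real i..real i})" for x
        using real_arch_simple[of "\<bar>x\<bar>"] by (auto simp: abs_le_iff) (metis minus_le_iff)
      then show ?thesis by blast
    qed
    show "emeasure ?L {- real i..real i} \<noteq> \<infinity>" for i
      using hausdorff1_graph_arc_finite by (simp add: em less_top)
  qed auto
  have "distr (distr ?D borel (\<lambda>x. x \<bullet> e1)) borel pt = distr ?D borel (pt \<circ> (\<lambda>x. x \<bullet> e1))"
    by (rule distr_distr) simp_all
  also have "\<dots> = distr ?D borel (\<lambda>x. x)"
  proof (rule distr_cong_AE)
    show "AE x in ?D. (pt \<circ> (\<lambda>x. x \<bullet> e1)) x = x"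
      using ptE by (subst AE_density) (auto split: split_indicator)
  qed simp_all
  also have "\<dots> = ?D" by (intro distr_id2) simp
  finally show ?thesis by (simp add: eq)
qed

lemma nn_integral_graph:
  assumes F: "F \<in> borel_measurable borel"
  shows "(\<integral>\<^sup>+x\<in>graph. F x \<partial>hausdorff1) = (\<integral>\<^sup>+t. F (pt t) * ennreal (speed t) \<partial>lborel)"
proof -
  have "(\<integral>\<^sup>+x\<in>graph. F x \<partial>hausdorff1) = (\<integral>\<^sup>+x. F x \<partial>density hausdorff1 (indicator graph))"
    using F by (subst nn_integral_density) (auto simp: mult.commute)
  also have "\<dots> = (\<integral>\<^sup>+t. F (pt t) \<partial>density lborel (\<lambda>t. ennreal (speed t)))"
    unfolding hausdorff1_graph using F by (subst nn_integral_distr) auto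
  also have "\<dots> = (\<integral>\<^sup>+t. F (pt t) * ennreal (speed t) \<partial>lborel)"
    using F by (subst nn_integral_density) (auto simp: mult.commute)
  finally show ?thesis .
qed

lemma integral_graph:
  fixes F :: "real ^ 2 \<Rightarrow> real"
  assumes F: "F \<in> borel_measurable borel"
  shows "(LINT x:graph|hausdorff1. F x) = (LINT t|lborel. F (pt t) * speed t)"
proof -
  have "(LINT x:graph|hausdorff1. F x) = (LINT x|density hausdorff1 (\<lambda>x. ennreal (indicator graph x)). F x)"
    unfolding set_lebesgue_integral_def using F by (subst integral_density) auto
  also have "\<dots> = (LINT t|density lborel (\<lambda>t. ennreal (speed t)). F (pt t))"
    unfolding ennreal_indicator hausdorff1_graph using F by (subst integral_distr) auto
  also have "\<dots> = (LINT t|lborel. F (pt t) * speed t)"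
    using F by (subst integral_density) (auto simp: mult.commute less_imp_le)
  finally show ?thesis .
qed

end

section \<open>Localization and the boundary as a measurable object\<close>

text \<open>By uniqueness of the gradient, as translation in the angle leaves \<open>\<psi>\<close> unchanged.\<close>

lemma periodic_gradient:
  fixes \<psi> :: "'a::euclidean_space \<times> real \<Rightarrow> real"
  assumes C: "C1_gradient \<psi> D" and per: "\<And>x \<theta>. \<psi> (x, \<theta> + 2 * pi) = \<psi> (x, \<theta>)"
  shows "D (x, \<theta> + 2 * pi) = D (x, \<theta>)"
proof -
  have "((\<lambda>z. z + (0, 2 * pi)) has_derivative (\<lambda>h. h)) (at z)" for z :: "'a \<times> real"
    by (auto intro!: derivative_eq_intros)
  from has_derivative_compose[OF this C1_gradient_has_derivative[OF C]]
  have "((\<lambda>z. \<psi> (z + (0, 2 * pi))) has_derivative (\<lambda>h. h \<bullet> D (z + (0, 2 * pi)))) (at z)" for z .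
  moreover have "(\<lambda>z. \<psi> (z + (0, 2 * pi))) = \<psi>" using per by (auto simp: fun_eq_iff)
  ultimately have d: "(\<psi> has_derivative (\<lambda>h. h \<bullet> D (z + (0, 2 * pi)))) (at z)" for z by simp
  have "(\<lambda>h. h \<bullet> D (z + (0, 2 * pi))) = (\<lambda>h. h \<bullet> D z)" for z
    by (rule has_derivative_unique[OF d C1_gradient_has_derivative[OF C]])
  then have "D (z + (0, 2 * pi)) = D z" for z by (metis vector_eq_ldot)
  from this[of "(x, \<theta>)"] show ?thesis by simp
qed

lemma phase_test_fun_periodic_gradient:
  "phase_test_fun \<Omega> \<psi> D \<Longrightarrow> D (x, \<theta> + 2 * pi) = D (x, \<theta>)"
  using periodic_gradient[of \<psi> D] by (auto simp: phase_test_fun_iff)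

lemma C1_gradient_zero_outside:
  assumes "C1_gradient \<psi> D" "open S" "\<And>z. z \<in> S \<Longrightarrow> \<psi> z = 0" "z \<in> S"
  shows "D z = 0"
proof -
  have "(\<psi> has_derivative (\<lambda>h. 0)) (at z)"
    by (rule has_derivative_transform_within_open[of "\<lambda>_. 0" _ z UNIV S]) (use assms in auto)
  then have "(\<lambda>h. h \<bullet> D z) = (\<lambda>h. 0)"
    using has_derivative_unique C1_gradient_has_derivative[OF assms(1)] by blast
  then show ?thesis by (metis inner_eq_zero_iff)
qed

lemma phase_gradient_zero_outside:
  fixes \<psi> :: "'a::euclidean_space \<times> 'b::euclidean_space \<Rightarrow> real"
  assumes "C1_gradient \<psi> D" "compact K" "\<And>x \<theta>. x \<notin> K \<Longrightarrow> \<psi> (x, \<theta>) = 0" "x \<notin> K"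
  shows "D (x, \<theta>) = 0"
proof (rule C1_gradient_zero_outside[OF assms(1)])
  show "open ((- K) \<times> (UNIV :: 'b set))"
    using assms(2) by (intro open_Times) (auto simp: compact_imp_closed open_Compl)
qed (use assms in auto)

text \<open>A continuous function with the periodicity and the support of a test function is determined by its
  values on a compact set.\<close>

lemma phase_test_fun_bounded:
  assumes \<psi>: "phase_test_fun \<Omega> \<psi> D"
    and F: "continuous_on UNIV F" "\<And>x \<theta>. F (x, \<theta> + 2 * pi) = F (x, \<theta>)"
    and van: "\<And>z. \<psi> z = 0 \<Longrightarrow> D z = 0 \<Longrightarrow> F z = 0"
  obtains C where "0 \<le> C" "\<And>z. norm (F z :: 'b::real_normed_vector) \<le> C"
proof -
  obtain K where K: "compact K" "\<And>x \<theta>. x \<notin> K \<Longrightarrow> \<psi> (x, \<theta>) = 0" and C: "C1_gradient \<psi> D"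
    using \<psi> by (auto simp: phase_test_fun_iff)
  have "F (x, \<theta>) = 0" if "x \<notin> K" for x \<theta>
  proof (rule van)
    show "D (x, \<theta>) = 0"
      using phase_gradient_zero_outside[where K=K and \<psi>=\<psi>, OF C K(1) _ that] K(2) by blast
  qed (rule K(2)[OF that])
  note out = this
  have "compact (F ` (K \<times> {0..2 * pi}))"
    by (intro compact_continuous_image compact_Times K continuous_on_subset[OF F(1)]) auto
  then obtain C where C: "0 < C" "\<And>z. z \<in> K \<times> {0..2 * pi} \<Longrightarrow> norm (F z) \<le> C"
    using compact_imp_bounded[of "F ` (K \<times> {0..2 * pi})"] unfolding bounded_pos by (metis image_eqI)
  have "norm (F (x, \<theta>)) \<le> C" for x \<theta>
  proof (cases "x \<in> K")
    case True
    have "F (x, circ \<theta>) = F (x, \<theta>)" by (rule periodic_circ) (rule F(2))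
    moreover have "circ \<theta> \<in> {0..2 * pi}" using circ_range[of \<theta>] by auto
    ultimately show ?thesis using C(2)[of "(x, circ \<theta>)"] True by auto
  qed (use out C in auto)
  then show ?thesis using that[of C] C(1) by auto
qed

lemma phase_test_fun_bounded_gradient:
  assumes \<psi>: "phase_test_fun \<Omega> \<psi> D"
  obtains C where "0 \<le> C" "\<And>z. norm (D z) \<le> C"
  using phase_test_fun_bounded[OF \<psi>, of D] phase_test_fun_periodic_gradient[OF \<psi>] \<psi>
  by (auto simp: phase_test_fun_iff C1_gradient_def)

lemma phase_test_fun_mult:
  assumes "phase_test_fun \<Omega> \<psi> D" "C1_gradient h H" "\<And>x \<theta>. h (x, \<theta> + 2 * pi) = h (x, \<theta>)"
    and "\<And>x. x \<notin> V \<Longrightarrow> \<forall>\<theta>. h (x, \<theta>) = 0" "closed V"  "\<Omega> \<inter> V \<subseteq> U"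
  shows "phase_test_fun U (\<lambda>z. \<psi> z * h z) (\<lambda>z. \<psi> z *\<^sub>R H z + h z *\<^sub>R D z)"
proof -
  obtain K where K: "compact K" "K \<subseteq> \<Omega>" "\<And>x \<theta>. x \<notin> K \<Longrightarrow> \<psi> (x, \<theta>) = 0" using assms(1) by (auto simp: phase_test_fun_iff)
  have "compact (K \<inter> V)" "K \<inter> V \<subseteq> U" using K assms by (auto intro: compact_Int_closed)
  moreover have "\<psi> (x, \<theta>) * h (x, \<theta>) = 0" if "x \<notin> K \<inter> V" for x \<theta> using K(3) assms(4) that by auto
  ultimately show ?thesis using assms C1_gradient_mult[of \<psi> D h H]
    by (auto simp: phase_test_fun_iff intro!: exI[of _ "K \<inter> V"])
qed

text \<open>A property of gradients of test functions that is additive need only be checked for supports in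
  small sets. If the product of the functions \<open>1 - bump\<close> kills \<open>\<psi>\<close>, then \<open>\<psi>\<close> is a sum of a function
  supported near one centre and a function that is killed by the remaining factors.\<close>

lemma phase_localization:
  assumes local: "\<And>c. c \<in> \<Omega> \<Longrightarrow> \<exists>U. open U \<and> c \<in> U \<and> (\<forall>\<psi> D. phase_test_fun U \<psi> D \<longrightarrow> P D)"
    and add: "\<And>D1 D2. P D1 \<Longrightarrow> P D2 \<Longrightarrow> P (\<lambda>z. D1 z + D2 z)" and zero: "P (\<lambda>z. 0)"
    and \<psi>: "phase_test_fun \<Omega> \<psi> D"
  shows "P D"
proof -
  obtain K where K: "compact K" "K \<subseteq> \<Omega>" "\<And>x \<theta>. x \<notin> K \<Longrightarrow> \<psi> (x, \<theta>) = 0"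
    using \<psi> by (auto simp: phase_test_fun_iff)
  obtain U where U: "\<And>c. c \<in> \<Omega> \<Longrightarrow> open (U c)" "\<And>c. c \<in> \<Omega> \<Longrightarrow> c \<in> U c"
    "\<And>c \<psi> D. c \<in> \<Omega> \<Longrightarrow> phase_test_fun (U c) \<psi> D \<Longrightarrow> P D" using local by metis
  have "\<exists>r>0. cball c r \<subseteq> U c" if "c \<in> K" for c
    using U(1,2)[of c] that K(2) open_contains_cball by blast
  then obtain r where r: "\<And>c. c \<in> K \<Longrightarrow> 0 < r c" "\<And>c. c \<in> K \<Longrightarrow> cball c (r c) \<subseteq> U c" by metis
  obtain S where S: "finite S" "S \<subseteq> K" "\<forall>x\<in>K. (\<Prod>c\<in>S. 1 - bump c (r c) x) = 0"
    using finite_bumps_exhaust[of K r, OF K(1) r(1)] by blast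
  have "P D" if "finite S" "S \<subseteq> K" "phase_test_fun \<Omega> \<psi> D"
      "\<And>x \<theta>. \<psi> (x, \<theta>) * (\<Prod>c\<in>S. 1 - bump c (r c) x) = 0" for \<psi> D
    using that
  proof (induction S arbitrary: \<psi> D rule: finite_induct)
    case empty
    then have "\<psi> = (\<lambda>_. 0)" by auto
    then have "C1_gradient (\<lambda>_. 0) D" using empty by (simp add: phase_test_fun_iff)
    then have "D = (\<lambda>_. 0)" using C1_gradient_unique[OF _ C1_gradient_const] by blast
    then show ?case using zero by simp
  next
    case (insert c S)
    obtain B where B: "C1_gradient (bump c (r c)) B" using C1_bump by blast
    note B' = C1_gradient_fst[OF B, where 'b=real]
    have c: "c \<in> K" "c \<in> \<Omega>" using insert K by auto
    define D1 where "D1 = (\<lambda>z. \<psi> z *\<^sub>R (B (fst z), 0) + bump c (r c) (fst z) *\<^sub>R D z)"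
    have "phase_test_fun (U c) (\<lambda>z. \<psi> z * bump c (r c) (fst z)) D1"
      unfolding D1_def
      by (rule phase_test_fun_mult[OF insert.prems(2) B', where V="cball c (r c)"])
         (use r(1)[OF c(1)] r(2)[OF c(1)] in \<open>auto simp: bump_outside not_le\<close>)
    then have P1: "P D1" using U(3) c by blast
    have one: "C1_gradient (\<lambda>z :: (real ^ 2) \<times> real. 1 - bump c (r c) (fst z)) (\<lambda>z. 0 - (B (fst z), 0))"
      by (intro C1_gradient_diff C1_gradient_const B')
    have p2: "phase_test_fun \<Omega> (\<lambda>z. \<psi> z * (1 - bump c (r c) (fst z)))
        (\<lambda>z. \<psi> z *\<^sub>R (0 - (B (fst z), 0)) + (1 - bump c (r c) (fst z)) *\<^sub>R D z)"
      by (rule phase_test_fun_mult[OF insert.prems(2) one, where V=UNIV]) auto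
    have P2: "P (\<lambda>z. \<psi> z *\<^sub>R (0 - (B (fst z), 0)) + (1 - bump c (r c) (fst z)) *\<^sub>R D z)"
      by (rule insert.IH[OF _ p2]) (use insert in \<open>auto simp: mult.assoc\<close>)
    have "(\<lambda>z. D1 z + (\<psi> z *\<^sub>R (0 - (B (fst z), 0)) + (1 - bump c (r c) (fst z)) *\<^sub>R D z)) = D"
      unfolding D1_def by (rule ext) (simp add: algebra_simps flip: zero_prod_def)
    then show ?case using add[OF P1 P2] by (simp only:)
  qed
  from this[OF S(1,2) \<psi>] show ?thesis using S(3) K(3) by force
qed

lemma plane_test_field_mult:
  assumes \<phi>: "plane_test_field \<Omega> \<phi> J" and b: "C1_gradient b B"
    and V: "\<And>x. x \<notin> V \<Longrightarrow> b x = 0" "closed V" "\<Omega> \<inter> V \<subseteq> U"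
  shows "plane_test_field U (\<lambda>x. b x *\<^sub>R \<phi> x) (\<lambda>x. b x *\<^sub>R J x + (\<chi> i j. \<phi> x $ i * B x $ j))"
proof -
  obtain K where K: "compact K" "K \<subseteq> \<Omega>" "\<And>x. x \<notin> K \<Longrightarrow> \<phi> x = 0" using \<phi> by (auto simp: plane_test_field_def)
  have d: "(\<phi> has_derivative (\<lambda>v. J x *v v)) (at x)" and J: "continuous_on UNIV J" for x
    using \<phi> by (auto simp: plane_test_field_def)
  have "continuous_on UNIV \<phi>" using d by (meson continuous_at_imp_continuous_on has_derivative_continuous)
  then have "continuous_on UNIV (\<lambda>x. b x *\<^sub>R J x + (\<chi> i j. \<phi> x $ i * B x $ j))"
    using J C1_gradient_continuous[OF b] C1_gradient_continuous_gradient[OF b] by (intro continuous_intros)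
  moreover have "((\<lambda>x. b x *\<^sub>R \<phi> x) has_derivative (\<lambda>v. (b x *\<^sub>R J x + (\<chi> i j. \<phi> x $ i * B x $ j)) *v v)) (at x)" for x
  proof -
    have "((\<lambda>x. b x *\<^sub>R \<phi> x) has_derivative (\<lambda>v. b x *\<^sub>R (J x *v v) + (v \<bullet> B x) *\<^sub>R \<phi> x)) (at x)"
      by (intro has_derivative_scaleR C1_gradient_has_derivative b d)
    moreover have "b x *\<^sub>R (J x *v v) + (v \<bullet> B x) *\<^sub>R \<phi> x = (b x *\<^sub>R J x + (\<chi> i j. \<phi> x $ i * B x $ j)) *v v" for v
      by (simp add: vec2_eq_iff matrix_vector_mult_def inner_vec2 sum_2 algebra_simps)
    ultimately show ?thesis by simp
  qed
  moreover have "compact (K \<inter> V)" "K \<inter> V \<subseteq> U" using K V by (auto intro: compact_Int_closed)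
  moreover have "b x *\<^sub>R \<phi> x = 0" if "x \<notin> K \<inter> V" for x using K(3) V(1) that by auto
  ultimately show ?thesis unfolding plane_test_field_def by blast
qed

lemma plane_test_field_unique:
  assumes "plane_test_field \<Omega> \<phi> J" "plane_test_field \<Omega>' \<phi> J'" shows "J = J'"
proof
  fix x
  have "(\<lambda>v. J x *v v) = (\<lambda>v. J' x *v v)"
    using assms has_derivative_unique unfolding plane_test_field_def by metis
  then show "J x = J' x" by (metis matrix_eq)
qed

text \<open>The analogue for test fields in the plane and their Jacobian matrices.\<close>

lemma plane_localization:
  assumes local: "\<And>c. c \<in> \<Omega> \<Longrightarrow> \<exists>U. open U \<and> c \<in> U \<and> (\<forall>\<phi> J. plane_test_field U \<phi> J \<longrightarrow> P \<phi> J)"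
    and add: "\<And>\<phi>1 J1 \<phi>2 J2. P \<phi>1 J1 \<Longrightarrow> P \<phi>2 J2 \<Longrightarrow> P (\<lambda>x. \<phi>1 x + \<phi>2 x) (\<lambda>x. J1 x + J2 x)"
    and zero: "P (\<lambda>x. 0) (\<lambda>x. 0)"
    and \<phi>: "plane_test_field \<Omega> \<phi> J"
  shows "P \<phi> J"
proof -
  obtain K where K: "compact K" "K \<subseteq> \<Omega>" "\<And>x. x \<notin> K \<Longrightarrow> \<phi> x = 0"
    using \<phi> by (auto simp: plane_test_field_def)
  obtain U where U: "\<And>c. c \<in> \<Omega> \<Longrightarrow> open (U c)" "\<And>c. c \<in> \<Omega> \<Longrightarrow> c \<in> U c"
    "\<And>c \<phi> J. c \<in> \<Omega> \<Longrightarrow> plane_test_field (U c) \<phi> J \<Longrightarrow> P \<phi> J" using local by metis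
  have "\<exists>r>0. cball c r \<subseteq> U c" if "c \<in> K" for c
    using U(1,2)[of c] that K(2) open_contains_cball by blast
  then obtain r where r: "\<And>c. c \<in> K \<Longrightarrow> 0 < r c" "\<And>c. c \<in> K \<Longrightarrow> cball c (r c) \<subseteq> U c" by metis
  obtain S where S: "finite S" "S \<subseteq> K" "\<forall>x\<in>K. (\<Prod>c\<in>S. 1 - bump c (r c) x) = 0"
    using finite_bumps_exhaust[of K r, OF K(1) r(1)] by blast
  have "P \<phi> J" if "finite S" "S \<subseteq> K" "plane_test_field \<Omega> \<phi> J"
      "\<And>x. (\<Prod>c\<in>S. 1 - bump c (r c) x) *\<^sub>R \<phi> x = 0" for \<phi> J
    using that
  proof (induction S arbitrary: \<phi> J rule: finite_induct)
    case empty
    then have "\<phi> = (\<lambda>_. 0)" by auto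
    moreover from this have "J = (\<lambda>_. 0)"
      using empty by (intro plane_test_field_unique[of \<Omega> \<phi> J \<Omega>])
        (auto simp: plane_test_field_def intro!: exI[of _ "{}"] continuous_on_const)
    ultimately show ?case using zero by simp
  next
    case (insert c S)
    obtain B where B: "C1_gradient (bump c (r c)) B" using C1_bump by blast
    have c: "c \<in> K" "c \<in> \<Omega>" using insert K by auto
    have p1: "plane_test_field (U c) (\<lambda>x. bump c (r c) x *\<^sub>R \<phi> x) (\<lambda>x. bump c (r c) x *\<^sub>R J x + (\<chi> i j. \<phi> x $ i * B x $ j))"
      by (rule plane_test_field_mult[OF insert.prems(2) B, where V="cball c (r c)"])
         (use r(1)[OF c(1)] r(2)[OF c(1)] in \<open>auto simp: bump_outside not_le\<close>)
    have one: "C1_gradient (\<lambda>z. 1 - bump c (r c) z) (\<lambda>z. 0 - B z)"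
      by (intro C1_gradient_diff C1_gradient_const B)
    have p2: "plane_test_field \<Omega> (\<lambda>x. (1 - bump c (r c) x) *\<^sub>R \<phi> x)
        (\<lambda>x. (1 - bump c (r c) x) *\<^sub>R J x + (\<chi> i j. \<phi> x $ i * (0 - B x) $ j))"
      by (rule plane_test_field_mult[OF insert.prems(2) one, where V=UNIV]) auto
    have P2: "P (\<lambda>x. (1 - bump c (r c) x) *\<^sub>R \<phi> x)
        (\<lambda>x. (1 - bump c (r c) x) *\<^sub>R J x + (\<chi> i j. \<phi> x $ i * (0 - B x) $ j))"
      by (rule insert.IH[OF _ p2]) (use insert in \<open>auto simp: mult.commute\<close>)
    have "bump c (r c) x *\<^sub>R J x + (\<chi> i j. \<phi> x $ i * B x $ j)
        + ((1 - bump c (r c) x) *\<^sub>R J x + (\<chi> i j. \<phi> x $ i * (0 - B x) $ j)) = J x" for x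
      by (simp add: vec_eq_iff algebra_simps)
    moreover have "bump c (r c) x *\<^sub>R \<phi> x + (1 - bump c (r c) x) *\<^sub>R \<phi> x = \<phi> x" for x
      by (simp add: algebra_simps)
    ultimately show ?case using add[OF U(3)[OF c(2) p1] P2] by simp
  qed
  from this[OF S(1,2) \<phi>] show ?thesis using S(3) K(3) by force
qed

lemma boundary_chart_cover:
  assumes "C2_boundary_in \<Omega> E" "open \<Omega>"
  obtains \<U> where "countable \<U>" "frontier E \<inter> \<Omega> \<subseteq> \<Union>\<U>"
    "\<And>U. U \<in> \<U> \<Longrightarrow> U \<subseteq> \<Omega> \<and> (\<exists>a g g' g''. boundary_chart a g g' g'' E U)"
proof -
  define Q where "Q U \<longleftrightarrow> U \<subseteq> \<Omega> \<and> (\<exists>a g g' g''. boundary_chart a g g' g'' E U)" for U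
  have "open U" if "U \<in> Collect Q" for U using that boundary_chart.open_U unfolding Q_def by blast
  then obtain \<U> where \<U>: "\<U> \<subseteq> Collect Q" "countable \<U>" "\<Union>\<U> = \<Union>(Collect Q)" by (rule Lindelof)
  have "frontier E \<inter> \<Omega> \<subseteq> \<Union>(Collect Q)"
  proof
    fix x assume "x \<in> frontier E \<inter> \<Omega>"
    then obtain a g g' g'' U where "boundary_chart a g g' g'' E U" "x \<in> U" "U \<subseteq> \<Omega>"
      by (rule boundary_chart_exists[OF assms])
    then show "x \<in> \<Union>(Collect Q)" unfolding Q_def by blast
  qed
  then show ?thesis using that[of \<U>] \<U> unfolding Q_def[symmetric] by auto
qed

lemma borel_frontier_Int:
  assumes "open \<Omega>" shows "frontier E \<inter> \<Omega> \<in> sets borel"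
  using assms by (intro sets.Int borel_closed borel_open) auto

text \<open>Countably many charts cover the boundary, so Borel formulas in the charts suffice.\<close>

lemma borel_measurable_on_boundary:
  fixes F :: "real ^ 2 \<Rightarrow> real"
  assumes C2: "C2_boundary_in \<Omega> E" and \<Omega>: "open \<Omega>"
    and F: "\<And>a g g' g'' U. boundary_chart a g g' g'' E U \<Longrightarrow>
      \<exists>h\<in>borel_measurable borel. \<forall>x\<in>U \<inter> frontier E. F x = h x"
  shows "(\<lambda>x. if x \<in> frontier E \<inter> \<Omega> then F x else 0) \<in> borel_measurable borel" (is "?F \<in> _")
proof -
  let ?\<Gamma> = "frontier E \<inter> \<Omega>"
  have \<Gamma>: "?\<Gamma> \<in> sets borel" by (rule borel_frontier_Int[OF \<Omega>])
  obtain \<U> where \<U>: "countable \<U>" "?\<Gamma> \<subseteq> \<Union>\<U>"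
    "\<And>U. U \<in> \<U> \<Longrightarrow> U \<subseteq> \<Omega> \<and> (\<exists>a g g' g''. boundary_chart a g g' g'' E U)"
    using boundary_chart_cover[OF C2 \<Omega>] by blast
  show ?thesis
  proof (rule measurable_piecewise_restrict[where C="insert (- ?\<Gamma>) ((\<lambda>U. U \<inter> ?\<Gamma>) ` \<U>)"])
    fix A assume A: "A \<in> insert (- ?\<Gamma>) ((\<lambda>U. U \<inter> ?\<Gamma>) ` \<U>)"
    then consider "A = - ?\<Gamma>" | U where "U \<in> \<U>" "A = U \<inter> ?\<Gamma>" by blast
    then show "A \<inter> space borel \<in> sets borel"
    proof cases
      case 2
      then have "open U" using \<U>(3) boundary_chart.open_U by blast
      then show ?thesis using 2 \<Gamma> by auto
    qed (use \<Gamma> in \<open>simp only: space_borel Int_UNIV_right borel_comp\<close>)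
    show "?F \<in> borel_measurable (restrict_space borel A)"
    proof (cases "A = - ?\<Gamma>")
      case True
      have "?F \<in> borel_measurable (restrict_space borel A) \<longleftrightarrow> (\<lambda>x. 0::real) \<in> borel_measurable (restrict_space borel A)"
        by (rule measurable_cong) (use True in \<open>auto simp: space_restrict_space\<close>)
      then show ?thesis by simp
    next
      case False
      then obtain U where U: "U \<in> \<U>" "A = U \<inter> ?\<Gamma>" using A by blast
      then obtain h where h: "h \<in> borel_measurable borel" "\<forall>x\<in>U \<inter> frontier E. F x = h x"
        using \<U>(3) F by metis
      have "?F \<in> borel_measurable (restrict_space borel A) \<longleftrightarrow> h \<in> borel_measurable (restrict_space borel A)"
        by (rule measurable_cong) (use U h(2) in \<open>auto simp: space_restrict_space\<close>)
      then show ?thesis using h(1) by (simp add: measurable_restrict_space1)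
    qed
  qed (use \<U> in auto)
qed

definition boundary_curvature :: "(real ^ 2) set \<Rightarrow> (real ^ 2) set \<Rightarrow> real ^ 2 \<Rightarrow> real" where
  "boundary_curvature \<Omega> E x = (if x \<in> frontier E \<inter> \<Omega> then curvature E x else 0)"

definition boundary_angle :: "(real ^ 2) set \<Rightarrow> (real ^ 2) set \<Rightarrow> real ^ 2 \<Rightarrow> real" where
  "boundary_angle \<Omega> E x = (if x \<in> frontier E \<inter> \<Omega> then tangent_angle E x else 0)"

lemma (in boundary_chart) boundary_point:
  assumes "x \<in> U" "x \<in> frontier E"
  shows "pt (x \<bullet> e1) = x" "curvature E x = kappa (x \<bullet> e1)" "tangent_angle E x = circ (angle (x \<bullet> e1))"
proof -
  show 1: "pt (x \<bullet> e1) = x" using assms frontier_iff height_eq_0_iff by metis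
  show "curvature E x = kappa (x \<bullet> e1)" "tangent_angle E x = circ (angle (x \<bullet> e1))"
    using curvature_eq[of "x \<bullet> e1"] tangent_angle_eq[of "x \<bullet> e1"] assms 1 by simp_all
qed

lemma (in boundary_chart) pt_boundary:
  assumes "pt t \<in> U" "U \<subseteq> \<Omega>"
  shows "pt t \<in> frontier E \<inter> \<Omega>" "boundary_curvature \<Omega> E (pt t) = kappa t" "boundary_angle \<Omega> E (pt t) = circ (angle t)"
  using assms frontier_iff[OF assms(1)] curvature_eq[OF assms(1)] tangent_angle_eq[OF assms(1)]
  by (auto simp: boundary_curvature_def boundary_angle_def)

lemma borel_boundary_curvature:
  assumes "C2_boundary_in \<Omega> E" "open \<Omega>"
  shows "boundary_curvature \<Omega> E \<in> borel_measurable borel"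
  unfolding boundary_curvature_def[abs_def]
proof (rule borel_measurable_on_boundary[OF assms])
  fix a g g' g'' U assume "boundary_chart a g g' g'' E U"
  then interpret boundary_chart a g g' g'' E U .
  show "\<exists>h\<in>borel_measurable borel. \<forall>x\<in>U \<inter> frontier E. curvature E x = h x"
    using boundary_point by (intro bexI[of _ "\<lambda>x. kappa (x \<bullet> e1)"]) auto
qed

lemma borel_boundary_angle:
  assumes "C2_boundary_in \<Omega> E" "open \<Omega>"
  shows "boundary_angle \<Omega> E \<in> borel_measurable borel"
  unfolding boundary_angle_def[abs_def]
proof (rule borel_measurable_on_boundary[OF assms])
  fix a g g' g'' U assume "boundary_chart a g g' g'' E U"
  then interpret boundary_chart a g g' g'' E U .
  show "\<exists>h\<in>borel_measurable borel. \<forall>x\<in>U \<inter> frontier E. tangent_angle E x = h x"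
    using boundary_point by (intro bexI[of _ "\<lambda>x. circ (angle (x \<bullet> e1))"]) auto
qed

lemma boundary_angle_range:
  assumes "C2_boundary_in \<Omega> E" "open \<Omega>"
  shows "boundary_angle \<Omega> E x \<in> {0..<2 * pi}"
proof (cases "x \<in> frontier E \<inter> \<Omega>")
  case True
  then obtain a g g' g'' U where "boundary_chart a g g' g'' E U" "x \<in> U" "U \<subseteq> \<Omega>"
    using boundary_chart_exists[OF assms] by metis
  then interpret boundary_chart a g g' g'' E U by simp
  show ?thesis using boundary_point(3) \<open>x \<in> U\<close> True circ_range by (auto simp: boundary_angle_def)
qed (auto simp: boundary_angle_def)

section \<open>The lifted boundary: upper bound\<close>

lemma continuous_perp: "continuous_on S perp"
proof -
  have "perp = (\<lambda>x. x $ 2 *\<^sub>R angle_vec 0 - x $ 1 *\<^sub>R angle_vec (pi / 2))"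
    by (simp add: fun_eq_iff vec2_eq_iff perp_def)
  moreover have "continuous_on S (\<lambda>x :: real ^ 2. x $ 2 *\<^sub>R angle_vec 0 - x $ 1 *\<^sub>R angle_vec (pi / 2))"
    by (intro continuous_intros)
  ultimately show ?thesis by (simp only:)
qed

lemma (in boundary_chart) integral_boundary_chart:
  fixes F :: "real ^ 2 \<Rightarrow> real"
  assumes U: "U \<subseteq> \<Omega>" and F: "F \<in> borel_measurable borel" "\<And>x. x \<notin> U \<Longrightarrow> F x = 0"
  shows "(LINT x:frontier E \<inter> \<Omega>|hausdorff1. F x) = (LINT t|lborel. F (pt t) * speed t)"
proof -
  have "(LINT x:frontier E \<inter> \<Omega>|hausdorff1. F x) = (LINT x:graph|hausdorff1. F x)"
    unfolding set_lebesgue_integral_def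
  proof (intro Bochner_Integration.integral_cong refl)
    fix x
    show "indicator (frontier E \<inter> \<Omega>) x *\<^sub>R F x = indicator graph x *\<^sub>R F x"
      using frontier_iff[of x] F(2)[of x] U by (cases "x \<in> U") (auto simp: graph_def indicator_def)
  qed
  then show ?thesis by (simp add: integral_graph F)
qed

text \<open>Inside the chart, \<open>E\<close> is the region above the graph up to a subset of the graph. The graph is a null
  set, hence completeness of Lebesgue measure makes the restriction of \<open>E\<close> measurable.\<close>

lemma (in boundary_chart) divergence_chart:
  assumes U: "U \<subseteq> \<Omega>" and \<phi>: "plane_test_field U \<phi> J"
  shows "integrable lebesgue (\<lambda>x. indicator \<Omega> x *\<^sub>R (indicator E x * trace (J x)))"
    and "(LINT x:\<Omega>|lebesgue. indicator E x * trace (J x)) = - (LINT t|lborel. perp (\<phi> (pt t)) \<bullet> tangent t)"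
proof -
  obtain K where K: "compact K" "K \<subseteq> U" "\<And>x. x \<notin> K \<Longrightarrow> \<phi> x = 0" using \<phi> by (auto simp: plane_test_field_def)
  have d: "(\<phi> has_derivative (\<lambda>v. J x *v v)) (at x)" and J: "continuous_on UNIV J" for x
    using \<phi> by (auto simp: plane_test_field_def)
  have J0: "trace (J x) = 0" if "x \<notin> K" for x
    using jacobian_zero_outside[OF d K(1,3) that] by (simp add: trace_def)
  note div = divergence_above_graph[OF d J K(1,3)]
  let ?f = "\<lambda>x. indicator {x. 0 < height x} x * trace (J x)"
  let ?g = "\<lambda>x. indicator \<Omega> x *\<^sub>R (indicator E x * trace (J x)) :: real"
  have fm: "?f \<in> borel_measurable lborel" using div(1) by (rule borel_measurable_integrable)
  have "AE x in lborel. x \<notin> {x. height x = 0}" using graph_null by (rule AE_not_in)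
  then have "AE x in lborel. ?f x = ?g x"
  proof eventually_elim
    case (elim x)
    show ?case
    proof (cases "x \<in> K")
      case True
      then have "x \<in> U" using K by auto
      then show ?thesis using elim above[of x] below[of x] U by (cases "0 < height x") (auto simp: indicator_def)
    qed (simp add: J0)
  qed
  then have ae: "AE x in lebesgue. ?f x = ?g x" by (rule AE_completion)
  have fm': "?f \<in> borel_measurable lebesgue" using fm by (rule measurable_completion)
  have gm: "?g \<in> borel_measurable lebesgue" by (rule borel_measurable_AE[OF fm' ae])
  have "integrable lebesgue ?f" using div(1) fm by (simp add: integrable_completion)
  then show "integrable lebesgue ?g" using integrable_cong_AE_imp[OF _ gm ae] by blast
  have "integral\<^sup>L lebesgue ?g = integral\<^sup>L lebesgue ?f" using ae by (intro integral_cong_AE gm fm') auto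
  also have "\<dots> = integral\<^sup>L lborel ?f" by (rule integral_completion[OF fm])
  also have "\<dots> = - (LINT t|lborel. perp (\<phi> (pt t)) \<bullet> tangent t)" by (rule div(2))
  finally show "(LINT x:\<Omega>|lebesgue. indicator E x * trace (J x)) = - (LINT t|lborel. perp (\<phi> (pt t)) \<bullet> tangent t)"
    unfolding set_lebesgue_integral_def .
qed

locale C2_set =
  fixes \<Omega> E :: "(real ^ 2) set"
  assumes open_Omega: "open \<Omega>" and C2: "C2_boundary_in \<Omega> E"
begin

abbreviation "\<Gamma> \<equiv> frontier E \<inter> \<Omega>"
abbreviation "kap \<equiv> boundary_curvature \<Omega> E"
abbreviation "th \<equiv> boundary_angle \<Omega> E"

lemma borel_Gamma [measurable]: "\<Gamma> \<in> sets borel"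
  by (rule borel_frontier_Int[OF open_Omega])

lemma borel_kap [measurable]: "kap \<in> borel_measurable borel"
  by (rule borel_boundary_curvature[OF C2 open_Omega])

lemma borel_th [measurable]: "th \<in> borel_measurable borel"
  by (rule borel_boundary_angle[OF C2 open_Omega])

lemma borel_angle_vec [measurable]: "angle_vec \<in> borel_measurable borel"
  by (intro borel_measurable_continuous_onI continuous_angle_vec)

text \<open>The competitor for the upper bound is length measure on the boundary, lifted to phase space by the
  tangent angle and multiplied by \<open>field\<close>, the velocity of the lifted curve at unit speed.\<close>

definition "lift x = (x, th x)"
definition "curve_measure = distr (restrict_space hausdorff1 \<Gamma>) (phase_space \<Omega>) lift"
definition "field z = (angle_vec (snd z), kap (fst z))"

lemma borel_fst: "(fst :: (real ^ 2) \<times> real \<Rightarrow> real ^ 2) \<in> borel_measurable borel"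
  and borel_snd: "(snd :: (real ^ 2) \<times> real \<Rightarrow> real) \<in> borel_measurable borel"
  by (intro borel_measurable_continuous_onI continuous_intros)+

lemma borel_kap_fst: "(\<lambda>z :: (real ^ 2) \<times> real. kap (fst z)) \<in> borel_measurable borel"
  by (rule measurable_compose[OF borel_fst borel_kap])

lemma borel_field: "field \<in> borel_measurable borel"
  unfolding field_def[abs_def]
  by (intro borel_measurable_Pair borel_kap_fst measurable_compose[OF borel_snd borel_angle_vec])

lemma lift_measurable: "lift \<in> measurable (restrict_space hausdorff1 \<Gamma>) (phase_space \<Omega>)"
  unfolding phase_space_def
proof (rule measurable_restrict_space2)
  show "lift \<in> space (restrict_space hausdorff1 \<Gamma>) \<rightarrow> \<Omega> \<times> {0..<2 * pi}"
    using boundary_angle_range[OF C2 open_Omega] by (auto simp: lift_def space_restrict_space)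
  have "lift \<in> borel_measurable borel" unfolding lift_def[abs_def] by measurable
  then show "lift \<in> borel_measurable (restrict_space hausdorff1 \<Gamma>)"
    by (intro measurable_restrict_space1) simp
qed

lemma sets_curve_measure [simp]: "sets curve_measure = sets (phase_space \<Omega>)"
  by (simp add: curve_measure_def)

lemma phase_space_measurable: "F \<in> borel_measurable borel \<Longrightarrow> F \<in> borel_measurable (phase_space \<Omega>)"
  unfolding phase_space_def by (rule measurable_restrict_space1)

lemma nn_integral_curve_measure:
  assumes "F \<in> borel_measurable (phase_space \<Omega>)"
  shows "(\<integral>\<^sup>+z. F z \<partial>curve_measure) = (\<integral>\<^sup>+x\<in>\<Gamma>. F (lift x) \<partial>hausdorff1)"
  unfolding curve_measure_def using assms lift_measurable
  by (simp add: nn_integral_distr nn_integral_restrict_space)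

lemma integral_curve_measure:
  fixes F :: "_ \<Rightarrow> real"
  assumes "F \<in> borel_measurable (phase_space \<Omega>)"
  shows "(LINT z|curve_measure. F z) = (LINT x:\<Gamma>|hausdorff1. F (lift x))"
  unfolding curve_measure_def set_lebesgue_integral_def using assms lift_measurable
  by (simp add: integral_distr integral_restrict_space)

text \<open>Away from the boundary, \<open>E\<close> or its complement fills a neighbourhood.\<close>

lemma chart_or_ball:
  assumes "c \<in> \<Omega>"
  obtains (chart) a g g' g'' U where "boundary_chart a g g' g'' E U" "c \<in> U" "U \<subseteq> \<Omega>"
  | (inside) U where "open U" "c \<in> U" "U \<subseteq> \<Omega>" "U \<subseteq> E" "U \<inter> frontier E = {}"
  | (outside) U where "open U" "c \<in> U" "U \<subseteq> \<Omega>" "U \<inter> E = {}" "U \<inter> frontier E = {}"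
proof (cases "c \<in> frontier E")
  case True
  then show ?thesis using boundary_chart_exists[OF C2 open_Omega, of c] assms chart by blast
next
  case False
  then consider "c \<in> interior E" | "c \<in> interior (- E)" by (auto simp: frontier_def interior_complement)
  then show ?thesis
  proof cases
    case 1
    then show ?thesis using inside[of "interior E \<inter> \<Omega>"] assms open_Omega interior_subset
      by (auto simp: frontier_def open_Int)
  next
    case 2
    then show ?thesis using outside[of "interior (- E) \<inter> \<Omega>"] assms open_Omega interior_subset[of "- E"]
      by (auto simp: frontier_def interior_complement open_Int)
  qed
qed

text \<open>In a chart, the integral of a gradient along the lifted boundary is the integral over the line
  of a total derivative.\<close>

lemma lifted_boundary_closed:
  assumes iG: "integrable curve_measure field" and \<psi>: "phase_test_fun \<Omega> \<psi> D"
  shows "(LINT z|curve_measure. D z \<bullet> field z) = 0"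
proof -
  define P where "P D \<longleftrightarrow> D \<in> borel_measurable borel \<and> (\<exists>C. \<forall>z. norm (D z :: (real ^ 2) \<times> real) \<le> C) \<and>
      (LINT z|curve_measure. D z \<bullet> field z) = 0" for D
  have int: "integrable curve_measure (\<lambda>z. D z \<bullet> field z)" if PD: "P D" for D
  proof -
    obtain C where C: "\<And>z. norm (D z) \<le> C" and m: "D \<in> borel_measurable borel" using PD unfolding P_def by blast
    have mD: "D \<in> borel_measurable curve_measure" "field \<in> borel_measurable curve_measure"
      using phase_space_measurable[OF m] borel_measurable_integrable[OF iG]
      by (simp_all cong: measurable_cong_sets)
    show ?thesis
    proof (rule Bochner_Integration.integrable_bound[of _ "\<lambda>z. C * norm (field z)"])
      show "integrable curve_measure (\<lambda>z. C * norm (field z))" using iG by simp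
      show "AE z in curve_measure. norm (D z \<bullet> field z) \<le> norm (C * norm (field z))"
      proof (rule AE_I2)
        fix z
        have "norm (D z \<bullet> field z) \<le> norm (D z) * norm (field z)" by (simp add: Cauchy_Schwarz_ineq2)
        also have "\<dots> \<le> C * norm (field z)" using C by (intro mult_right_mono) auto
        finally show "norm (D z \<bullet> field z) \<le> norm (C * norm (field z))" by simp
      qed
    qed (use mD in measurable)
  qed
  have "P D"
  proof (rule phase_localization[OF _ _ _ \<psi>])
    fix D1 D2 assume P: "P D1" "P D2"
    then obtain C1 C2 where "\<And>z. norm (D1 z) \<le> C1" "\<And>z. norm (D2 z) \<le> C2" by (auto simp: P_def)
    then have "norm (D1 z + D2 z) \<le> C1 + C2" for z by (meson add_mono norm_triangle_le)
    then show "P (\<lambda>z. D1 z + D2 z)"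
      using P int[OF P(1)] int[OF P(2)] by (auto simp: P_def inner_add_left)
  next
    show "P (\<lambda>z. 0)" by (auto simp: P_def)
  next
    fix c assume c: "c \<in> \<Omega>"
    have meas: "D \<in> borel_measurable borel \<and> (\<exists>C. \<forall>z. norm (D z) \<le> C)"
      "(LINT z|curve_measure. D z \<bullet> field z) = (LINT x:\<Gamma>|hausdorff1. D (lift x) \<bullet> field (lift x))"
      "x \<notin> U \<Longrightarrow> D (x, \<theta>) = 0"
      if "phase_test_fun U \<psi> D" for U \<psi> D x \<theta>
    proof -
      have m: "D \<in> borel_measurable borel" using that
        by (auto simp: phase_test_fun_iff intro: borel_measurable_continuous_onI C1_gradient_continuous_gradient)
      then show "D \<in> borel_measurable borel \<and> (\<exists>C. \<forall>z. norm (D z) \<le> C)"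
        using phase_test_fun_bounded_gradient[OF that] by metis
      show "(LINT z|curve_measure. D z \<bullet> field z) = (LINT x:\<Gamma>|hausdorff1. D (lift x) \<bullet> field (lift x))"
        using m borel_field by (intro integral_curve_measure phase_space_measurable borel_measurable_inner)
      show "D (x, \<theta>) = 0" if x: "x \<notin> U"
      proof -
        obtain K where K: "compact K" "K \<subseteq> U" "\<And>x \<theta>. x \<notin> K \<Longrightarrow> \<psi> (x, \<theta>) = 0"
          using \<open>phase_test_fun U \<psi> D\<close> by (auto simp: phase_test_fun_iff)
        show ?thesis
          by (rule phase_gradient_zero_outside[where K=K and \<psi>=\<psi>])
             (use K x \<open>phase_test_fun U \<psi> D\<close> in \<open>auto simp: phase_test_fun_iff\<close>)
      qed
    qed
    have away: "P D" if "phase_test_fun U \<psi> D" "U \<inter> frontier E = {}" for U \<psi> D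
    proof -
      have "D (lift x) = 0" if "x \<in> \<Gamma>" for x using meas(3)[OF \<open>phase_test_fun U \<psi> D\<close>] that \<open>U \<inter> frontier E = {}\<close>
        by (auto simp: lift_def)
      then have "(LINT x:\<Gamma>|hausdorff1. D (lift x) \<bullet> field (lift x)) = (LINT x:\<Gamma>|hausdorff1. 0)"
        unfolding set_lebesgue_integral_def
        by (intro Bochner_Integration.integral_cong refl) (auto split: split_indicator)
      then show ?thesis using meas(1,2)[OF that(1)] by (simp add: P_def set_lebesgue_integral_def)
    qed
    show "\<exists>U. open U \<and> c \<in> U \<and> (\<forall>\<psi> D. phase_test_fun U \<psi> D \<longrightarrow> P D)"
    proof (cases rule: chart_or_ball[OF c])
      case (1 a g g' g'' U)
      interpret boundary_chart a g g' g'' E U by fact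
      have "P D" if t: "phase_test_fun U \<psi> D" for \<psi> D
      proof -
        obtain K where K: "compact K" "K \<subseteq> U" "\<And>x \<theta>. x \<notin> K \<Longrightarrow> \<psi> (x, \<theta>) = 0" and C: "C1_gradient \<psi> D"
          using t by (auto simp: phase_test_fun_iff)
        have [measurable]: "D \<in> borel_measurable borel" using meas(1)[OF t] by simp
        have Kz: "D (x, \<theta>) = 0" if "x \<notin> K" for x \<theta>
          using phase_gradient_zero_outside[where K=K and \<psi>=\<psi>, OF C K(1) _ that] K(3) by blast
        have "(LINT x:\<Gamma>|hausdorff1. D (lift x) \<bullet> field (lift x)) = (LINT t|lborel. D (lift (pt t)) \<bullet> field (lift (pt t)) * speed t)"
        proof (rule integral_boundary_chart[OF 1(3)])
          show "(\<lambda>x. D (lift x) \<bullet> field (lift x)) \<in> borel_measurable borel"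
            unfolding field_def lift_def fst_conv snd_conv by measurable
          show "D (lift x) \<bullet> field (lift x) = 0" if "x \<notin> U" for x
            using meas(3)[OF t that] by (simp add: lift_def)
        qed
        also have "\<dots> = (LINT t|lborel. D (pt t, angle t) \<bullet> (tangent t, angle' t))"
        proof (intro Bochner_Integration.integral_cong refl)
          fix s
          show "D (lift (pt s)) \<bullet> field (lift (pt s)) * speed s = D (pt s, angle s) \<bullet> (tangent s, angle' s)"
          proof (cases "pt s \<in> U")
            case True
            have "D (pt s, circ (angle s)) = D (pt s, angle s)"
              by (rule periodic_circ[where p="\<lambda>\<theta>. D (pt s, \<theta>)"]) (rule phase_test_fun_periodic_gradient[OF t])
            then have "D (lift (pt s)) = D (pt s, angle s)" "field (lift (pt s)) = (angle_vec (angle s), kappa s)"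
              using pt_boundary(2,3)[OF True 1(3)] by (simp_all add: lift_def field_def)
            moreover have "(tangent s, angle' s) = speed s *\<^sub>R (angle_vec (angle s), kappa s)"
              by (simp add: tangent_eq kappa_def)
            ultimately show ?thesis by (simp only: inner_scaleR_right mult.commute)
          next
            case False
            then show ?thesis using meas(3)[OF t False] by (simp add: lift_def)
          qed
        qed
        also have "\<dots> = 0"
        proof -
          have "bounded ((\<lambda>x. x \<bullet> e1) ` K)"
            using K(1) by (intro compact_imp_bounded compact_continuous_image continuous_intros)
          then obtain N where N: "0 < N" "\<And>x. x \<in> K \<Longrightarrow> \<bar>x \<bullet> e1\<bar> \<le> N"
            unfolding bounded_pos by (metis image_eqI real_norm_def)
          have out: "pt t \<notin> K" if "N + 1 \<le> \<bar>t\<bar>" for t using N(2)[of "pt t"] that by auto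
          have vd: "((\<lambda>t. (pt t, angle t)) has_vector_derivative (tangent t, angle' t)) (at t)" for t
            using angle_has_derivative pt_has_vector_derivative
            by (intro has_vector_derivative_Pair) (auto simp: has_real_derivative_iff_has_vector_derivative)
          have "((\<lambda>t. \<psi> (pt t, angle t)) has_real_derivative D (pt t, angle t) \<bullet> (tangent t, angle' t)) (at t)" for t
            using C1_gradient_chain[OF C vd] by (simp add: inner_commute)
          moreover have "continuous_on UNIV (\<lambda>t. D (pt t, angle t) \<bullet> (tangent t, angle' t))"
            by (intro continuous_intros continuous_on_compose2[OF C1_gradient_continuous_gradient[OF C]]
                continuous_pt continuous_angle continuous_tangent continuous_angle') auto
          ultimately show ?thesis
            using out K(3) Kz N(1) by (intro FTC_compact_support(1)[where N="N + 1" and h="\<lambda>t. \<psi> (pt t, angle t)"]) auto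
        qed
        finally show ?thesis using meas(1,2)[OF t] by (simp add: P_def)
      qed
      then show ?thesis using 1(2) open_U by (intro exI[of _ U]) simp
    next
      case (2 U)
      then show ?thesis using away[of U] by (intro exI[of _ U]) simp
    next
      case (3 U)
      then show ?thesis using away[of U] by (intro exI[of _ U]) simp
    qed
  qed
  then show ?thesis by (simp add: P_def)
qed

text \<open>Localized to a chart, both sides are the flux of \<open>\<phi>\<close> through the graph. In an open subset of \<open>E\<close> both
  vanish because the divergence of a compactly supported field has integral zero.\<close>

lemma lifted_boundary_marginal:
  assumes fin: "finite_measure curve_measure" and \<phi>: "plane_test_field \<Omega> \<phi> J"
  shows "(LINT x:\<Gamma>|hausdorff1. perp (\<phi> x) \<bullet> angle_vec (th x)) = - (LINT x:\<Omega>|lebesgue. indicator E x * trace (J x))"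
proof -
  have [measurable]: "perp \<in> borel_measurable borel"
    by (intro borel_measurable_continuous_onI continuous_perp)
  have norm_perp: "norm (perp x) = norm x" for x
    by (simp add: norm_eq_sqrt_inner inner_vec2 perp_def add.commute)
  have H: "emeasure hausdorff1 \<Gamma> < \<infinity>"
  proof -
    have "emeasure hausdorff1 \<Gamma> = (\<integral>\<^sup>+z. 1 \<partial>curve_measure)"
      by (subst nn_integral_curve_measure) auto
    then show ?thesis using finite_measure.emeasure_finite[OF fin] by (simp add: less_top)
  qed
  define P where "P \<phi> J \<longleftrightarrow> \<phi> \<in> borel_measurable borel \<and> (\<exists>C. \<forall>x. norm (\<phi> x) \<le> C) \<and>
    integrable lebesgue (\<lambda>x. indicator \<Omega> x *\<^sub>R (indicator E x * trace (J x)) :: real) \<and>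
    (LINT x:\<Gamma>|hausdorff1. perp (\<phi> x) \<bullet> angle_vec (th x)) = - (LINT x:\<Omega>|lebesgue. indicator E x * trace (J x))"
    for \<phi> :: "real ^ 2 \<Rightarrow> real ^ 2" and J :: "real ^ 2 \<Rightarrow> real ^ 2 ^ 2"
  have int: "integrable hausdorff1 (\<lambda>x. indicator \<Gamma> x *\<^sub>R (perp (\<phi> x) \<bullet> angle_vec (th x)))" if P\<phi>: "P \<phi> J" for \<phi> J
  proof -
    obtain C where C: "\<And>x. norm (\<phi> x) \<le> C" and [measurable]: "\<phi> \<in> borel_measurable borel" using P\<phi> unfolding P_def by blast
    show ?thesis
    proof (rule Bochner_Integration.integrable_bound[of _ "\<lambda>x. C * indicator \<Gamma> x"])
      show "integrable hausdorff1 (\<lambda>x. C * indicator \<Gamma> x)"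
        using H by (intro integrable_mult_right) (simp add: integrable_indicator_iff)
      show "AE x in hausdorff1. norm (indicator \<Gamma> x *\<^sub>R (perp (\<phi> x) \<bullet> angle_vec (th x))) \<le> norm (C * indicator \<Gamma> x)"
      proof (rule AE_I2)
        fix x
        have "\<bar>perp (\<phi> x) \<bullet> angle_vec (th x)\<bar> \<le> C"
          using Cauchy_Schwarz_ineq2[of "perp (\<phi> x)" "angle_vec (th x)"] C[of x] by (simp add: norm_perp)
        then show "norm (indicator \<Gamma> x *\<^sub>R (perp (\<phi> x) \<bullet> angle_vec (th x))) \<le> norm (C * indicator \<Gamma> x)"
          by (auto split: split_indicator)
      qed
    qed measurable
  qed
  have "P \<phi> J"
  proof (rule plane_localization[OF _ _ _ \<phi>])
    fix \<phi>1 J1 \<phi>2 J2 assume P: "P \<phi>1 J1" "P \<phi>2 J2"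
    then obtain C1 C2 where "\<And>x. norm (\<phi>1 x) \<le> C1" "\<And>x. norm (\<phi>2 x) \<le> C2" by (auto simp: P_def)
    then have "norm (\<phi>1 x + \<phi>2 x) \<le> C1 + C2" for x by (meson add_mono norm_triangle_le)
    moreover have "perp (x + y) = perp x + perp y" for x y by (simp add: vec2_eq_iff perp_def)
    moreover have "trace (A + B) = trace A + trace B" for A B :: "real ^ 2 ^ 2" by (simp add: trace_def sum.distrib)
    ultimately show "P (\<lambda>x. \<phi>1 x + \<phi>2 x) (\<lambda>x. J1 x + J2 x)"
      using P int[OF P(1)] int[OF P(2)]
      by (auto simp: P_def inner_add_left set_lebesgue_integral_def distrib_left)
  next
    have "perp 0 = 0" by (simp add: vec2_eq_iff perp_def)
    then show "P (\<lambda>x. 0) (\<lambda>x. 0)" by (auto simp: P_def trace_def set_lebesgue_integral_def)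
  next
    fix c assume c: "c \<in> \<Omega>"
    have basic: "\<phi> \<in> borel_measurable borel \<and> (\<exists>C. \<forall>x. norm (\<phi> x) \<le> C)" if t: "plane_test_field U \<phi> J" for U \<phi> J
    proof -
      obtain K where K: "compact K" "\<And>x. x \<notin> K \<Longrightarrow> \<phi> x = 0" using t by (auto simp: plane_test_field_def)
      have cont: "continuous_on UNIV \<phi>" using t unfolding plane_test_field_def
        by (meson continuous_at_imp_continuous_on has_derivative_continuous)
      have "compact (\<phi> ` K)" using K(1) cont by (intro compact_continuous_image) (auto intro: continuous_on_subset)
      then obtain C where "0 < C" "\<And>x. x \<in> K \<Longrightarrow> norm (\<phi> x) \<le> C"
        using compact_imp_bounded[of "\<phi> ` K"] unfolding bounded_pos by (metis image_eqI)
      then have "norm (\<phi> x) \<le> C" for x using K(2)[of x] by (cases "x \<in> K") auto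
      then show ?thesis using borel_measurable_continuous_onI[OF cont] by blast
    qed
    have zero: "(LINT x:\<Gamma>|hausdorff1. perp (\<phi> x) \<bullet> angle_vec (th x)) = 0" 
      if t: "plane_test_field U \<phi> J" "U \<inter> frontier E = {}" for U \<phi> J
    proof -
      have "perp (\<phi> x) = 0" if "x \<in> \<Gamma>" for x
        using t that unfolding plane_test_field_def perp_def by (auto simp: vec2_eq_iff)
      then have "(LINT x:\<Gamma>|hausdorff1. perp (\<phi> x) \<bullet> angle_vec (th x)) = (LINT x:\<Gamma>|hausdorff1. 0)"
        unfolding set_lebesgue_integral_def
        by (intro Bochner_Integration.integral_cong refl) (auto split: split_indicator)
      then show ?thesis by (simp add: set_lebesgue_integral_def)
    qed
    show "\<exists>U. open U \<and> c \<in> U \<and> (\<forall>\<phi> J. plane_test_field U \<phi> J \<longrightarrow> P \<phi> J)"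
    proof (cases rule: chart_or_ball[OF c])
      case (1 a g g' g'' U)
      interpret boundary_chart a g g' g'' E U by fact
      have "P \<phi> J" if t: "plane_test_field U \<phi> J" for \<phi> J
      proof -
        have [measurable]: "\<phi> \<in> borel_measurable borel" using basic[OF t] by simp
        have out: "perp (\<phi> x) = 0" if "x \<notin> U" for x
          using t that unfolding plane_test_field_def perp_def by (auto simp: vec2_eq_iff)
        have "(LINT x:\<Gamma>|hausdorff1. perp (\<phi> x) \<bullet> angle_vec (th x)) = (LINT t|lborel. perp (\<phi> (pt t)) \<bullet> angle_vec (th (pt t)) * speed t)"
          using out by (intro integral_boundary_chart[OF 1(3)]) auto
        also have "\<dots> = (LINT t|lborel. perp (\<phi> (pt t)) \<bullet> tangent t)"
        proof (intro Bochner_Integration.integral_cong refl)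
          fix s show "perp (\<phi> (pt s)) \<bullet> angle_vec (th (pt s)) * speed s = perp (\<phi> (pt s)) \<bullet> tangent s"
            using out[of "pt s"] pt_boundary(3)[OF _ 1(3), of s]
            by (cases "pt s \<in> U") (auto simp: tangent_eq)
        qed
        finally show ?thesis using divergence_chart[OF 1(3) t] basic[OF t] by (simp add: P_def)
      qed
      then show ?thesis using 1(2) open_U by (intro exI[of _ U]) simp
    next
      case (2 U)
      have "P \<phi> J" if t: "plane_test_field U \<phi> J" for \<phi> J
      proof -
        \<comment> \<open>A flat graph only provides coordinates in the whole plane.\<close>
        interpret flat: C2_graph 0 "\<lambda>_. 0" "\<lambda>_. 0" "\<lambda>_. 0"
          by unfold_locales auto
        obtain K where K: "compact K" "K \<subseteq> U" "\<And>x. x \<notin> K \<Longrightarrow> \<phi> x = 0" using t by (auto simp: plane_test_field_def)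
        have d: "(\<phi> has_derivative (\<lambda>v. J x *v v)) (at x)" and J: "continuous_on UNIV J" for x
          using t by (auto simp: plane_test_field_def)
        have J0: "trace (J x) = 0" if "x \<notin> K" for x
          using jacobian_zero_outside[OF d K(1,3) that] by (simp add: trace_def)
        have eq: "indicator \<Omega> x *\<^sub>R (indicator E x * trace (J x)) = trace (J x)" for x
          using J0[of x] K(2) 2 by (cases "x \<in> K") (auto simp: indicator_def)
        have ct: "continuous_on UNIV (\<lambda>x. trace (J x))" using J unfolding trace_def by (intro continuous_intros)
        have "integrable lborel (\<lambda>x. trace (J x))"
          using integrable_continuous_compact_support[OF K(1) ct J0, of UNIV] by simp
        then have "integrable lebesgue (\<lambda>x. trace (J x))"
          using borel_measurable_continuous_onI[OF ct] by (simp add: integrable_completion)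
        moreover have "integral\<^sup>L lebesgue (\<lambda>x. trace (J x)) = 0"
          using flat.divergence_above_graph(3)[OF d J K(1,3)] borel_measurable_continuous_onI[OF ct]
          by (simp add: integral_completion)
        ultimately show ?thesis using zero[OF t] 2 basic[OF t]
          by (simp add: P_def set_lebesgue_integral_def eq del: real_scaleR_def)
      qed
      then show ?thesis using 2(1,2) by (intro exI[of _ U]) simp
    next
      case (3 U)
      have "P \<phi> J" if t: "plane_test_field U \<phi> J" for \<phi> J
      proof -
        obtain K where K: "compact K" "K \<subseteq> U" "\<And>x. x \<notin> K \<Longrightarrow> \<phi> x = 0" using t by (auto simp: plane_test_field_def)
        have d: "(\<phi> has_derivative (\<lambda>v. J x *v v)) (at x)" for x
          using t by (auto simp: plane_test_field_def)
        have J0: "trace (J x) = 0" if "x \<notin> K" for x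
          using jacobian_zero_outside[OF d K(1,3) that] by (simp add: trace_def)
        have eq: "indicator \<Omega> x *\<^sub>R (indicator E x * trace (J x)) = (0::real)" for x
          using J0[of x] K(2) 3 by (cases "x \<in> K") (auto simp: indicator_def)
        show ?thesis using zero[OF t] 3 basic[OF t]
          by (simp add: P_def set_lebesgue_integral_def eq del: real_scaleR_def)
      qed
      then show ?thesis using 3(1,2) by (intro exI[of _ U]) simp
    qed
  qed
  then show ?thesis by (simp add: P_def)
qed

text \<open>The integrand is positively homogeneous in the density where the spatial part does not vanish, as
  is the case for \<open>field\<close>. So the polar density may be replaced by \<open>field\<close>, and the energy is the
  integral of \<open>f (curvature)\<close>. If the latter is finite, the coercivity of \<open>f\<close> makes the lifted
  measure bounded.\<close>

lemma energy_le:
  assumes f: "f \<in> borel_measurable borel" and \<gamma>: "0 < \<gamma>" "\<And>t. ennreal (\<gamma> * sqrt (1 + t\<^sup>2)) \<le> f t"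
  shows "roto_translation_energy f \<Omega> (indicator E) \<le> (\<integral>\<^sup>+x\<in>\<Gamma>. f (curvature E x) \<partial>hausdorff1)"
proof (cases "(\<integral>\<^sup>+x\<in>\<Gamma>. f (curvature E x) \<partial>hausdorff1) = \<infinity>")
  case False
  define R where "R = (\<integral>\<^sup>+x\<in>\<Gamma>. f (curvature E x) \<partial>hausdorff1)"
  have R: "R < \<infinity>" using False by (simp add: R_def less_top)
  have R_eq: "R = (\<integral>\<^sup>+z. f (kap (fst z)) \<partial>curve_measure)"
  proof -
    have "(\<lambda>z :: (real ^ 2) \<times> real. f (kap (fst z))) \<in> borel_measurable borel"
      by (rule measurable_compose[OF borel_kap_fst f])
    then have "(\<integral>\<^sup>+z. f (kap (fst z)) \<partial>curve_measure) = (\<integral>\<^sup>+x\<in>\<Gamma>. f (kap x) \<partial>hausdorff1)"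
      by (subst nn_integral_curve_measure) (auto intro: phase_space_measurable simp: lift_def)
    also have "\<dots> = R" unfolding R_def
      by (intro nn_integral_cong) (auto simp: boundary_curvature_def split: split_indicator)
    finally show ?thesis by simp
  qed
  note field_meas = borel_field
  then have field_meas': "field \<in> borel_measurable curve_measure"
    using phase_space_measurable by (simp cong: measurable_cong_sets)
  have norm_field: "norm (field z) = sqrt (1 + (kap (fst z))\<^sup>2)" for z
    by (simp add: field_def norm_Pair)
  have "ennreal \<gamma> * (\<integral>\<^sup>+z. ennreal (norm (field z)) \<partial>curve_measure) = (\<integral>\<^sup>+z. ennreal \<gamma> * ennreal (norm (field z)) \<partial>curve_measure)"
    using field_meas' by (intro nn_integral_cmult[symmetric]) auto
  also have "\<dots> \<le> R"
    unfolding R_eq using \<gamma> by (intro nn_integral_mono) (simp add: norm_field ennreal_mult'[symmetric])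
  also note R
  finally have "(\<integral>\<^sup>+z. ennreal (norm (field z)) \<partial>curve_measure) < \<infinity>"
    using \<gamma>(1) by (auto simp: ennreal_mult_less_top)
  then have iG: "integrable curve_measure field"
    using field_meas' by (simp add: integrable_iff_bounded)
  have fin: "finite_measure curve_measure"
  proof (rule finite_measureI)
    have "emeasure curve_measure (space curve_measure) = (\<integral>\<^sup>+z. 1 \<partial>curve_measure)" by simp
    also have "\<dots> \<le> (\<integral>\<^sup>+z. ennreal (norm (field z)) \<partial>curve_measure)"
      by (intro nn_integral_mono) (simp add: norm_field)
    also have "\<dots> < \<infinity>" by fact
    finally show "emeasure curve_measure (space curve_measure) \<noteq> \<infinity>" by simp
  qed
  define \<sigma> where "\<sigma> A = (LINT z:A|curve_measure. field z)" for A
  have \<sigma>: "\<sigma> A = (LINT z:A|curve_measure. field z)" for A by (simp add: \<sigma>_def)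
  note dens = polar_density_of_density[OF fin sets_curve_measure iG \<sigma>]
  note vint = vector_integral_of_density[OF fin sets_curve_measure iG \<sigma>]
  have div: "divergence_free \<Omega> \<sigma>"
    unfolding divergence_free_def
  proof (intro allI impI)
    fix \<psi> D assume t: "phase_test_fun \<Omega> \<psi> D"
    then have "D \<in> borel_measurable (phase_space \<Omega>)"
      by (intro phase_space_measurable borel_measurable_continuous_onI) (auto simp: phase_test_fun_def)
    from vint[OF this] show "vector_integral (phase_space \<Omega>) D \<sigma> = 0"
      using lifted_boundary_closed[OF iG t] by simp
  qed
  have marg: "marginal_is_rotated_gradient \<Omega> (indicator E) \<sigma>"
    unfolding marginal_is_rotated_gradient_def
  proof (intro allI impI)
    fix \<phi> J assume t: "plane_test_field \<Omega> \<phi> J"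
    have "continuous_on UNIV \<phi>" using t unfolding plane_test_field_def
      by (meson continuous_at_imp_continuous_on has_derivative_continuous)
    then have "continuous_on UNIV (\<lambda>z :: (real ^ 2) \<times> real. \<phi> (fst z))"
      by (rule continuous_on_compose2[OF _ continuous_on_fst[OF continuous_on_id]]) simp
    then have "continuous_on UNIV (\<lambda>z :: (real ^ 2) \<times> real. perp (\<phi> (fst z)))"
      by (rule continuous_on_compose2[OF continuous_perp[of UNIV]]) simp
    then have "(\<lambda>z :: (real ^ 2) \<times> real. (perp (\<phi> (fst z)), 0 :: real)) \<in> borel_measurable borel"
      by (intro borel_measurable_continuous_onI continuous_on_Pair continuous_on_const)
    note m = phase_space_measurable[OF this]
    have "vector_integral (phase_space \<Omega>) (\<lambda>z. (perp (\<phi> (fst z)), 0)) \<sigma>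
        = (LINT z|curve_measure. (perp (\<phi> (fst z)), 0) \<bullet> field z)"
      by (rule vint[OF m])
    also have "\<dots> = (LINT x:\<Gamma>|hausdorff1. (perp (\<phi> (fst (lift x))), 0) \<bullet> field (lift x))"
      using m phase_space_measurable[OF field_meas] by (intro integral_curve_measure borel_measurable_inner)
    also have "\<dots> = (LINT x:\<Gamma>|hausdorff1. perp (\<phi> x) \<bullet> angle_vec (th x))"
      by (simp add: lift_def field_def inner_Pair)
    finally show "vector_integral (phase_space \<Omega>) (\<lambda>z. (perp (\<phi> (fst z)), 0)) \<sigma>
        = - (LINT x:\<Omega>|lebesgue. indicator E x * trace (J x))"
      using lifted_boundary_marginal[OF fin t] by simp
  qed
  have "roto_translation_energy f \<Omega> (indicator E) \<le> lifted_energy f \<Omega> \<sigma>"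
    unfolding roto_translation_energy_def by (rule Inf_lower) (use dens(1) div marg in auto)
  also have "lifted_energy f \<Omega> \<sigma> = R"
  proof -
    let ?M = "phase_space \<Omega>"
    let ?p = "polar_density ?M \<sigma>"
    obtain \<rho> where \<rho>: "\<rho> \<in> borel_measurable curve_measure" "\<And>z. 0 \<le> \<rho> z"
      "total_variation ?M \<sigma> = density curve_measure (\<lambda>z. ennreal (\<rho> z))"
      "AE z in curve_measure. \<rho> z *\<^sub>R ?p z = field z"
      using dens(2) by blast
    have pm[measurable]: "?p \<in> borel_measurable curve_measure"
      using borel_measurable_integrable[OF integrable_polar_density[OF dens(1)]] by (simp cong: measurable_cong_sets)
    have fk[measurable]: "(\<lambda>z. f (kap (fst z))) \<in> borel_measurable curve_measure"
    proof -
      have "(\<lambda>z :: (real ^ 2) \<times> real. f (kap (fst z))) \<in> borel_measurable borel"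
        by (rule measurable_compose[OF borel_kap_fst f])
      from phase_space_measurable[OF this] show ?thesis by (simp cong: measurable_cong_sets)
    qed
    have n1: "(\<lambda>z. norm (fst (?p z))) \<in> borel_measurable curve_measure"
      by (rule measurable_compose[OF measurable_compose[OF pm borel_fst] borel_measurable_norm])
    have hfun: "lifted_density f (snd z) (?p z) = ennreal (norm (fst (?p z))) * f (kap (fst z))" "0 < \<rho> z"
      "\<rho> z * norm (fst (?p z)) = 1"
      if eq: "\<rho> z *\<^sub>R ?p z = field z" for z
    proof -
      have nz: "\<rho> z \<noteq> 0" 
      proof
        assume "\<rho> z = 0"
        then have "norm (field z) = 0" using eq by simp
        moreover have "1 \<le> norm (field z)" by (simp add: norm_field)
        ultimately show False by simp
      qed
      then show pos: "0 < \<rho> z" using \<rho>(2)[of z] by simp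
      have p: "?p z = (1 / \<rho> z) *\<^sub>R field z" using nz by (simp add: eq[symmetric])
      have p1: "fst (?p z) = (1 / \<rho> z) *\<^sub>R angle_vec (snd z)" and p2: "snd (?p z) = (1 / \<rho> z) * kap (fst z)"
        unfolding p by (simp_all add: field_def)
      have n: "norm (fst (?p z)) = 1 / \<rho> z" unfolding p1 using pos by simp
      then show "\<rho> z * norm (fst (?p z)) = 1" using pos by simp
      have "fst (?p z) \<noteq> 0" using n pos by auto
      moreover have "\<exists>r\<ge>0. fst (?p z) = r *\<^sub>R angle_vec (snd z)" using p1 pos by (intro exI[of _ "1 / \<rho> z"]) auto
      moreover have "snd (?p z) / norm (fst (?p z)) = kap (fst z)" unfolding n p2 using pos by simp
      ultimately show "lifted_density f (snd z) (?p z) = ennreal (norm (fst (?p z))) * f (kap (fst z))"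
        by (simp add: lifted_density_def)
    qed
    have "AE z in density curve_measure (\<lambda>z. ennreal (\<rho> z)). \<rho> z *\<^sub>R ?p z = field z"
      using \<rho>(1,4) by (subst AE_density) auto
    then have "AE z in density curve_measure (\<lambda>z. ennreal (\<rho> z)).
        lifted_density f (snd z) (?p z) = ennreal (norm (fst (?p z))) * f (kap (fst z))"
      by eventually_elim (rule hfun(1))
    then have "lifted_energy f \<Omega> \<sigma> = (\<integral>\<^sup>+z. ennreal (norm (fst (?p z))) * f (kap (fst z)) \<partial>density curve_measure (\<lambda>z. ennreal (\<rho> z)))"
      unfolding lifted_energy_def \<rho>(3) by (rule nn_integral_cong_AE)
    also have "\<dots> = (\<integral>\<^sup>+z. ennreal (\<rho> z) * (ennreal (norm (fst (?p z))) * f (kap (fst z))) \<partial>curve_measure)"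
      using \<rho>(1) fk measurable_compose[OF n1 measurable_ennreal]
      by (intro nn_integral_density borel_measurable_times_ennreal) auto
    also have "\<dots> = (\<integral>\<^sup>+z. f (kap (fst z)) \<partial>curve_measure)"
    proof (rule nn_integral_cong_AE)
      show "AE z in curve_measure. ennreal (\<rho> z) * (ennreal (norm (fst (?p z))) * f (kap (fst z))) = f (kap (fst z))"
        using \<rho>(4)
      proof eventually_elim
        case (elim z)
        show ?case using hfun(3)[OF elim] \<rho>(2)[of z] by (simp add: mult.assoc[symmetric] ennreal_mult[symmetric])
      qed
    qed
    finally show ?thesis using R_eq by simp
  qed
  finally show ?thesis by (simp add: R_def)
qed simp

end

section \<open>Concentrating test functions\<close>

lemma integral_indicator_UN_sums:
  fixes d :: "'a \<Rightarrow> real" and A :: "nat \<Rightarrow> 'b set"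
  assumes d: "integrable M d" and X: "X \<in> measurable M N" and A: "\<And>i. A i \<in> sets N" "disjoint_family A"
  shows "(\<lambda>i. LINT z|M. indicator (A i) (X z) * d z) sums (LINT z|M. indicator (\<Union>i. A i) (X z) * d z)"
proof -
  have int: "integrable M (\<lambda>z. indicator B (X z) * d z)" if B: "B \<in> sets N" for B
  proof -
    have "integrable M (\<lambda>z. indicator (X -` B \<inter> space M) z *\<^sub>R d z)"
      using measurable_sets[OF X B] d by (rule integrable_mult_indicator)
    then show ?thesis by (rule Bochner_Integration.integrable_cong[THEN iffD1, rotated 2]) (auto simp: indicator_def)
  qed
  have "(\<lambda>n. LINT z|M. indicator (\<Union>i<n. A i) (X z) * d z) \<longlonglongrightarrow> (LINT z|M. indicator (\<Union>i. A i) (X z) * d z)"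
  proof (rule integral_dominated_convergence[where w="\<lambda>z. norm (d z)"])
    show "AE z in M. (\<lambda>n. indicator (\<Union>i<n. A i) (X z) * d z) \<longlonglongrightarrow> indicator (\<Union>i. A i) (X z) * d z"
      by (intro AE_I2 tendsto_mult tendsto_const LIMSEQ_indicator_UN)
    show "(\<lambda>z. indicator (\<Union>i. A i) (X z) * d z) \<in> borel_measurable M"
      by (intro borel_measurable_integrable int sets.countable_UN) (use A in auto)
    show "(\<lambda>z. indicator (\<Union>i<n. A i) (X z) * d z) \<in> borel_measurable M" for n
      by (intro borel_measurable_integrable int sets.finite_UN) (use A in auto)
  qed (use d in \<open>auto split: split_indicator\<close>)
  moreover have "(LINT z|M. indicator (\<Union>i<n. A i) (X z) * d z) = (\<Sum>i<n. LINT z|M. indicator (A i) (X z) * d z)" for n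
  proof (induction n)
    case (Suc n)
    have "(\<Union>i<n. A i) \<inter> A n = {}"
      using disjoint_family_onD[OF A(2), of _ n] by fastforce
    then have "indicator (\<Union>i<Suc n. A i) (X z) * d z = indicator (\<Union>i<n. A i) (X z) * d z + indicator (A n) (X z) * d z" for z
      by (auto simp: lessThan_Suc split: split_indicator)
    moreover have "integrable M (\<lambda>z. indicator (\<Union>i<n. A i) (X z) * d z)" using A by (intro int sets.finite_UN) auto
    ultimately show ?case using Suc int[OF A(1)[of n]] by simp
  qed simp
  ultimately show ?thesis by (simp add: sums_def)
qed

text \<open>Two signed densities whose images under \<open>X1\<close> and \<open>X2\<close> agree on open intervals
  agree on all Borel sets.\<close>

lemma integral_eq_on_intervals:
  fixes d1 :: "'a \<Rightarrow> real" and d2 :: "'b \<Rightarrow> real" and X1 :: "'a \<Rightarrow> real" and X2 :: "'b \<Rightarrow> real"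
  assumes d: "integrable M1 d1" "integrable M2 d2"
    and X: "X1 \<in> borel_measurable M1" "X2 \<in> borel_measurable M2"
    and itv: "\<And>u v. (LINT z|M1. indicator {u<..<v} (X1 z) * d1 z) = (LINT z|M2. indicator {u<..<v} (X2 z) * d2 z)"
    and tot: "(LINT z|M1. d1 z) = (LINT z|M2. d2 z)"
    and B: "B \<in> sets borel"
  shows "(LINT z|M1. indicator B (X1 z) * d1 z) = (LINT z|M2. indicator B (X2 z) * d2 z)"
proof -
  let ?G = "range (\<lambda>(u, v). {u<..<v::real})"
  have G: "sets (borel :: real measure) = sigma_sets UNIV ?G"
    by (subst borel_eq_box) (simp add: box_real split_beta')
  have int: "integrable M (\<lambda>z. indicator B (X z) * d z)"
    if "B \<in> sets borel" "integrable M d" "X \<in> borel_measurable M" for B :: "real set" and M and d :: "'c \<Rightarrow> real" and X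
  proof -
    have "integrable M (\<lambda>z. indicator (X -` B \<inter> space M) z *\<^sub>R d z)"
      using measurable_sets[OF that(3,1)] that(2) by (rule integrable_mult_indicator)
    then show ?thesis by (rule Bochner_Integration.integrable_cong[THEN iffD1, rotated 2]) (auto simp: indicator_def)
  qed
  have "Int_stable ?G"
    by (auto simp: Int_stable_def Int_greaterThanLessThan intro!: image_eqI)
  moreover have "?G \<subseteq> Pow UNIV" by simp
  moreover have "B \<in> sigma_sets UNIV ?G" using B G by simp
  ultimately show ?thesis
  proof (induction rule: sigma_sets_induct_disjoint)
    case (basic A)
    then show ?case using itv by auto
  next
    case empty
    then show ?case by simp
  next
    case (compl A)
    then have A: "A \<in> sets borel" using G by simp
    have "(LINT z|M1. indicator (UNIV - A) (X1 z) * d1 z) = (LINT z|M1. d1 z - indicator A (X1 z) * d1 z)"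
      by (intro Bochner_Integration.integral_cong) (auto split: split_indicator)
    also have "\<dots> = (LINT z|M2. d2 z - indicator A (X2 z) * d2 z)"
      using d int[OF A d(1) X(1)] int[OF A d(2) X(2)] compl tot by simp
    also have "\<dots> = (LINT z|M2. indicator (UNIV - A) (X2 z) * d2 z)"
      by (intro Bochner_Integration.integral_cong) (auto split: split_indicator)
    finally show ?case .
  next
    case (union A)
    then have A: "\<And>i. A i \<in> sets borel" using G by auto
    show ?case
      using integral_indicator_UN_sums[OF d(1) X(1) A union(1)] integral_indicator_UN_sums[OF d(2) X(2) A union(1)] union(3)
      by (simp add: sums_unique2)
  qed
qed

text \<open>Concentration profiles: as \<open>N\<close> grows, \<open>s / (1 + (N s)\<^sup>2)\<close> vanishes uniformly while its
  derivative converges boundedly to the indicator of \<open>s = 0\<close>.\<close>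

definition prof :: "real \<Rightarrow> real \<Rightarrow> real" where "prof N s = s / (1 + (N * s)\<^sup>2)"
definition prof' :: "real \<Rightarrow> real \<Rightarrow> real" where "prof' N s = (1 - (N * s)\<^sup>2) / (1 + (N * s)\<^sup>2)\<^sup>2"
definition peak :: "real \<Rightarrow> real \<Rightarrow> real" where "peak N v = 1 / (1 + (N * v)\<^sup>2)"
definition peak' :: "real \<Rightarrow> real \<Rightarrow> real" where "peak' N v = - (2 * N\<^sup>2 * v) / (1 + (N * v)\<^sup>2)\<^sup>2"

lemma one_plus_sq_pos [simp]: "0 < 1 + (x::real)\<^sup>2" "1 + (x::real)\<^sup>2 \<noteq> 0"
  by (auto simp: add_pos_nonneg add_nonneg_eq_0_iff)

lemma C1_prof: "C1_gradient (prof N) (prof' N)"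
  unfolding C1_gradient_real prof_def[abs_def] prof'_def[abs_def]
proof safe
  fix t :: real
  show "((\<lambda>s. s / (1 + (N * s)\<^sup>2)) has_real_derivative (1 - (N * t)\<^sup>2) / (1 + (N * t)\<^sup>2)\<^sup>2) (at t)"
    by (auto intro!: derivative_eq_intros simp: power2_eq_square algebra_simps simp del: one_plus_sq_pos)
       (use one_plus_sq_pos[of "N * t"] in \<open>auto simp: power2_eq_square algebra_simps divide_simps\<close>)
qed (auto intro!: continuous_intros)

lemma C1_peak: "C1_gradient (peak N) (peak' N)"
  unfolding C1_gradient_real peak_def[abs_def] peak'_def[abs_def]
proof safe
  fix t :: real
  show "((\<lambda>s. 1 / (1 + (N * s)\<^sup>2)) has_real_derivative - (2 * N\<^sup>2 * t) / (1 + (N * t)\<^sup>2)\<^sup>2) (at t)"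
    by (auto intro!: derivative_eq_intros simp: power2_eq_square algebra_simps simp del: one_plus_sq_pos)
       (use one_plus_sq_pos[of "N * t"] in \<open>auto simp: power2_eq_square algebra_simps divide_simps\<close>)
qed (auto intro!: continuous_intros)

lemma prof_bound: "0 < N \<Longrightarrow> \<bar>prof N s\<bar> \<le> 1 / N"
proof -
  assume N: "0 < N"
  have "\<bar>N * s\<bar> \<le> 1 + (N * s)\<^sup>2"
    using zero_le_power2[of "\<bar>N * s\<bar> - 1"] by (simp add: power2_diff)
  then have "N * \<bar>s\<bar> \<le> 1 + (N * s)\<^sup>2" using N by (simp add: abs_mult)
  then show ?thesis using N by (simp add: prof_def abs_divide pos_divide_le_eq pos_le_divide_eq mult.commute)
qed

lemma peak_bounds: "0 \<le> peak N v" "peak N v \<le> 1" "peak N 0 = 1"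
  by (auto simp: peak_def)

lemma prof'_bound: "\<bar>prof' N s\<bar> \<le> peak N s" "prof' N 0 = 1"
proof -
  have "\<bar>1 - (N * s)\<^sup>2\<bar> \<le> 1 + (N * s)\<^sup>2" by (simp add: abs_le_iff)
  then have "\<bar>1 - (N * s)\<^sup>2\<bar> / (1 + (N * s)\<^sup>2)\<^sup>2 \<le> (1 + (N * s)\<^sup>2) / (1 + (N * s)\<^sup>2)\<^sup>2"
    by (intro divide_right_mono) auto
  then show "\<bar>prof' N s\<bar> \<le> peak N s" by (simp add: prof'_def peak_def abs_divide power2_eq_square[of "1 + _"])
qed (simp add: prof'_def)

lemma prof_peak'_bound:
  assumes N: "0 < N" shows "\<bar>prof N s * peak' N v\<bar> \<le> peak N v"
proof -
  have "2 * \<bar>N * v\<bar> \<le> 1 + (N * v)\<^sup>2"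
    using zero_le_power2[of "\<bar>N * v\<bar> - 1"] by (simp add: power2_diff)
  then have "2 * (N * \<bar>v\<bar>) / (1 + (N * v)\<^sup>2)\<^sup>2 \<le> (1 + (N * v)\<^sup>2) / (1 + (N * v)\<^sup>2)\<^sup>2"
    using N by (intro divide_right_mono) (auto simp: abs_mult)
  also have "\<dots> = peak N v" by (simp add: peak_def power2_eq_square[of "1 + _"])
  finally have "(1 / N) * \<bar>peak' N v\<bar> \<le> peak N v"
    using N by (simp add: peak'_def abs_divide abs_mult power2_eq_square[of N] mult.assoc)
  moreover have "\<bar>prof N s\<bar> * \<bar>peak' N v\<bar> \<le> (1 / N) * \<bar>peak' N v\<bar>"
    by (intro mult_right_mono prof_bound N) simp
  ultimately show ?thesis by (simp add: abs_mult)
qed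

lemma peak_tendsto: "(\<lambda>n. peak (real (Suc n)) v) \<longlonglongrightarrow> (if v = 0 then 1 else 0)"
proof (cases "v = 0")
  case False
  have "(\<lambda>n. peak (real (Suc n)) v) \<longlonglongrightarrow> 0"
  proof (rule tendsto_sandwich[where f="\<lambda>_. 0"])
    show "\<forall>\<^sub>F n in sequentially. peak (real (Suc n)) v \<le> (1 / \<bar>v\<bar>) * inverse (real (Suc n))"
    proof (intro always_eventually allI)
      fix n
      have "\<bar>real (Suc n) * v\<bar> \<le> 1 + (real (Suc n) * v)\<^sup>2"
        using zero_le_power2[of "\<bar>real (Suc n) * v\<bar> - 1"] by (simp add: power2_diff)
      then have "real (Suc n) * \<bar>v\<bar> \<le> 1 + (real (Suc n) * v)\<^sup>2" by (simp only: abs_mult abs_of_nat)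
      then have "1 / (1 + (real (Suc n) * v)\<^sup>2) \<le> 1 / (real (Suc n) * \<bar>v\<bar>)"
        using False by (intro divide_left_mono) auto
      then show "peak (real (Suc n)) v \<le> (1 / \<bar>v\<bar>) * inverse (real (Suc n))"
        by (simp add: peak_def divide_inverse mult.commute)
    qed
    show "(\<lambda>n. (1 / \<bar>v\<bar>) * inverse (real (Suc n))) \<longlonglongrightarrow> 0"
      by (intro tendsto_mult_right_zero LIMSEQ_inverse_real_of_nat)
  qed (auto simp: peak_bounds)
  then show ?thesis using False by simp
qed (simp add: peak_bounds)

lemma profile_limits:
  "(\<lambda>n. prof (real (Suc n)) s * peak (real (Suc n)) v) \<longlonglongrightarrow> 0"
  "(\<lambda>n. prof (real (Suc n)) s * peak' (real (Suc n)) v) \<longlonglongrightarrow> 0"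
  "(\<lambda>n. peak (real (Suc n)) v * prof' (real (Suc n)) s) \<longlonglongrightarrow> (if s = 0 \<and> v = 0 then 1 else 0)"
proof -
  have prof0: "(\<lambda>n. prof (real (Suc n)) s) \<longlonglongrightarrow> 0"
    by (rule Lim_null_comparison[OF _ LIMSEQ_inverse_real_of_nat])
       (auto intro!: always_eventually prof_bound[of "real (Suc _)", simplified inverse_eq_divide[symmetric]] simp del: of_nat_Suc)
  from tendsto_mult[OF this peak_tendsto]
  show "(\<lambda>n. prof (real (Suc n)) s * peak (real (Suc n)) v) \<longlonglongrightarrow> 0" by simp
  show "(\<lambda>n. prof (real (Suc n)) s * peak' (real (Suc n)) v) \<longlonglongrightarrow> 0"
  proof (cases "v = 0")
    case False
    show ?thesis
      by (rule Lim_null_comparison[where g="\<lambda>n. peak (real (Suc n)) v"])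
         (use peak_tendsto[of v] False in \<open>auto intro!: always_eventually prof_peak'_bound simp del: of_nat_Suc\<close>)
  qed (simp add: peak'_def)
  have "(\<lambda>n. prof' (real (Suc n)) s) \<longlonglongrightarrow> (if s = 0 then 1 else 0)"
  proof (cases "s = 0")
    case False
    have "(\<lambda>n. prof' (real (Suc n)) s) \<longlonglongrightarrow> 0"
      by (rule Lim_null_comparison[where g="\<lambda>n. peak (real (Suc n)) s"])
         (use peak_tendsto[of s] False in \<open>auto intro!: always_eventually prof'_bound simp del: of_nat_Suc\<close>)
    then show ?thesis using False by simp
  qed (simp add: prof'_bound)
  note tendsto_mult[OF peak_tendsto[of v] this]
  moreover have "(if v = 0 then 1 else 0) * (if s = 0 then 1 else 0) = (if s = 0 \<and> v = 0 then 1 else 0 :: real)" by simp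
  ultimately show "(\<lambda>n. peak (real (Suc n)) v * prof' (real (Suc n)) s) \<longlonglongrightarrow> (if s = 0 \<and> v = 0 then 1 else 0)"
    by (simp only:)
qed

lemma borel_phase_space: "F \<in> borel_measurable borel \<Longrightarrow> F \<in> borel_measurable (phase_space \<Omega>)"
  unfolding phase_space_def by (rule measurable_restrict_space1)

text \<open>The equation \<open>div \<sigma> = 0\<close> passes to the zero set of a periodic function \<open>S\<close>: there, \<open>\<sigma>\<close> is
  tangential. The test functions are small multiples of \<open>A\<close> with a gradient that concentrates. A second
  function \<open>V\<close> restricts the conclusion to a set of codimension two.\<close>

lemma divergence_free_concentrate:
  assumes bvm: "bounded_vector_measure (phase_space \<Omega>) \<sigma>" and div: "divergence_free \<Omega> \<sigma>"
    and A: "phase_test_fun \<Omega> A DA"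
    and S: "C1_gradient S DS" "\<And>x \<theta>. S (x, \<theta> + 2 * pi) = S (x, \<theta>)"
    and V: "C1_gradient V DV" "\<And>x \<theta>. V (x, \<theta> + 2 * pi) = V (x, \<theta>)"
  shows "integrable (total_variation (phase_space \<Omega>) \<sigma>) (\<lambda>z. (if S z = 0 \<and> V z = 0 then 1 else 0) *
      (A z * (DS z \<bullet> polar_density (phase_space \<Omega>) \<sigma> z)))" (is "integrable _ ?F")
    and "(LINT z|total_variation (phase_space \<Omega>) \<sigma>. (if S z = 0 \<and> V z = 0 then 1 else 0) *
      (A z * (DS z \<bullet> polar_density (phase_space \<Omega>) \<sigma> z))) = 0"
proof -
  let ?T = "total_variation (phase_space \<Omega>) \<sigma>" and ?q = "polar_density (phase_space \<Omega>) \<sigma>"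
  have iq: "integrable ?T ?q" by (rule integrable_polar_density[OF bvm])
  have AC: "C1_gradient A DA" using A by (simp add: phase_test_fun_iff)
  have bd: "\<exists>C\<ge>0. \<forall>z. norm (A z *\<^sub>R F z) \<le> C" if "C1_gradient G F" "\<And>x \<theta>. G (x, \<theta> + 2 * pi) = G (x, \<theta>)" for G F
  proof -
    have "continuous_on UNIV (\<lambda>z. A z *\<^sub>R F z)"
      by (intro continuous_intros C1_gradient_continuous[OF AC] C1_gradient_continuous_gradient[OF that(1)])
    moreover have "A (x, \<theta> + 2 * pi) *\<^sub>R F (x, \<theta> + 2 * pi) = A (x, \<theta>) *\<^sub>R F (x, \<theta>)" for x \<theta>
      using periodic_gradient[OF that] A by (auto simp: phase_test_fun_iff)
    ultimately obtain C where "0 \<le> C" "\<And>z. norm (A z *\<^sub>R F z) \<le> C"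
      by (rule phase_test_fun_bounded[OF A]) (simp, blast)
    then show ?thesis by blast
  qed
  obtain C1 where C1: "0 \<le> C1" "\<And>z. norm (A z *\<^sub>R DS z) \<le> C1" using bd[OF S] by blast
  obtain C2 where C2: "0 \<le> C2" "\<And>z. norm (A z *\<^sub>R DV z) \<le> C2" using bd[OF V] by blast
  obtain C3 where C3: "0 \<le> C3" "\<And>z. norm (DA z) \<le> C3" using phase_test_fun_bounded_gradient[OF A] by blast
  define Dn where "Dn n z = A z *\<^sub>R (prof (real (Suc n)) (S z) *\<^sub>R (peak' (real (Suc n)) (V z) *\<^sub>R DV z)
      + peak (real (Suc n)) (V z) *\<^sub>R (prof' (real (Suc n)) (S z) *\<^sub>R DS z))
      + (prof (real (Suc n)) (S z) * peak (real (Suc n)) (V z)) *\<^sub>R DA z" for n z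
  have test: "phase_test_fun \<Omega> (\<lambda>z. A z * (prof (real (Suc n)) (S z) * peak (real (Suc n)) (V z))) (Dn n)" for n
  proof -
    have "C1_gradient (\<lambda>z. A z * (prof (real (Suc n)) (S z) * peak (real (Suc n)) (V z))) (Dn n)"
      unfolding Dn_def
      by (intro C1_gradient_mult AC C1_gradient_compose[OF S(1) C1_prof] C1_gradient_compose[OF V(1) C1_peak])
    then show ?thesis using A S(2) V(2) by (auto simp: phase_test_fun_iff)
  qed
  have Dn_meas: "Dn n \<in> borel_measurable (phase_space \<Omega>)" for n
    using test[of n] by (intro borel_phase_space borel_measurable_continuous_onI) (auto simp: phase_test_fun_def)
  have zero: "(LINT z|?T. Dn n z \<bullet> ?q z) = 0" for n
    using div test[of n] unfolding divergence_free_def vector_integral_def by blast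
  have qm: "?q \<in> borel_measurable ?T" using iq by (rule borel_measurable_integrable)
  have Fm: "?F \<in> borel_measurable ?T"
  proof -
    have "S \<in> borel_measurable ?T" "V \<in> borel_measurable ?T" "A \<in> borel_measurable ?T" "DS \<in> borel_measurable ?T"
      using C1_gradient_continuous[OF S(1)] C1_gradient_continuous[OF V(1)] C1_gradient_continuous[OF AC]
        C1_gradient_continuous_gradient[OF S(1)]
      by (auto intro!: borel_phase_space borel_measurable_continuous_onI cong: measurable_cong_sets)
    then show ?thesis using qm by measurable
  qed
  show "integrable ?T ?F"
  proof (rule Bochner_Integration.integrable_bound[of _ "\<lambda>z. C1 * norm (?q z)"])
    show "AE z in ?T. norm (?F z) \<le> norm (C1 * norm (?q z))"
    proof (rule AE_I2)
      fix z
      have "\<bar>A z * (DS z \<bullet> ?q z)\<bar> \<le> norm (A z *\<^sub>R DS z) * norm (?q z)"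
        using Cauchy_Schwarz_ineq2[of "A z *\<^sub>R DS z" "?q z"] by simp
      also have "\<dots> \<le> C1 * norm (?q z)" by (intro mult_right_mono C1) simp
      finally show "norm (?F z) \<le> norm (C1 * norm (?q z))" using C1(1) by (simp add: abs_mult)
    qed
  qed (use iq Fm in simp_all)
  have "(\<lambda>n. LINT z|?T. Dn n z \<bullet> ?q z) \<longlonglongrightarrow> (LINT z|?T. (if S z = 0 \<and> V z = 0 then 1 else 0) * (A z * (DS z \<bullet> ?q z)))"
  proof (rule integral_dominated_convergence[where w="\<lambda>z. (C1 + C2 + C3) * norm (?q z)"])
    show "integrable ?T (\<lambda>z. (C1 + C2 + C3) * norm (?q z))" using iq by simp
    show "(\<lambda>z. Dn n z \<bullet> ?q z) \<in> borel_measurable ?T" for n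
      using Dn_meas[of n] qm by (intro borel_measurable_inner) (simp_all cong: measurable_cong_sets)
    show "?F \<in> borel_measurable ?T" by (rule Fm)
    show "AE z in ?T. (\<lambda>n. Dn n z \<bullet> ?q z) \<longlonglongrightarrow> (if S z = 0 \<and> V z = 0 then 1 else 0) * (A z * (DS z \<bullet> ?q z))"
    proof (rule AE_I2)
      fix z
      have "(\<lambda>n. Dn n z) \<longlonglongrightarrow> A z *\<^sub>R (0 *\<^sub>R DV z + (if S z = 0 \<and> V z = 0 then 1 else 0) *\<^sub>R DS z) + 0 *\<^sub>R DA z"
        unfolding Dn_def scaleR_scaleR by (intro tendsto_intros profile_limits)
      then have "(\<lambda>n. Dn n z \<bullet> ?q z) \<longlonglongrightarrow> (A z *\<^sub>R (0 *\<^sub>R DV z + (if S z = 0 \<and> V z = 0 then 1 else 0) *\<^sub>R DS z) + 0 *\<^sub>R DA z) \<bullet> ?q z"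
        by (intro tendsto_inner tendsto_const)
      then show "(\<lambda>n. Dn n z \<bullet> ?q z) \<longlonglongrightarrow> (if S z = 0 \<and> V z = 0 then 1 else 0) * (A z * (DS z \<bullet> ?q z))"
        by (auto split: if_splits)
    qed
    show "AE z in ?T. norm (Dn n z \<bullet> ?q z) \<le> (C1 + C2 + C3) * norm (?q z)" for n
    proof (rule AE_I2)
      fix z
      let ?N = "real (Suc n)"
      have N: "0 < ?N" "1 \<le> ?N" by auto
      have b1: "\<bar>prof ?N (S z) * peak' ?N (V z)\<bar> \<le> 1"
        using prof_peak'_bound[of ?N "S z" "V z"] N peak_bounds(2)[of ?N "V z"] by linarith
      have b2: "\<bar>peak ?N (V z) * prof' ?N (S z)\<bar> \<le> 1"
        using prof'_bound(1)[of ?N "S z"] peak_bounds(1,2)[of ?N "S z"] peak_bounds(1,2)[of ?N "V z"]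
        by (simp add: abs_mult) (intro mult_le_one, auto)
      have "\<bar>prof ?N (S z)\<bar> \<le> 1" 
      proof -
        have "1 / ?N \<le> 1" by simp
        then show ?thesis using prof_bound[OF N(1), of "S z"] by linarith
      qed
      then have b3: "\<bar>prof ?N (S z) * peak ?N (V z)\<bar> \<le> 1"
        using peak_bounds(1,2)[of ?N "V z"] by (simp add: abs_mult) (intro mult_le_one, auto)
      have Dn_eq: "Dn n z = (prof ?N (S z) * peak' ?N (V z)) *\<^sub>R (A z *\<^sub>R DV z)
          + (peak ?N (V z) * prof' ?N (S z)) *\<^sub>R (A z *\<^sub>R DS z) + (prof ?N (S z) * peak ?N (V z)) *\<^sub>R DA z"
        unfolding Dn_def by (simp add: scaleR_add_right mult.commute mult.left_commute)
      have "norm (Dn n z) \<le> \<bar>prof ?N (S z) * peak' ?N (V z)\<bar> * norm (A z *\<^sub>R DV z)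
          + \<bar>peak ?N (V z) * prof' ?N (S z)\<bar> * norm (A z *\<^sub>R DS z) + \<bar>prof ?N (S z) * peak ?N (V z)\<bar> * norm (DA z)"
        unfolding Dn_eq by (intro order_trans[OF norm_triangle_ineq] add_mono) (simp_all add: abs_mult mult.assoc)
      also have "\<dots> \<le> 1 * C2 + 1 * C1 + 1 * C3"
        by (intro add_mono mult_mono b1 b2 b3 C1 C2 C3) auto
      finally have "norm (Dn n z) \<le> C1 + C2 + C3" by simp
      then have "norm (Dn n z) * norm (?q z) \<le> (C1 + C2 + C3) * norm (?q z)" by (intro mult_right_mono) auto
      then show "norm (Dn n z \<bullet> ?q z) \<le> (C1 + C2 + C3) * norm (?q z)"
        using Cauchy_Schwarz_ineq2[of "Dn n z" "?q z"] by simp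
    qed
  qed
  then have "(\<lambda>n::nat. 0::real) \<longlonglongrightarrow> (LINT z|?T. (if S z = 0 \<and> V z = 0 then 1 else 0) * (A z * (DS z \<bullet> ?q z)))"
    by (simp only: zero)
  then show "(LINT z|?T. ?F z) = 0" by (rule LIMSEQ_unique[OF _ tendsto_const])
qed

text \<open>In the limit, smooth bumps are as good as the indicators of intervals. The cutoff to \<open>{l<..<r}\<close>
  reduces an arbitrary interval to one on which the bumps are admissible.\<close>

lemma integral_eq_on_bumps:
  fixes d1 :: "'a \<Rightarrow> real" and d2 :: "'b \<Rightarrow> real" and X1 :: "'a \<Rightarrow> real" and X2 :: "'b \<Rightarrow> real"
  assumes d: "integrable M1 d1" "integrable M2 d2"
    and X: "X1 \<in> borel_measurable M1" "X2 \<in> borel_measurable M2"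
    and J: "\<And>z. X1 z \<notin> {l<..<r} \<Longrightarrow> d1 z = 0" "\<And>z. X2 z \<notin> {l<..<r} \<Longrightarrow> d2 z = 0"
    and eq: "\<And>u v n. l \<le> u \<Longrightarrow> v \<le> r \<Longrightarrow>
      (LINT z|M1. itv_bump u v n (X1 z) * d1 z) = (LINT z|M2. itv_bump u v n (X2 z) * d2 z)"
    and B: "B \<in> sets borel"
  shows "(LINT z|M1. indicator B (X1 z) * d1 z) = (LINT z|M2. indicator B (X2 z) * d2 z)"
proof -
  have lim: "(\<lambda>n. LINT z|M. itv_bump u v n (X z) * d z) \<longlonglongrightarrow> (LINT z|M. indicator {u<..<v} (X z) * d z)"
    if d: "integrable M d" and X: "X \<in> borel_measurable M" for M and d :: "'c \<Rightarrow> real" and X u v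
  proof (rule integral_dominated_convergence[where w="\<lambda>z. norm (d z)"])
    have "itv_bump u v n \<in> borel_measurable borel" for n
      using C1_itv_bump C1_gradient_continuous borel_measurable_continuous_onI by blast
    from measurable_compose[OF X this]
    show "(\<lambda>z. itv_bump u v n (X z) * d z) \<in> borel_measurable M" for n using d by auto
    have "(indicator {u<..<v} :: real \<Rightarrow> real) \<in> borel_measurable borel" by simp
    from measurable_compose[OF X this]
    show "(\<lambda>z. indicator {u<..<v} (X z) * d z) \<in> borel_measurable M" using d by auto
    show "AE z in M. (\<lambda>n. itv_bump u v n (X z) * d z) \<longlonglongrightarrow> indicator {u<..<v} (X z) * d z"
      by (intro AE_I2 tendsto_mult tendsto_const itv_bump_tendsto)
    show "AE z in M. norm (itv_bump u v n (X z) * d z) \<le> norm (d z)" for n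
      using itv_bump_bounds[of u v n] by (intro AE_I2) (auto simp: abs_mult intro!: mult_left_le_one_le)
  qed (use d in simp)
  have step: "(LINT z|M1. indicator {u<..<v} (X1 z) * d1 z) = (LINT z|M2. indicator {u<..<v} (X2 z) * d2 z)"
    if "l \<le> u" "v \<le> r" for u v
    using lim[OF d(1) X(1), of u v] lim[OF d(2) X(2), of u v] eq[OF that] by (simp add: LIMSEQ_unique)
  have cut: "indicator {u<..<v} (X1 z) * d1 z = indicator {max u l<..<min v r} (X1 z) * d1 z"
    "indicator {u<..<v} (X2 z') * d2 z' = indicator {max u l<..<min v r} (X2 z') * d2 z'" for u v z z'
    using J(1)[of z] J(2)[of z'] by (auto simp: indicator_def)
  have cut': "d1 z = indicator {l<..<r} (X1 z) * d1 z" "d2 z' = indicator {l<..<r} (X2 z') * d2 z'" for z z'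
    using J(1)[of z] J(2)[of z'] by (auto simp: indicator_def)
  show ?thesis
  proof (rule integral_eq_on_intervals[OF d X _ _ B])
    fix u v
    have "(LINT z|M1. indicator {u<..<v} (X1 z) * d1 z) = (LINT z|M1. indicator {max u l<..<min v r} (X1 z) * d1 z)"
      by (intro Bochner_Integration.integral_cong refl cut)
    also have "\<dots> = (LINT z|M2. indicator {max u l<..<min v r} (X2 z) * d2 z)" by (rule step) auto
    also have "\<dots> = (LINT z|M2. indicator {u<..<v} (X2 z) * d2 z)"
      by (intro Bochner_Integration.integral_cong refl cut[symmetric])
    finally show "(LINT z|M1. indicator {u<..<v} (X1 z) * d1 z) = (LINT z|M2. indicator {u<..<v} (X2 z) * d2 z)" .
  next
    have "(LINT z|M1. d1 z) = (LINT z|M1. indicator {l<..<r} (X1 z) * d1 z)"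
      by (intro Bochner_Integration.integral_cong refl cut')
    also have "\<dots> = (LINT z|M2. indicator {l<..<r} (X2 z) * d2 z)" by (rule step) auto
    also have "\<dots> = (LINT z|M2. d2 z)" by (intro Bochner_Integration.integral_cong refl cut'[symmetric])
    finally show "(LINT z|M1. d1 z) = (LINT z|M2. d2 z)" .
  qed
qed

section \<open>The lower bound in a chart\<close>

text \<open>A lower bound for \<open>lifted_density\<close> that drops the purely angular part, where \<open>p\<close> has no spatial
  component.\<close>

definition low_density :: "(real \<Rightarrow> ennreal) \<Rightarrow> (real ^ 2) \<times> real \<Rightarrow> ennreal" where
  "low_density f p = ennreal (norm (fst p)) * f (snd p / norm (fst p))"

text \<open>An admissible measure \<open>\<sigma>\<close> of finite energy, seen near a boundary point. The rectangle of width and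
  height \<open>2 \<delta>\<close> in the coordinates \<open>Phi\<close> lies in the chart and contains the spatial supports of all
  test functions below.\<close>

locale chart_current = boundary_chart a g g' g'' E U
  for a g g' g'' E U +
  fixes \<Omega> :: "(real ^ 2) set" and \<sigma> :: "((real ^ 2) \<times> real) set \<Rightarrow> (real ^ 2) \<times> real" and p \<delta> :: real
  assumes open_Omega: "open \<Omega>" and U_sub: "U \<subseteq> \<Omega>"
    and bvm: "bounded_vector_measure (phase_space \<Omega>) \<sigma>"
    and div_free: "divergence_free \<Omega> \<sigma>"
    and marginal: "marginal_is_rotated_gradient \<Omega> (indicator E) \<sigma>"
    and delta: "0 < \<delta>"
    and rect: "\<And>t s. t \<in> {p - \<delta>..p + \<delta>} \<Longrightarrow> s \<in> {- \<delta>..\<delta>} \<Longrightarrow> Phi (t, s) \<in> U"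
    and ray: "AE z in total_variation (phase_space \<Omega>) \<sigma>.
      fst (polar_density (phase_space \<Omega>) \<sigma> z) = norm (fst (polar_density (phase_space \<Omega>) \<sigma> z)) *\<^sub>R angle_vec (snd z)"
begin

abbreviation "T \<equiv> total_variation (phase_space \<Omega>) \<sigma>"
abbreviation "q \<equiv> polar_density (phase_space \<Omega>) \<sigma>"
abbreviation "X z \<equiv> fst z \<bullet> e1"
abbreviation "J \<equiv> {p - \<delta><..<p + \<delta>}"
definition "K = Phi ` ({p - \<delta>..p + \<delta>} \<times> {- \<delta>..\<delta>})"
definition "eta u v n x = itv_bump u v n (x \<bullet> e1) * sqpos (1 - height x * (height x * (1 / \<delta>\<^sup>2)))"

lemma compact_K: "compact K" and K_sub: "K \<subseteq> U"
  unfolding K_def using rect by (auto intro!: compact_continuous_image continuous_Phi compact_Times)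

lemma not_in_K:
  assumes "x \<notin> K" shows "x \<bullet> e1 \<notin> {p - \<delta>..p + \<delta>} \<or> height x \<notin> {- \<delta>..\<delta>}"
proof (rule ccontr)
  assume "\<not> ?thesis"
  then have "Phi (x \<bullet> e1, height x) \<in> K" unfolding K_def by blast
  then show False using assms Phi_inverse by simp
qed

lemma C1_eta: "\<exists>H. C1_gradient (eta u v n) H"
proof -
  obtain B where B: "C1_gradient (itv_bump u v n) B" using C1_itv_bump by blast
  show ?thesis unfolding eta_def[abs_def]
    by (intro exI, (rule C1_gradient_mult C1_gradient_diff C1_gradient_const C1_height
        C1_gradient_compose[OF C1_gradient_inner B] C1_gradient_compose[OF _ C1_gradient_sqpos])+)
qed

lemma eta_outside:
  assumes "p - \<delta> \<le> u" "v \<le> p + \<delta>" "x \<notin> K" shows "eta u v n x = 0"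
  using not_in_K[OF assms(3)]
proof
  assume "x \<bullet> e1 \<notin> {p - \<delta>..p + \<delta>}"
  then show ?thesis using assms itv_bump_outside[of "x \<bullet> e1" u v n] by (auto simp: eta_def)
next
  assume h: "height x \<notin> {- \<delta>..\<delta>}"
  then have "\<delta>\<^sup>2 \<le> (height x)\<^sup>2" using delta by (auto simp: abs_le_square_iff[symmetric])
  then have "1 - height x * (height x * (1 / \<delta>\<^sup>2)) \<le> 0" using delta by (simp add: power2_eq_square field_simps)
  then show ?thesis by (simp add: eta_def)
qed

lemma eta_graph: "height x = 0 \<Longrightarrow> eta u v n x = itv_bump u v n (x \<bullet> e1)"
  by (simp add: eta_def)

lemma eta_test:
  assumes uv: "p - \<delta> \<le> u" "v \<le> p + \<delta>" and B: "C1_gradient B DB" "\<And>x \<theta>. B (x, \<theta> + 2 * pi) = B (x, \<theta>)"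
  shows "\<exists>DA. phase_test_fun \<Omega> (\<lambda>z. eta u v n (fst z) * B z) DA"
proof -
  obtain H where H: "C1_gradient (eta u v n) H" using C1_eta by blast
  have "C1_gradient (\<lambda>z. eta u v n (fst z) * B z) (\<lambda>z. eta u v n (fst z) *\<^sub>R DB z + B z *\<^sub>R (H (fst z), 0))"
    by (rule C1_gradient_mult[OF C1_gradient_fst[OF H] B(1)])
  moreover have "compact K" "K \<subseteq> \<Omega>" "\<forall>x \<theta>. x \<notin> K \<longrightarrow> eta u v n (fst (x, \<theta>)) * B (x, \<theta>) = 0"
    using compact_K subset_trans[OF K_sub U_sub] eta_outside[OF uv] by simp_all
  moreover have "\<forall>x \<theta>. eta u v n (fst (x, \<theta> + 2 * pi)) * B (x, \<theta> + 2 * pi) = eta u v n (fst (x, \<theta>)) * B (x, \<theta>)"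
    by (simp only: fst_conv B(2)) simp
  ultimately show ?thesis unfolding phase_test_fun_iff by (intro exI conjI) assumption+
qed

lemma integrable_q: "integrable T q"
  by (rule integrable_polar_density[OF bvm])

lemma borel_q: "q \<in> borel_measurable T"
  by (rule borel_measurable_integrable[OF integrable_q])

lemma borel_T: "F \<in> borel_measurable borel \<Longrightarrow> F \<in> borel_measurable T"
  by (subst measurable_cong_sets[OF sets_total_variation refl]) (rule borel_phase_space)

lemma borel_T_continuous: "continuous_on UNIV F \<Longrightarrow> F \<in> borel_measurable T"
  by (intro borel_T borel_measurable_continuous_onI)

lemma borel_X: "X \<in> borel_measurable T"
  by (intro borel_T_continuous continuous_intros)

lemma borel_T_coord [measurable]: "F \<in> borel_measurable borel \<Longrightarrow> (\<lambda>z. F (X z)) \<in> borel_measurable T" for F :: "real \<Rightarrow> _"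
  by (rule measurable_compose[OF borel_X])

lemma continuous_height_fst: "continuous_on UNIV (\<lambda>z :: (real ^ 2) \<times> real. height (fst z))"
  by (rule C1_gradient_continuous[OF C1_gradient_fst[OF C1_height]])

text \<open>Deviation of the phase angle from the tangent angle of the graph, and the component of the direction
  across the graph.\<close>

definition "normal_part z = conormal (X z) \<bullet> angle_vec (snd z)"
definition "deviation z = snd z - angle (X z)"

lemma normal_part_eq: "normal_part z = speed (X z) * sin (deviation z)"
  by (simp add: normal_part_def conormal_eq inner_angle_vec deviation_def cos_diff cos_add sin_add sin_diff)

lemma tangent_part_eq: "tangent (X z) \<bullet> angle_vec (snd z) = speed (X z) * cos (deviation z)"
  by (simp add: tangent_eq inner_angle_vec deviation_def cos_diff mult.commute)

lemma C1_X: "C1_gradient (\<lambda>z :: (real ^ 2) \<times> real. X z) (\<lambda>z. (e1, 0))"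
  by (rule C1_gradient_fst[OF C1_gradient_inner])

lemma C1_snd: "C1_gradient (\<lambda>z :: (real ^ 2) \<times> real. snd z) (\<lambda>z. (0, 1))"
  using C1_gradient_snd[OF C1_gradient_inner[of "1 :: real"]] by simp

lemma C1_deviation: "C1_gradient deviation (\<lambda>z. (0, 1) - angle' (X z) *\<^sub>R (e1, 0))"
  unfolding deviation_def[abs_def] by (intro C1_gradient_diff C1_snd C1_gradient_compose[OF C1_X C1_angle])

lemma C1_sin: "C1_gradient sin (cos :: real \<Rightarrow> real)" and C1_cos: "C1_gradient cos (\<lambda>x :: real. - sin x)"
  by (auto simp: C1_gradient_real intro!: derivative_eq_intros continuous_intros)

lemma continuous_deviation: "continuous_on UNIV deviation"
  by (rule C1_gradient_continuous[OF C1_deviation])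

lemma deviation_periodic: "sin (deviation (x, \<theta> + 2 * pi)) = sin (deviation (x, \<theta>))"
  "cos (deviation (x, \<theta> + 2 * pi)) = cos (deviation (x, \<theta>))"
  using sin_periodic[of "deviation (x, \<theta>)"] cos_periodic[of "deviation (x, \<theta>)"]
  by (simp_all add: deviation_def algebra_simps)

lemma C1_normal_part: "\<exists>D. C1_gradient normal_part D"
proof -
  have "normal_part = (\<lambda>z. cos (snd z - (a + pi / 2)) - g' (X z) * cos (snd z - a))"
    by (simp add: fun_eq_iff normal_part_def conormal_def inner_diff_left e1_def e2_def inner_angle_vec)
       (metis cos_minus minus_diff_eq)
  then show ?thesis
    by (simp only:)
       (intro exI, (rule C1_gradient_diff C1_gradient_mult C1_gradient_const C1_snd
          C1_gradient_compose[OF C1_X C1_g'] C1_gradient_compose[OF _ C1_cos])+)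
qed

text \<open>Over the graph, \<open>\<sigma>\<close> only moves along the graph, forwards or backwards. The test function is
  multiplied by \<open>normal_part\<close>, to which the spatial density is proportional by \<open>ray\<close>; this turns the
  vanishing integral into one with a nonnegative integrand.\<close>

lemma polar_tangential:
  "AE z in T. height (fst z) = 0 \<and> X z \<in> J \<longrightarrow> norm (fst (q z)) = 0 \<or> sin (deviation z) = 0"
proof -
  let ?eta = "eta (p - \<delta>) (p + \<delta>) (Suc 0)"
  obtain DB where DB: "C1_gradient normal_part DB" using C1_normal_part by blast
  have per: "normal_part (x, \<theta> + 2 * pi) = normal_part (x, \<theta>)" for x \<theta>
    by (simp add: normal_part_def)
  obtain DA where DA: "phase_test_fun \<Omega> (\<lambda>z. ?eta (fst z) * normal_part z) DA"
    using eta_test[OF _ _ DB per, of "p - \<delta>" "p + \<delta>"] by auto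
  define F where "F z = (if height (fst z) = 0 \<and> (0::real) = 0 then 1 else 0) *
      (?eta (fst z) * normal_part z * ((conormal (X z), 0) \<bullet> q z))" for z
  have iF: "integrable T F" and zF: "(LINT z|T. F z) = 0"
    unfolding F_def
    using divergence_free_concentrate[OF bvm div_free DA C1_gradient_fst[OF C1_height] _ C1_gradient_const[of 0]]
    by simp_all
  have F_eq: "AE z in T. F z = (if height (fst z) = 0 then 1 else 0) * ?eta (fst z) * norm (fst (q z)) * (normal_part z)\<^sup>2"
    using ray
  proof eventually_elim
    case (elim z)
    have "(conormal (X z), 0) \<bullet> q z = norm (fst (q z)) * normal_part z"
      by (subst inner_prod_def, subst elim) (simp add: normal_part_def)
    then show ?case by (simp add: F_def power2_eq_square)
  qed
  have eta0: "0 \<le> ?eta x" for x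
    using itv_bump_bounds by (simp add: eta_def)
  have "AE z in T. 0 \<le> F z" using F_eq by eventually_elim (auto intro!: mult_nonneg_nonneg eta0)
  then have "AE z in T. F z = 0" using integral_nonneg_eq_0_iff_AE[OF iF] zF by simp
  then show ?thesis using F_eq
  proof eventually_elim
    case (elim z)
    show ?case
    proof (intro impI)
      assume h: "height (fst z) = 0 \<and> X z \<in> J"
      then have "0 < ?eta (fst z)" using itv_bump_pos[of "X z" "p - \<delta>" "p + \<delta>" "Suc 0"] by (simp add: eta_graph)
      then show "norm (fst (q z)) = 0 \<or> sin (deviation z) = 0"
        using elim h by (auto simp: normal_part_eq)
    qed
  qed
qed

lemma compact_interval_bound:
  assumes "continuous_on UNIV (F :: real \<Rightarrow> 'z::real_normed_vector)"
  obtains C where "0 \<le> C" "\<And>t. t \<in> J \<Longrightarrow> norm (F t) \<le> C"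
proof -
  have "compact (F ` {p - \<delta>..p + \<delta>})"
    using assms by (intro compact_continuous_image) (auto intro: continuous_on_subset)
  then obtain C where "0 < C" "\<And>t. t \<in> {p - \<delta>..p + \<delta>} \<Longrightarrow> norm (F t) \<le> C"
    using compact_imp_bounded[of "F ` {p - \<delta>..p + \<delta>}"] unfolding bounded_pos by (metis image_eqI)
  then show ?thesis using that[of C] by auto
qed

definition "flux z = (if height (fst z) = 0 \<and> X z \<in> J then tangent (X z) \<bullet> fst (q z) else 0)"

lemma borel_fst_q: "(\<lambda>z. fst (q z)) \<in> borel_measurable T" and borel_snd_q: "(\<lambda>z. snd (q z)) \<in> borel_measurable T"
proof -
  have "(fst :: (real ^ 2) \<times> real \<Rightarrow> _) \<in> borel_measurable borel" "(snd :: (real ^ 2) \<times> real \<Rightarrow> _) \<in> borel_measurable borel"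
    by (intro borel_measurable_continuous_onI continuous_intros)+
  from measurable_compose[OF borel_q this(1)] measurable_compose[OF borel_q this(2)]
  show "(\<lambda>z. fst (q z)) \<in> borel_measurable T" "(\<lambda>z. snd (q z)) \<in> borel_measurable T" .
qed

lemma on_graph_sets: "{z \<in> space T. height (fst z) = 0 \<and> X z \<in> J} \<in> sets T"
proof -
  have [measurable]: "(\<lambda>z. height (fst z)) \<in> borel_measurable T" "X \<in> borel_measurable T"
    by (rule borel_T_continuous[OF continuous_height_fst], rule borel_X)
  show ?thesis by measurable
qed

lemma integrable_flux: "integrable T flux"
proof -
  obtain C where C: "0 \<le> C" "\<And>t. t \<in> J \<Longrightarrow> norm (tangent t) \<le> C"
    using compact_interval_bound[OF continuous_tangent] by blast
  show ?thesis
  proof (rule Bochner_Integration.integrable_bound[of _ "\<lambda>z. C * norm (q z)"])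
    have "(\<lambda>z. tangent (X z) \<bullet> fst (q z)) \<in> borel_measurable T"
      by (intro borel_measurable_inner borel_T_coord borel_tangent borel_fst_q)
    then show "flux \<in> borel_measurable T"
      unfolding flux_def[abs_def] by (intro measurable_If on_graph_sets) simp_all
    show "AE z in T. norm (flux z) \<le> norm (C * norm (q z))"
    proof (rule AE_I2)
      fix z
      show "norm (flux z) \<le> norm (C * norm (q z))"
      proof (cases "height (fst z) = 0 \<and> X z \<in> J")
        case True
        have "\<bar>tangent (X z) \<bullet> fst (q z)\<bar> \<le> norm (tangent (X z)) * norm (fst (q z))" by (rule Cauchy_Schwarz_ineq2)
        also have "\<dots> \<le> C * norm (q z)" using C True norm_fst_le[of "fst (q z)" "snd (q z)"] by (intro mult_mono) auto
        finally show ?thesis using True C(1) by (simp add: flux_def)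
      qed (auto simp: flux_def)
    qed
  qed (use integrable_q in simp)
qed

lemma perp_conormal: "perp (conormal t) = tangent t"
  by (rule frame_eqI)
     (simp_all add: conormal_def tangent_def e1_def e2_def inner_vec2 perp_def cos_add sin_add algebra_simps)

lemma perp_scaleR: "perp (r *\<^sub>R x) = r *\<^sub>R perp x"
  by (simp add: vec2_eq_iff perp_def)

text \<open>The flux of the rotated gradient across the graph, tested with fields along the conormal that
  concentrate on the graph.\<close>

lemma flux_bump:
  assumes uv: "p - \<delta> \<le> u" "v \<le> p + \<delta>"
  shows "(LINT z|T. itv_bump u v n (X z) * flux z) = (LINT t|lborel. itv_bump u v n t * (indicator J t * (speed t)\<^sup>2))"
proof -
  obtain H where H: "C1_gradient (eta u v n) H" using C1_eta by blast
  define \<phi> where "\<phi> m x = (eta u v n x * peak (real (Suc m)) (height x)) *\<^sub>R conormal (x \<bullet> e1)" for m x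
  have perp_\<phi>: "perp (\<phi> m x) = (eta u v n x * peak (real (Suc m)) (height x)) *\<^sub>R tangent (x \<bullet> e1)" for m x
    by (simp add: \<phi>_def perp_scaleR perp_conormal)
  have eq: "(LINT z|T. (perp (\<phi> m (fst z)), 0) \<bullet> q z) = (LINT t|lborel. itv_bump u v n t * (indicator J t * (speed t)\<^sup>2))" for m
  proof -
    obtain D where D: "C1_gradient (\<lambda>x. eta u v n x * peak (real (Suc m)) (height x)) D"
      using C1_gradient_mult[OF H C1_gradient_compose[OF C1_height C1_peak]] by blast
    have "C1_gradient (\<lambda>x. 0 - eta u v n x * peak (real (Suc m)) (height x) * g' (x \<bullet> e1))
       (\<lambda>x. 0 - ((eta u v n x * peak (real (Suc m)) (height x)) *\<^sub>R (g'' (x \<bullet> e1) *\<^sub>R e1) + g' (x \<bullet> e1) *\<^sub>R D x))"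
      by (intro C1_gradient_diff C1_gradient_const C1_gradient_mult D C1_gradient_compose[OF C1_gradient_inner C1_g'])
    from plane_fieldI[OF D this, of e2 e1]
    obtain Jac where Jac: "\<And>x. ((\<lambda>x. (eta u v n x * peak (real (Suc m)) (height x)) *\<^sub>R e2 +
        (0 - eta u v n x * peak (real (Suc m)) (height x) * g' (x \<bullet> e1)) *\<^sub>R e1) has_derivative (\<lambda>h. Jac x *v h)) (at x)"
      "continuous_on UNIV Jac" by blast
    have "(\<lambda>x. (eta u v n x * peak (real (Suc m)) (height x)) *\<^sub>R e2 +
        (0 - eta u v n x * peak (real (Suc m)) (height x) * g' (x \<bullet> e1)) *\<^sub>R e1) = \<phi> m"
      by (simp add: fun_eq_iff \<phi>_def conormal_def scaleR_diff_right)
    with Jac have "plane_test_field U (\<phi> m) Jac"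
      using compact_K K_sub eta_outside[OF uv] unfolding plane_test_field_def
      by (auto intro!: exI[of _ K] simp: \<phi>_def)
    moreover from this have "plane_test_field \<Omega> (\<phi> m) Jac"
      using U_sub unfolding plane_test_field_def by blast
    ultimately have "vector_integral (phase_space \<Omega>) (\<lambda>z. (perp (\<phi> m (fst z)), 0)) \<sigma>
        = (LINT t|lborel. perp (\<phi> m (pt t)) \<bullet> tangent t)"
      using marginal divergence_chart(2)[OF U_sub] unfolding marginal_is_rotated_gradient_def by simp
    also have "\<dots> = (LINT t|lborel. itv_bump u v n t * (indicator J t * (speed t)\<^sup>2))"
    proof (intro Bochner_Integration.integral_cong refl)
      fix t
      have "tangent t \<bullet> tangent t = (speed t)\<^sup>2" by (simp add: norm_tangent power2_norm_eq_inner[symmetric])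
      then show "perp (\<phi> m (pt t)) \<bullet> tangent t = itv_bump u v n t * (indicator J t * (speed t)\<^sup>2)"
        using itv_bump_outside[of t u v n] uv
        by (cases "t \<in> {u<..<v}") (auto simp: perp_\<phi> eta_graph peak_bounds indicator_def)
    qed
    finally show ?thesis by (simp add: vector_integral_def)
  qed
  obtain C where C: "0 \<le> C" "\<And>t. t \<in> J \<Longrightarrow> norm (tangent t) \<le> C"
    using compact_interval_bound[OF continuous_tangent] by blast
  have eta01: "\<bar>eta u v n x\<bar> \<le> 1" for x
  proof -
    have "sqpos (1 - height x * (height x * (1 / \<delta>\<^sup>2))) \<le> 1"
      by (intro sqpos_le_1) (simp add: zero_le_mult_iff divide_nonneg_nonneg mult.assoc[symmetric])
    then show ?thesis using itv_bump_bounds[of u v n "x \<bullet> e1"]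
      by (simp add: eta_def abs_mult) (intro mult_le_one, auto)
  qed
  have eta_J: "eta u v n x = 0" if "x \<bullet> e1 \<notin> J" for x
    using itv_bump_outside[of "x \<bullet> e1" u v n] uv that by (auto simp: eta_def)
  have "(\<lambda>m. LINT z|T. (perp (\<phi> m (fst z)), 0) \<bullet> q z) \<longlonglongrightarrow> (LINT z|T. itv_bump u v n (X z) * flux z)"
  proof (rule integral_dominated_convergence[where w="\<lambda>z. C * norm (q z)"])
    show "integrable T (\<lambda>z. C * norm (q z))" using integrable_q by simp
    have "itv_bump u v n \<in> borel_measurable borel"
      using C1_itv_bump C1_gradient_continuous borel_measurable_continuous_onI by blast
    then show "(\<lambda>z. itv_bump u v n (X z) * flux z) \<in> borel_measurable T"
      using borel_measurable_integrable[OF integrable_flux] borel_T_coord by (intro borel_measurable_times)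
    show "(\<lambda>z. (perp (\<phi> m (fst z)), 0) \<bullet> q z) \<in> borel_measurable T" for m
    proof (intro borel_measurable_inner borel_q borel_T_continuous continuous_on_Pair continuous_on_const)
      have "continuous_on UNIV (\<lambda>z :: (real ^ 2) \<times> real. eta u v n (fst z))" "continuous_on UNIV (\<lambda>z :: (real ^ 2) \<times> real. peak (real (Suc m)) (height (fst z)))"
        using C1_gradient_continuous[OF C1_gradient_fst[OF H]]
          C1_gradient_continuous[OF C1_gradient_compose[OF C1_gradient_fst[OF C1_height] C1_peak]] by auto
      moreover have "continuous_on UNIV (\<lambda>z :: (real ^ 2) \<times> real. tangent (X z))"
        by (rule continuous_on_compose2[OF continuous_tangent[of UNIV] C1_gradient_continuous[OF C1_X]]) simp
      ultimately show "continuous_on UNIV (\<lambda>z :: (real ^ 2) \<times> real. perp (\<phi> m (fst z)))"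
        unfolding perp_\<phi> by (intro continuous_intros)
    qed
    show "AE z in T. (\<lambda>m. (perp (\<phi> m (fst z)), 0) \<bullet> q z) \<longlonglongrightarrow> itv_bump u v n (X z) * flux z"
    proof (rule AE_I2)
      fix z
      have "(\<lambda>m. (eta u v n (fst z) * peak (real (Suc m)) (height (fst z))) * (tangent (X z) \<bullet> fst (q z)))
          \<longlonglongrightarrow> (eta u v n (fst z) * (if height (fst z) = 0 then 1 else 0)) * (tangent (X z) \<bullet> fst (q z))"
        by (intro tendsto_intros peak_tendsto)
      also have "(eta u v n (fst z) * (if height (fst z) = 0 then 1 else 0)) * (tangent (X z) \<bullet> fst (q z)) = itv_bump u v n (X z) * flux z"
        using eta_J[of "fst z"] eta_graph[of "fst z" u v n] itv_bump_outside[of "X z" u v n] uv by (auto simp: flux_def)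
      finally show "(\<lambda>m. (perp (\<phi> m (fst z)), 0) \<bullet> q z) \<longlonglongrightarrow> itv_bump u v n (X z) * flux z"
        by (simp add: perp_\<phi> inner_prod_def)
    qed
    show "AE z in T. norm ((perp (\<phi> m (fst z)), 0) \<bullet> q z) \<le> C * norm (q z)" for m
    proof (rule AE_I2)
      fix z
      show "norm ((perp (\<phi> m (fst z)), 0) \<bullet> q z) \<le> C * norm (q z)"
      proof (cases "X z \<in> J")
        case True
        have "\<bar>eta u v n (fst z) * peak (real (Suc m)) (height (fst z))\<bar> \<le> 1"
          using eta01[of "fst z"] peak_bounds(1,2)[of "real (Suc m)" "height (fst z)"]
          by (simp only: abs_mult) (intro mult_le_one, auto)
        then have "norm (perp (\<phi> m (fst z))) \<le> 1 * C"
          unfolding perp_\<phi> norm_scaleR using C True by (intro mult_mono) auto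
        then have "norm (perp (\<phi> m (fst z)), 0 :: real) * norm (q z) \<le> C * norm (q z)"
          by (intro mult_right_mono) (auto simp: norm_Pair)
        then show ?thesis using Cauchy_Schwarz_ineq2[of "(perp (\<phi> m (fst z)), 0)" "q z"] by simp
      next
        case False
        then show ?thesis using eta_J C(1) by (simp add: perp_\<phi> inner_prod_def)
      qed
    qed
  qed
  then show ?thesis unfolding eq by (simp add: LIMSEQ_const_iff)
qed

lemma integrable_speed_sq: "integrable lborel (\<lambda>t. indicator J t * (speed t)\<^sup>2)"
proof -
  have "integrable lborel (\<lambda>t. indicator {p - \<delta>..p + \<delta>} t *\<^sub>R (speed t)\<^sup>2)"
    by (intro borel_integrable_compact continuous_intros continuous_speed) simp
  then have "integrable lborel (\<lambda>t. indicator J t *\<^sub>R (indicator {p - \<delta>..p + \<delta>} t *\<^sub>R (speed t)\<^sup>2))"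
    by (rule integrable_mult_indicator[rotated]) simp
  moreover have "(\<lambda>t. indicator J t *\<^sub>R (indicator {p - \<delta>..p + \<delta>} t *\<^sub>R (speed t)\<^sup>2)) = (\<lambda>t. indicator J t * (speed t)\<^sup>2)"
    by (auto simp: fun_eq_iff indicator_def)
  ultimately show ?thesis by (simp only:)
qed

lemma flux_eq:
  assumes "B \<in> sets borel"
  shows "(LINT z|T. indicator B (X z) * flux z) = (LINT t|lborel. indicator B t * (indicator J t * (speed t)\<^sup>2))"
  by (rule integral_eq_on_bumps[OF integrable_flux integrable_speed_sq borel_X _ _ _ flux_bump assms])
     (auto simp: flux_def)

text \<open>The part of the angular density that the curvature of the graph does not account for, on the lift of
  the graph by its tangent angle.\<close>

definition "bend z = (if height (fst z) = 0 \<and> cos (deviation z) = 1 \<and> X z \<in> J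
    then snd (q z) - angle' (X z) * (fst (q z) \<bullet> e1) else 0)"

lemma lifted_sets: "{z \<in> space T. height (fst z) = 0 \<and> cos (deviation z) = 1 \<and> X z \<in> J} \<in> sets T"
proof -
  have [measurable]: "(\<lambda>z. height (fst z)) \<in> borel_measurable T" "X \<in> borel_measurable T"
      "(\<lambda>z. cos (deviation z)) \<in> borel_measurable T"
    using borel_T_continuous[OF continuous_height_fst] borel_X
      borel_T_continuous[OF continuous_on_cos[OF continuous_deviation]] by auto
  show ?thesis by measurable
qed

lemma borel_bend: "bend \<in> borel_measurable T"
proof -
  have "(\<lambda>z. snd (q z) - angle' (X z) * (fst (q z) \<bullet> e1)) \<in> borel_measurable T"
    using borel_fst_q borel_snd_q borel_T_coord[OF borel_angle']
    by (intro borel_measurable_diff borel_measurable_times borel_measurable_inner) auto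
  then show ?thesis unfolding bend_def[abs_def] by (intro measurable_If lifted_sets) simp_all
qed

lemma integrable_bend: "integrable T bend"
proof -
  obtain C where C: "0 \<le> C" "\<And>t. t \<in> J \<Longrightarrow> norm (angle' t) \<le> C"
    using compact_interval_bound[OF continuous_angle'] by blast
  show ?thesis
  proof (rule Bochner_Integration.integrable_bound[of _ "\<lambda>z. (1 + C) * norm (q z)"])
    show "AE z in T. norm (bend z) \<le> norm ((1 + C) * norm (q z))"
    proof (rule AE_I2)
      fix z
      show "norm (bend z) \<le> norm ((1 + C) * norm (q z))"
      proof (cases "height (fst z) = 0 \<and> cos (deviation z) = 1 \<and> X z \<in> J")
        case True
        have "\<bar>fst (q z) \<bullet> e1\<bar> \<le> norm (fst (q z)) * norm e1" by (rule Cauchy_Schwarz_ineq2)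
        also have "\<dots> \<le> norm (q z)" using norm_fst_le[of "fst (q z)" "snd (q z)"] by (simp add: norm_eq_sqrt_inner[of e1])
        finally have "\<bar>angle' (X z)\<bar> * \<bar>fst (q z) \<bullet> e1\<bar> \<le> C * norm (q z)"
          using C True by (intro mult_mono) auto
        moreover have "\<bar>snd (q z)\<bar> \<le> norm (q z)" using norm_snd_le[of "snd (q z)" "fst (q z)"] by simp
        moreover have "\<bar>snd (q z) - angle' (X z) * (fst (q z) \<bullet> e1)\<bar> \<le> \<bar>snd (q z)\<bar> + \<bar>angle' (X z)\<bar> * \<bar>fst (q z) \<bullet> e1\<bar>"
          by (metis abs_mult abs_triangle_ineq4)
        ultimately show ?thesis using True C(1) by (simp add: bend_def algebra_simps)
      qed (auto simp: bend_def)
    qed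
  qed (use integrable_q borel_bend in simp_all)
qed

text \<open>Concentration on \<open>sin (deviation z) = 0\<close> does not distinguish the tangent angle from the opposite
  one; the factor \<open>(1 + cos (deviation z)) / 2\<close> removes the latter.\<close>

lemma bend_bump:
  assumes uv: "p - \<delta> \<le> u" "v \<le> p + \<delta>"
  shows "(LINT z|T. itv_bump u v n (X z) * bend z) = 0"
proof -
  define B where "B z = (1 + cos (deviation z)) * (1 / 2)" for z
  have BC: "\<exists>DB. C1_gradient B DB" unfolding B_def[abs_def]
    by (intro exI, (rule C1_gradient_mult C1_gradient_add C1_gradient_const C1_gradient_compose[OF C1_deviation C1_cos])+)
  then obtain DB where DB: "C1_gradient B DB" by blast
  have per: "B (x, \<theta> + 2 * pi) = B (x, \<theta>)" for x \<theta> by (simp only: B_def deviation_periodic)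
  obtain DA where DA: "phase_test_fun \<Omega> (\<lambda>z. eta u v n (fst z) * B z) DA"
    using eta_test[OF uv DB per] by blast
  have "(LINT z|T. (if sin (deviation z) = 0 \<and> height (fst z) = 0 then 1 else 0) *
      (eta u v n (fst z) * B z * ((cos (deviation z) *\<^sub>R ((0, 1) - angle' (X z) *\<^sub>R (e1, 0))) \<bullet> q z))) = 0"
    by (rule divergence_free_concentrate(2)[OF bvm div_free DA C1_gradient_compose[OF C1_deviation C1_sin] _ C1_gradient_fst[OF C1_height]])
       (simp_all only: deviation_periodic fst_conv)
  moreover have "(if sin (deviation z) = 0 \<and> height (fst z) = 0 then 1 else 0) *
      (eta u v n (fst z) * B z * ((cos (deviation z) *\<^sub>R ((0, 1) - angle' (X z) *\<^sub>R (e1, 0))) \<bullet> q z)) = itv_bump u v n (X z) * bend z" for z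
  proof (cases "sin (deviation z) = 0 \<and> height (fst z) = 0 \<and> X z \<in> J")
    case True
    then have "cos (deviation z) = 1 \<or> cos (deviation z) = -1"
      using sin_cos_squared_add[of "deviation z"] by (simp add: power2_eq_1_iff)
    then show ?thesis using True
      by (auto simp: B_def eta_graph bend_def inner_prod_def inner_diff_left inner_commute)
  next
    case False
    have "bend z = 0 \<or> (height (fst z) = 0 \<and> sin (deviation z) = 0 \<and> X z \<in> J)"
      using cos_one_sin_zero[of "deviation z"] by (auto simp: bend_def)
    moreover have "height (fst z) = 0 \<and> X z \<notin> J \<Longrightarrow> eta u v n (fst z) = 0"
      using itv_bump_outside[of "X z" u v n] uv by (auto simp: eta_graph)
    ultimately show ?thesis using False by auto
  qed
  ultimately show ?thesis by simp
qed

lemma bend_integral: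
  assumes "B \<in> sets borel" shows "(LINT z|T. indicator B (X z) * bend z) = 0"
proof -
  have "(LINT z|T. indicator B (X z) * bend z) = (LINT t|lborel. indicator B t * (0::real))"
  proof (rule integral_eq_on_bumps[OF integrable_bend _ borel_X _ _ _ _ assms])
    show "bend z = 0" if "X z \<notin> J" for z using that unfolding bend_def by presburger
    show "(LINT z|T. itv_bump u v n (X z) * bend z) = (LINT t|lborel. itv_bump u v n t * 0)"
      if "p - \<delta> \<le> u" "v \<le> p + \<delta>" for u v n
      using bend_bump[OF that] by simp
  qed simp_all
  then show ?thesis by simp
qed

text \<open>The coordinate \<open>X\<close> is injective on the lift of the graph. So every Borel set on the lift is cut
  out by a condition on \<open>X\<close>, and \<open>bend\<close> vanishes almost everywhere.\<close>

lemma bend_zero: "AE z in T. bend z = 0"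
proof -
  \<comment> \<open>The lift as a function of \<open>X\<close>; \<open>b\<close> extends \<open>bend\<close> to a Borel function on the whole space.\<close>
  define L where "L t = (pt t, circ (angle t))" for t
  define b where "b z = (if z \<in> \<Omega> \<times> {0..<2 * pi} then bend z else 0)" for z
  have space_T: "space T = \<Omega> \<times> {0..<2 * pi}"
    by (simp add: phase_space_def space_restrict_space)
  have L_meas: "L \<in> borel_measurable borel" unfolding L_def[abs_def]
    by (intro borel_measurable_Pair borel_pt measurable_compose[OF borel_angle borel_circ])
  have [measurable]: "\<Omega> \<times> {0..<2 * pi} \<in> sets (borel :: ((real ^ 2) \<times> real) measure)"
    using open_Omega by (simp add: borel_prod[symmetric])
  have "bend \<in> borel_measurable (restrict_space borel (\<Omega> \<times> {0..<2 * pi}))"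
    using borel_bend by (simp add: phase_space_def cong: measurable_cong_sets)
  then have b_meas: "b \<in> borel_measurable borel"
    unfolding b_def[abs_def] by (subst measurable_restrict_space_iff[symmetric]) auto
  have bL: "(\<lambda>t. b (L t)) \<in> borel_measurable borel" by (rule measurable_compose[OF L_meas b_meas])
  have onL: "L (X z) = z" if "bend z \<noteq> 0" "z \<in> space T" for z
  proof -
    have "height (fst z) = 0" "cos (snd z - angle (X z)) = 1" using that(1) by (auto simp: bend_def deviation_def split: if_splits)
    then show ?thesis using that(2) height_eq_0_iff[of "fst z"] circ_eqI[of "snd z" "angle (X z)"] space_T
      by (cases z) (auto simp: L_def)
  qed
  have sgn: "AE z in T. max 0 (r * bend z) = 0" if r: "r = 1 \<or> r = -1" for r :: real
  proof -
    let ?B = "{t. 0 < r * b (L t)}"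
    have B: "?B \<in> sets borel" using bL by measurable
    have "(LINT z|T. max 0 (r * bend z)) = (LINT z|T. r * (indicator ?B (X z) * bend z))"
    proof (intro Bochner_Integration.integral_cong refl)
      fix z assume z: "z \<in> space T"
      show "max 0 (r * bend z) = r * (indicator ?B (X z) * bend z)"
        using onL[OF _ z] z space_T by (cases "bend z = 0") (auto simp: b_def indicator_def)
    qed
    also have "\<dots> = 0" using bend_integral[OF B] by simp
    finally show ?thesis
      using integrable_bend by (subst integral_nonneg_eq_0_iff_AE[symmetric]) auto
  qed
  show ?thesis using sgn[of 1] sgn[of "-1"] by (auto elim!: AE_mp)
qed

definition "on_lift z \<longleftrightarrow> height (fst z) = 0 \<and> cos (deviation z) = 1 \<and> X z \<in> J"

text \<open>On the lift, the direction is the tangent of the graph, whose component along \<open>e1\<close> is the inverse of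
  the speed. So the vanishing of \<open>bend\<close> says that the angle turns at the rate \<open>kappa\<close>.\<close>

lemma lift_curvature: "AE z in T. on_lift z \<longrightarrow> snd (q z) = kappa (X z) * norm (fst (q z))"
  using bend_zero ray
proof eventually_elim
  case (elim z)
  show ?case
  proof
    assume l: "on_lift z"
    have "cos (snd z - angle (X z)) = 1" using l by (simp add: on_lift_def deviation_def)
    then have "angle_vec (angle (X z) + (snd z - angle (X z))) = angle_vec (angle (X z))"
      using cos_one_sin_zero[of "snd z - angle (X z)"] by (subst angle_vec_add) simp
    then have av: "angle_vec (snd z) = angle_vec (angle (X z))" by simp
    have "angle_vec (angle (X z)) \<bullet> e1 = 1 / speed (X z)"
      using tangent_inner(1)[of "X z"] unfolding tangent_eq by (simp add: field_simps)
    then have "fst (q z) \<bullet> e1 = norm (fst (q z)) * (1 / speed (X z))"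
      by (subst elim(2)) (simp add: av)
    then show "snd (q z) = kappa (X z) * norm (fst (q z))"
      using elim(1) l by (simp add: bend_def on_lift_def kappa_def)
  qed
qed

lemma flux_le: "AE z in T. flux z \<le> (if on_lift z then speed (X z) * norm (fst (q z)) else 0)"
  using ray polar_tangential
proof eventually_elim
  case (elim z)
  show ?case
  proof (cases "height (fst z) = 0 \<and> X z \<in> J")
    case True
    have fl: "flux z = norm (fst (q z)) * (speed (X z) * cos (deviation z))"
      unfolding flux_def using True by (subst elim(1)) (simp add: tangent_part_eq)
    show ?thesis
    proof (cases "norm (fst (q z)) = 0")
      case False
      then have "cos (deviation z) = 1 \<or> cos (deviation z) = -1"
        using elim(2) True sin_cos_squared_add[of "deviation z"] by (simp add: power2_eq_1_iff)
      then show ?thesis using True fl by (auto simp: on_lift_def mult_le_0_iff less_imp_le)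
    qed (use fl in simp)
  qed (auto simp: flux_def on_lift_def)
qed

lemma on_lift_sets: "{z \<in> space T. on_lift z} \<in> sets T"
  unfolding on_lift_def by (rule lifted_sets)

definition "lift_speed z = (if on_lift z then ennreal (speed (X z) * norm (fst (q z))) else 0)"

lemma borel_lift_speed: "lift_speed \<in> borel_measurable T"
proof -
  have "(\<lambda>z. ennreal (speed (X z) * norm (fst (q z)))) \<in> borel_measurable T"
    using borel_fst_q borel_T_coord[OF borel_speed]
    by (intro measurable_compose[OF _ measurable_ennreal] borel_measurable_times
        measurable_compose[OF borel_fst_q borel_measurable_norm])
  then show ?thesis unfolding lift_speed_def[abs_def] by (intro measurable_If on_lift_sets) simp_all
qed

text \<open>The lift of the graph carries at least the length of the graph, because tangent directions with
  the wrong orientation only diminish the flux.\<close>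

lemma lift_length_le:
  "density lborel (\<lambda>t. ennreal (indicator J t * (speed t)\<^sup>2)) \<le> distr (density T lift_speed) borel X"
proof (subst le_measure)
  show "\<forall>B\<in>sets (density lborel (\<lambda>t. ennreal (indicator J t * (speed t)\<^sup>2))).
      emeasure (density lborel (\<lambda>t. ennreal (indicator J t * (speed t)\<^sup>2))) B \<le> emeasure (distr (density T lift_speed) borel X) B"
  proof
    fix B assume "B \<in> sets (density lborel (\<lambda>t. ennreal (indicator J t * (speed t)\<^sup>2)))"
    then have B: "B \<in> sets borel" by simp
    have iB: "integrable lborel (\<lambda>t. indicator B t * (indicator J t * (speed t)\<^sup>2))"
      using integrable_mult_indicator[OF _ integrable_speed_sq, of B] B by simp
    have "emeasure (density lborel (\<lambda>t. ennreal (indicator J t * (speed t)\<^sup>2))) B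
        = (\<integral>\<^sup>+t. ennreal (indicator B t * (indicator J t * (speed t)\<^sup>2)) \<partial>lborel)"
      using B by (subst emeasure_density) (auto intro!: nn_integral_cong split: split_indicator)
    also have "\<dots> = ennreal (LINT t|lborel. indicator B t * (indicator J t * (speed t)\<^sup>2))"
      using iB by (intro nn_integral_eq_integral) auto
    also have "\<dots> = ennreal (LINT z|T. indicator B (X z) * flux z)" by (simp only: flux_eq[OF B])
    also have "\<dots> \<le> ennreal (LINT z|T. max 0 (indicator B (X z) * flux z))"
    proof -
      have "integrable T (\<lambda>z. indicator (X -` B \<inter> space T) z *\<^sub>R flux z)"
        using measurable_sets[OF borel_X B] integrable_flux by (rule integrable_mult_indicator)
      then have i: "integrable T (\<lambda>z. indicator B (X z) * flux z)"
        by (rule Bochner_Integration.integrable_cong[THEN iffD1, rotated 2]) (auto simp: indicator_def)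
      then have i': "integrable T (\<lambda>z. max 0 (indicator B (X z) * flux z))" by simp
      show ?thesis by (intro ennreal_leI integral_mono i i') simp
    qed
    also have "\<dots> \<le> (\<integral>\<^sup>+z. ennreal (max 0 (indicator B (X z) * flux z)) \<partial>T)"
      by (cases "integrable T (\<lambda>z. max 0 (indicator B (X z) * flux z))")
         (simp_all add: nn_integral_eq_integral not_integrable_integral_eq)
    also have "\<dots> \<le> (\<integral>\<^sup>+z. lift_speed z * indicator B (X z) \<partial>T)"
    proof (rule nn_integral_mono_AE)
      show "AE z in T. ennreal (max 0 (indicator B (X z) * flux z)) \<le> lift_speed z * indicator B (X z)"
        using flux_le
      proof eventually_elim
        case (elim z)
        have "0 \<le> speed (X z) * norm (fst (q z))" by (simp add: less_imp_le)
        then show ?case using elim by (auto simp: lift_speed_def indicator_def max_def intro!: ennreal_leI split: if_splits)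
      qed
    qed
    also have "\<dots> = emeasure (distr (density T lift_speed) borel X) B"
    proof -
      have X': "X \<in> measurable (density T lift_speed) borel" using borel_X by simp
      have "emeasure (distr (density T lift_speed) borel X) B = (\<integral>\<^sup>+z. lift_speed z * indicator (X -` B \<inter> space T) z \<partial>T)"
        using emeasure_distr[OF X' B] emeasure_density[OF borel_lift_speed, of "X -` B \<inter> space T"] measurable_sets[OF borel_X B]
        by simp
      also have "\<dots> = (\<integral>\<^sup>+z. lift_speed z * indicator B (X z) \<partial>T)"
        by (intro nn_integral_cong) (auto simp: indicator_def)
      finally show ?thesis by simp
    qed
    finally show "emeasure (density lborel (\<lambda>t. ennreal (indicator J t * (speed t)\<^sup>2))) B
        \<le> emeasure (distr (density T lift_speed) borel X) B" .
  qed
qed simp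

text \<open>By \<open>lift_curvature\<close>, the energy density on the lift is \<open>f (kappa)\<close> times the spatial density, and
  the latter dominates length.\<close>

lemma chart_energy_le:
  assumes f: "f \<in> borel_measurable borel" and B: "B \<in> sets borel"
  shows "(\<integral>\<^sup>+t. indicator B t * (indicator J t * (f (kappa t) * ennreal (speed t))) \<partial>lborel)
    \<le> (\<integral>\<^sup>+z. (if on_lift z then indicator B (X z) * low_density f (q z) else 0) \<partial>T)"
proof -
  \<comment> \<open>One factor of the speed is already present in the measures compared by \<open>lift_length_le\<close>.\<close>
  define F where "F t = indicator B t * (f (kappa t) * ennreal (1 / speed t))" for t
  have F: "F \<in> borel_measurable borel"
    unfolding F_def[abs_def] using f B measurable_compose[OF borel_kappa f] by measurable
  have "(\<integral>\<^sup>+t. indicator B t * (indicator J t * (f (kappa t) * ennreal (speed t))) \<partial>lborel)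
      = (\<integral>\<^sup>+t. ennreal (indicator J t * (speed t)\<^sup>2) * F t \<partial>lborel)"
  proof (rule nn_integral_cong)
    fix t
    have "ennreal (speed t) = ennreal ((speed t)\<^sup>2) * ennreal (1 / speed t)"
      by (subst ennreal_mult[symmetric]) (auto simp: less_imp_le power2_eq_square)
    then show "indicator B t * (indicator J t * (f (kappa t) * ennreal (speed t))) = ennreal (indicator J t * (speed t)\<^sup>2) * F t"
      by (auto simp: F_def indicator_def mult_ac)
  qed
  also have "\<dots> = (\<integral>\<^sup>+t. F t \<partial>density lborel (\<lambda>t. ennreal (indicator J t * (speed t)\<^sup>2)))"
    using F by (intro nn_integral_density[symmetric]) auto
  also have "\<dots> \<le> (\<integral>\<^sup>+t. F t \<partial>distr (density T lift_speed) borel X)"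
    by (rule nn_integral_mono_measure[OF _ lift_length_le]) simp
  also have "\<dots> = (\<integral>\<^sup>+z. F (X z) \<partial>density T lift_speed)"
    using F borel_X by (intro nn_integral_distr) simp_all
  also have "\<dots> = (\<integral>\<^sup>+z. lift_speed z * F (X z) \<partial>T)"
    by (intro nn_integral_density borel_lift_speed borel_T_coord F)
  also have "\<dots> \<le> (\<integral>\<^sup>+z. (if on_lift z then indicator B (X z) * low_density f (q z) else 0) \<partial>T)"
  proof (rule nn_integral_mono_AE)
    show "AE z in T. lift_speed z * F (X z) \<le> (if on_lift z then indicator B (X z) * low_density f (q z) else 0)"
      using lift_curvature
    proof eventually_elim
      case (elim z)
      show ?case
      proof (cases "on_lift z \<and> norm (fst (q z)) \<noteq> 0")
        case True
        then have "snd (q z) / norm (fst (q z)) = kappa (X z)" using elim by simp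
        moreover have "ennreal (speed (X z) * norm (fst (q z))) * ennreal (1 / speed (X z)) = ennreal (norm (fst (q z)))"
          by (subst ennreal_mult[symmetric]) (auto simp: less_imp_le)
        ultimately show ?thesis using True by (simp add: lift_speed_def F_def low_density_def mult_ac)
      qed (auto simp: lift_speed_def)
    qed
  qed
  finally show ?thesis .
qed

definition "cell = {x. x \<bullet> e1 \<in> J \<and> height x \<in> {- \<delta><..<\<delta>}}"

lemma open_cell: "open cell"
proof -
  have "open ((\<lambda>x. x \<bullet> e1) -` J)" "open (height -` {- \<delta><..<\<delta>})"
    by (intro open_vimage open_greaterThanLessThan continuous_intros C1_gradient_continuous[OF C1_height])+
  from open_Int[OF this] show ?thesis by (simp add: cell_def vimage_def Int_def)
qed

lemma cell_sub: "cell \<subseteq> U"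
proof
  fix x assume "x \<in> cell"
  then show "x \<in> U" using rect[of "x \<bullet> e1" "height x"] Phi_inverse[of x] by (auto simp: cell_def)
qed

lemma cell_energy_le:
  assumes f: "f \<in> borel_measurable borel" and A: "A \<in> sets borel" "A \<subseteq> cell"
  shows "(\<integral>\<^sup>+x. indicator A x * (indicator (frontier E \<inter> \<Omega>) x * f (curvature E x)) \<partial>hausdorff1)
    \<le> (\<integral>\<^sup>+z. indicator A (fst z) * low_density f (q z) \<partial>T)"
proof -
  have AU: "A \<subseteq> U" using A(2) cell_sub by blast
  let ?B = "pt -` A"
  have B: "?B \<in> sets borel" using measurable_sets[OF borel_pt A(1)] by simp
  have F: "(\<lambda>x. indicator A x * f (kappa (x \<bullet> e1))) \<in> borel_measurable borel"
    using A(1) measurable_compose[OF borel_e1 measurable_compose[OF borel_kappa f]] by measurable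
  have "(\<integral>\<^sup>+x. indicator A x * (indicator (frontier E \<inter> \<Omega>) x * f (curvature E x)) \<partial>hausdorff1)
      = (\<integral>\<^sup>+x\<in>graph. indicator A x * f (kappa (x \<bullet> e1)) \<partial>hausdorff1)"
  proof (rule nn_integral_cong)
    fix x
    show "indicator A x * (indicator (frontier E \<inter> \<Omega>) x * f (curvature E x)) = indicator A x * f (kappa (x \<bullet> e1)) * indicator graph x"
    proof (cases "x \<in> A")
      case True
      then have "x \<in> U" "x \<in> \<Omega>" using AU U_sub by auto
      then show ?thesis using frontier_iff[of x] boundary_point(2)[of x] by (auto simp: graph_def indicator_def)
    qed simp
  qed
  also have "\<dots> = (\<integral>\<^sup>+t. indicator A (pt t) * f (kappa (pt t \<bullet> e1)) * ennreal (speed t) \<partial>lborel)"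
    by (rule nn_integral_graph[OF F])
  also have "\<dots> = (\<integral>\<^sup>+t. indicator ?B t * (indicator J t * (f (kappa t) * ennreal (speed t))) \<partial>lborel)"
  proof (rule nn_integral_cong)
    fix t
    have "pt t \<in> A \<Longrightarrow> t \<in> J" using A(2) by (auto simp: cell_def)
    then show "indicator A (pt t) * f (kappa (pt t \<bullet> e1)) * ennreal (speed t) = indicator ?B t * (indicator J t * (f (kappa t) * ennreal (speed t)))"
      by (auto simp: indicator_def)
  qed
  also have "\<dots> \<le> (\<integral>\<^sup>+z. (if on_lift z then indicator ?B (X z) * low_density f (q z) else 0) \<partial>T)"
    by (rule chart_energy_le[OF f B])
  also have "\<dots> \<le> (\<integral>\<^sup>+z. indicator A (fst z) * low_density f (q z) \<partial>T)"
  proof (rule nn_integral_mono)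
    fix z
    show "(if on_lift z then indicator ?B (X z) * low_density f (q z) else 0) \<le> indicator A (fst z) * low_density f (q z)"
      using height_eq_0_iff[of "fst z"] by (auto simp: on_lift_def indicator_def)
  qed
  finally show ?thesis .
qed

end

section \<open>The energy of a set with regular boundary\<close>

text \<open>Countably many of the neighbourhoods cover \<open>G\<close>, and the inequality adds up over the pieces of the
  disjointed cover.\<close>

lemma emeasure_le_of_local_le:
  fixes N1 N2 :: "'a::second_countable_topology measure"
  assumes sets: "sets N1 = sets borel" "sets N2 = sets borel" and G: "G \<in> sets borel"
    and local: "\<And>x. x \<in> G \<Longrightarrow> \<exists>R. open R \<and> x \<in> R \<and> (\<forall>A\<in>sets borel. A \<subseteq> R \<longrightarrow> emeasure N1 A \<le> emeasure N2 A)"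
  shows "emeasure N1 G \<le> emeasure N2 UNIV"
proof -
  define Q where "Q R \<longleftrightarrow> open R \<and> (\<forall>A\<in>sets borel. A \<subseteq> R \<longrightarrow> emeasure N1 A \<le> emeasure N2 A)" for R
  have "open R" if "R \<in> Collect Q" for R using that by (simp add: Q_def)
  then obtain \<U> where \<U>: "\<U> \<subseteq> Collect Q" "countable \<U>" "\<Union>\<U> = \<Union>(Collect Q)" by (rule Lindelof)
  have cover: "G \<subseteq> \<Union>\<U>" unfolding \<U>(3) using local unfolding Q_def by blast
  show ?thesis
  proof (cases "\<U> = {}")
    case False
    define R where "R = from_nat_into \<U>"
    have R: "Q (R i)" for i using from_nat_into[OF False, of i] \<U>(1) by (auto simp: R_def)
    have UR: "(\<Union>i. R i) = \<Union>\<U>" using range_from_nat_into[OF False \<U>(2)] by (simp add: R_def)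
    define A where "A i = G \<inter> disjointed R i" for i
    have "R i \<in> sets borel" for i using R[of i] by (simp add: Q_def)
    then have "range (disjointed R) \<subseteq> sets borel" by (intro sets.range_disjointed_sets) auto
    then have A: "A i \<in> sets borel" "A i \<subseteq> R i" for i
      using G disjointed_subset[of R i] by (auto simp: A_def)
    have dis: "disjoint_family A" using disjoint_family_disjointed[of R]
      by (auto simp: A_def disjoint_family_on_def)
    have UA: "(\<Union>i. A i) = G" using cover UR UN_disjointed_eq[of R] by (auto simp: A_def)
    have "emeasure N1 G = (\<Sum>i. emeasure N1 (A i))"
      unfolding UA[symmetric] using A sets dis by (intro suminf_emeasure[symmetric]) auto
    also have "\<dots> \<le> (\<Sum>i. emeasure N2 (A i))"
    proof (intro suminf_le summableI)
      show "emeasure N1 (A i) \<le> emeasure N2 (A i)" for i using R[of i] A[of i] unfolding Q_def by blast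
    qed
    also have "\<dots> = emeasure N2 (\<Union>i. A i)" using A sets dis by (intro suminf_emeasure) auto
    also have "\<dots> \<le> emeasure N2 UNIV" using sets by (intro emeasure_mono) auto
    finally show ?thesis .
  qed (use cover in simp)
qed

lemma borel_measurable_lsc_fun:
  assumes "lsc_fun f" shows "f \<in> borel_measurable borel"
proof -
  have "open {t. c < f t}" for c
  proof (rule Topological_Spaces.openI)
    fix t assume "t \<in> {t. c < f t}"
    then have t: "c < f t" by simp
    also have "f t \<le> Liminf (at t) f" using assms by (simp add: lsc_fun_def)
    finally have "\<forall>\<^sub>F s in at t. c < f s" by (rule less_LiminfD)
    then have "\<forall>\<^sub>F s in nhds t. c < f s" using t by (simp add: eventually_nhds_conv_at)
    then show "\<exists>T. open T \<and> t \<in> T \<and> T \<subseteq> {t. c < f t}" by (auto simp: eventually_nhds)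
  qed
  then have "{t \<in> space borel. c < f t} \<in> sets borel" for c by simp
  then show ?thesis by (rule borel_measurableI_greater)
qed

lemma low_density_le: "low_density f p \<le> lifted_density f \<theta> p"
  by (auto simp: low_density_def lifted_density_def)

text \<open>Elsewhere the integrand is infinite.\<close>

lemma (in C2_set) ray_of_finite_energy:
  assumes bvm: "bounded_vector_measure (phase_space \<Omega>) \<sigma>" and fin: "lifted_energy f \<Omega> \<sigma> < \<infinity>"
  shows "AE z in total_variation (phase_space \<Omega>) \<sigma>.
      fst (polar_density (phase_space \<Omega>) \<sigma> z) = norm (fst (polar_density (phase_space \<Omega>) \<sigma> z)) *\<^sub>R angle_vec (snd z)"
proof -
  let ?T = "total_variation (phase_space \<Omega>) \<sigma>" and ?q = "polar_density (phase_space \<Omega>) \<sigma>"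
  let ?bad = "{z \<in> space ?T. fst (?q z) \<noteq> norm (fst (?q z)) *\<^sub>R angle_vec (snd z)}"
  have "?q \<in> borel_measurable ?T"
    by (rule borel_measurable_integrable[OF integrable_polar_density[OF bvm]])
  then have q1: "(\<lambda>z. fst (?q z)) \<in> borel_measurable ?T" by (rule measurable_compose[OF _ borel_fst])
  have "(\<lambda>z :: (real ^ 2) \<times> real. angle_vec (snd z)) \<in> borel_measurable borel"
    by (rule measurable_compose[OF borel_snd borel_angle_vec])
  then have av: "(\<lambda>z. angle_vec (snd z)) \<in> borel_measurable ?T"
    using phase_space_measurable by (subst measurable_cong_sets[OF sets_total_variation refl])
  have bad: "?bad \<in> sets ?T"
  proof -
    have "(\<lambda>z. norm (fst (?q z)) *\<^sub>R angle_vec (snd z)) \<in> borel_measurable ?T"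
      by (intro borel_measurable_scaleR measurable_compose[OF q1 borel_measurable_norm] av)
    with q1 show ?thesis by measurable
  qed
  have inf: "lifted_density f (snd z) (?q z) = \<infinity>" if "z \<in> ?bad" for z
  proof -
    have "fst (?q z) \<noteq> 0" using that by auto
    moreover have "\<not> (\<exists>r\<ge>0. fst (?q z) = r *\<^sub>R angle_vec (snd z))" using that by auto
    ultimately show ?thesis by (auto simp: lifted_density_def)
  qed
  have "(\<integral>\<^sup>+z. \<infinity> * indicator ?bad z \<partial>?T) \<le> lifted_energy f \<Omega> \<sigma>"
    unfolding lifted_energy_def by (intro nn_integral_mono) (use inf in \<open>auto simp: indicator_def\<close>)
  then have "\<infinity> * emeasure ?T ?bad < \<infinity>"
    using fin bad by (simp add: nn_integral_cmult_indicator)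
  then have "emeasure ?T ?bad = 0" by (simp add: ennreal_mult_less_top)
  then show ?thesis using bad by (intro AE_I'[of ?bad]) auto
qed

text \<open>Both sides are the total masses of measures on the plane, which can be compared locally.\<close>

lemma (in C2_set) energy_ge:
  assumes f: "f \<in> borel_measurable borel"
    and bvm: "bounded_vector_measure (phase_space \<Omega>) \<sigma>" and div: "divergence_free \<Omega> \<sigma>"
    and marg: "marginal_is_rotated_gradient \<Omega> (indicator E) \<sigma>"
  shows "(\<integral>\<^sup>+x\<in>\<Gamma>. f (curvature E x) \<partial>hausdorff1) \<le> lifted_energy f \<Omega> \<sigma>"
proof (cases "lifted_energy f \<Omega> \<sigma> < \<infinity>")
  case True
  let ?T = "total_variation (phase_space \<Omega>) \<sigma>" and ?q = "polar_density (phase_space \<Omega>) \<sigma>"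
  note ray = ray_of_finite_energy[OF bvm True]
  have q: "?q \<in> borel_measurable ?T"
    by (rule borel_measurable_integrable[OF integrable_polar_density[OF bvm]])
  have fst_T: "fst \<in> borel_measurable ?T"
    by (subst measurable_cong_sets[OF sets_total_variation refl]) (rule phase_space_measurable[OF borel_fst])
  have low: "(\<lambda>z. low_density f (?q z)) \<in> borel_measurable ?T"
  proof -
    have n: "(\<lambda>z. norm (fst (?q z))) \<in> borel_measurable ?T"
      by (rule measurable_compose[OF measurable_compose[OF q borel_fst] borel_measurable_norm])
    have "(\<lambda>z. snd (?q z) / norm (fst (?q z))) \<in> borel_measurable ?T"
      by (intro borel_measurable_divide n measurable_compose[OF q borel_snd])
    then show ?thesis unfolding low_density_def
      by (intro borel_measurable_times_ennreal measurable_compose[OF n measurable_ennreal] measurable_compose[OF _ f])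
  qed
  define N1 where "N1 = density hausdorff1 (\<lambda>x. indicator \<Gamma> x * f (kap x))"
  define N2 where "N2 = distr (density ?T (\<lambda>z. low_density f (?q z))) borel fst"
  have N1: "emeasure N1 A = (\<integral>\<^sup>+x. indicator A x * (indicator \<Gamma> x * f (curvature E x)) \<partial>hausdorff1)" if "A \<in> sets borel" for A
  proof -
    have "(\<lambda>x. indicator \<Gamma> x * f (kap x)) \<in> borel_measurable hausdorff1"
      using measurable_compose[OF borel_kap f] borel_Gamma by measurable
    then have "emeasure N1 A = (\<integral>\<^sup>+x. indicator \<Gamma> x * f (kap x) * indicator A x \<partial>hausdorff1)"
      unfolding N1_def using that by (intro emeasure_density) auto
    also have "\<dots> = (\<integral>\<^sup>+x. indicator A x * (indicator \<Gamma> x * f (curvature E x)) \<partial>hausdorff1)"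
      by (intro nn_integral_cong) (auto simp: indicator_def boundary_curvature_def)
    finally show ?thesis .
  qed
  have N2: "emeasure N2 A = (\<integral>\<^sup>+z. indicator A (fst z) * low_density f (?q z) \<partial>?T)" if A: "A \<in> sets borel" for A
  proof -
    have fst': "fst \<in> measurable (density ?T (\<lambda>z. low_density f (?q z))) borel" using fst_T by simp
    have "emeasure N2 A = emeasure (density ?T (\<lambda>z. low_density f (?q z))) (fst -` A \<inter> space ?T)"
      unfolding N2_def using emeasure_distr[OF fst' A] by simp
    also have "\<dots> = (\<integral>\<^sup>+z. low_density f (?q z) * indicator (fst -` A \<inter> space ?T) z \<partial>?T)"
      by (intro emeasure_density low measurable_sets[OF fst_T A])
    also have "\<dots> = (\<integral>\<^sup>+z. indicator A (fst z) * low_density f (?q z) \<partial>?T)"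
      by (intro nn_integral_cong) (auto simp: indicator_def)
    finally show ?thesis .
  qed
  have "(\<integral>\<^sup>+x\<in>\<Gamma>. f (curvature E x) \<partial>hausdorff1) = emeasure N1 \<Gamma>"
    by (subst N1[OF borel_Gamma], intro nn_integral_cong) (auto simp: indicator_def)
  also have "\<dots> \<le> emeasure N2 UNIV"
  proof (rule emeasure_le_of_local_le[OF _ _ borel_Gamma])
    fix x assume "x \<in> \<Gamma>"
    then obtain a g g' g'' U where U: "boundary_chart a g g' g'' E U" "x \<in> U" "U \<subseteq> \<Omega>"
      by (rule boundary_chart_exists[OF C2 open_Omega])
    interpret boundary_chart a g g' g'' E U by (rule U(1))
    have hx: "height x = 0" using \<open>x \<in> \<Gamma>\<close> U(2) frontier_iff by blast
    have "open (Phi -` U)" by (rule open_vimage[OF open_U continuous_Phi])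
    moreover have "(x \<bullet> e1, 0) \<in> Phi -` U" using Phi_inverse[of x] hx U(2) by simp
    ultimately obtain r where r: "0 < r" "ball (x \<bullet> e1, 0) r \<subseteq> Phi -` U"
      unfolding open_contains_ball by blast
    have "chart_current a g g' g'' E U \<Omega> \<sigma> (x \<bullet> e1) (r / 3)"
    proof unfold_locales
      fix t s assume ts: "t \<in> {x \<bullet> e1 - r / 3..x \<bullet> e1 + r / 3}" "s \<in> {- (r / 3)..r / 3}"
      have "dist (x \<bullet> e1, 0) (t, s) \<le> \<bar>x \<bullet> e1 - t\<bar> + \<bar>s\<bar>"
        using norm_Pair_le[of "x \<bullet> e1 - t" "0 - s"] by (simp add: dist_norm)
      also have "\<dots> < r" using ts r(1) by (simp add: abs_le_iff) linarith
      finally show "Phi (t, s) \<in> U" using r(2) by auto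
    qed (use open_Omega U bvm div marg r(1) ray in auto)
    then interpret chart_current a g g' g'' E U \<Omega> \<sigma> "x \<bullet> e1" "r / 3" .
    have "x \<in> cell" using hx r(1) by (simp add: cell_def)
    moreover have "emeasure N1 A \<le> emeasure N2 A" if "A \<in> sets borel" "A \<subseteq> cell" for A
      using cell_energy_le[OF f that] by (simp add: N1 N2 that)
    ultimately show "\<exists>R. open R \<and> x \<in> R \<and> (\<forall>A\<in>sets borel. A \<subseteq> R \<longrightarrow> emeasure N1 A \<le> emeasure N2 A)"
      using open_cell by blast
  qed (simp_all add: N1_def N2_def)
  also have "\<dots> \<le> lifted_energy f \<Omega> \<sigma>"
    unfolding lifted_energy_def by (subst N2) (auto intro!: nn_integral_mono low_density_le)
  finally show ?thesis .
qed (simp add: less_top[symmetric])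

theorem theorem1:
  fixes \<Omega> E :: "(real ^ 2) set" and f :: "real \<Rightarrow> ennreal" and \<gamma> :: real
  assumes "lipschitz_domain \<Omega>"
    and "convex_fun f" and "lsc_fun f"
    and "0 < \<gamma>" and "\<And>t. ennreal (\<gamma> * sqrt (1 + t\<^sup>2)) \<le> f t"
    and "E \<subseteq> \<Omega>" and "C2_boundary_in \<Omega> E"
  shows "roto_translation_energy f \<Omega> (indicator E) =
    (\<integral>\<^sup>+ x \<in> frontier E \<inter> \<Omega>. f (curvature E x) \<partial>hausdorff1)"
proof (rule antisym)
  interpret C2_set \<Omega> E
    using assms(1,7) by unfold_locales (auto simp: lipschitz_domain_def)
  have f: "f \<in> borel_measurable borel" using assms(3) by (rule borel_measurable_lsc_fun)
  show "roto_translation_energy f \<Omega> (indicator E) \<le> (\<integral>\<^sup>+ x \<in> frontier E \<inter> \<Omega>. f (curvature E x) \<partial>hausdorff1)"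
    by (rule energy_le[OF f assms(4,5)])
  show "(\<integral>\<^sup>+ x \<in> frontier E \<inter> \<Omega>. f (curvature E x) \<partial>hausdorff1) \<le> roto_translation_energy f \<Omega> (indicator E)"
    unfolding roto_translation_energy_def by (rule Inf_greatest) (auto intro: energy_ge[OF f])
qed

end
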